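(* Let $n\ge1$. The $q$-Cartan matrix of $(\mathcal{W}_n^\sharp,* )$ is the restriction to rows and columns indexed by non-unitary set partitions of $[n]$ (set partitions without singleton blocks) of the $q$-Cartan matrix of $(\mathcal{W}_n,* )$, which is $$c_{\alpha,\beta}(q)=c_{\alpha,\beta}\,q^{\,l(\alpha)-l(\beta)},$$ where $l(\pi)$ is the number of blocks of $\pi$, $c_{\alpha,\beta}=0$ if $\alpha$ is not finer than (or equal to) $\beta$, and otherwise $c_{\alpha,\beta}=\prod_i(m_i-1)!$, where for each block $B_i$ of $\beta$, $m_i$ is the number of blocks of $\alpha$ into which $B_i$ is split. In particular, the vertices of the quiver of $\mathcal{W}_n^\sharp$ are the non-unitary set partitions of $[n]$, and there is an arrow $\alpha\to\beta$ whenever $\beta$ is obtained from $\alpha$ by merging two blocks.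
   Context: Let $\mathbb{K}$ be a field of characteristic $0$. A packed word is a word $u$ over the positive integers whose set of letters is $\{1,\dots,m\}$ for some $m=\max(u)$. $\mathcal{W}=\mathbf{WQSym}^*=\bigoplus_n\mathcal{W}_n$ has basis $\mathbf{N}_u$ over packed words $u$, $\mathcal{W}_n$ being spanned by those of length $n$. A packed word $u=u_1\cdots u_n$ encodes the set composition of $[n]$ whose $j$-th block is $\{i:u_i=j\}$; $\Pi(u)$ is the underlying set partition. Product: $\mathbf{N}_u\mathbf{N}_v=\sum_w\mathbf{N}_w$, over the words $w$ in the shuffle of $u$ with $v$ shifted by $\max(u)$. Internal product: for $u,v$ of the same length $\mathbf{N}_u*\mathbf{N}_v=\mathbf{N}_{\mathrm{pack}(u,v)}$, where $\mathrm{pack}(u,v)$ is the packed word obtained by replacing each biletter $(u_i,v_i)$ by its rank in the lexicographically ordered set of distinct occurring biletters. The unit of $(\mathcal{W}_n,* )$ is $S_n:=\mathbf{N}_{1^n}$. Let $S_n^\sharp=\sum_{i=0}^n(-1)^i\frac{\mathbf{N}_1^i}{i!}\mathbf{N}_{1^{n-i}}$ and $\mathcal{W}_n^\sharp=\{F*S_n^\sharp:F\in\mathcal{W}_n\}$, a unital algebra under $*$ with unit $S_n^\sharp$. The simple modules of $\mathcal{W}_n$ are one-dimensional, labelled by set partitions $\pi$ of $[n]$, with character $\chi_\pi(\mathbf{N}_u)=1$ if $\pi$ is finer than or equal to $\Pi(u)$ and $0$ otherwise; those of $\mathcal{W}_n^\sharp$ are labelled by non-unitary $\pi$ via restriction of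 $\chi_\pi$. For an algebra $B$ with simple modules so labelled and primitive idempotents $e_\pi$ labelled correspondingly, the $q$-Cartan invariants are $c_{\alpha,\beta}(q)=\sum_{k\ge0}q^k\dim\big[(e_\beta*\mathrm{rad}^kB*e_\alpha)/(e_\beta*\mathrm{rad}^{k+1}B*e_\alpha)\big]$, and the number of arrows $\alpha\to\beta$ in the quiver is the coefficient of $q^1$ in $c_{\alpha,\beta}(q)$. *)

theory Defs
  imports
    Complex_Main
    "HOL-Library.Poly_Mapping"
    "HOL-Library.Disjoint_Sets"
    "HOL-Computational_Algebra.Formal_Power_Series"
begin

section \<open>Packed words\<close>

definition max_letter :: "nat list \<Rightarrow> nat" where
  "max_letter u = Max (insert 0 (set u))"

definition packed :: "nat list \<Rightarrow> bool" where
  "packed u \<longleftrightarrow> set u = {1..max_letter u}"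

definition packed_words :: "nat \<Rightarrow> nat list set" where
  "packed_words n = {u. packed u \<and> length u = n}"

text \<open>Positions of words are numbered from 1, as in the mathematical notation.\<close>

definition word_partition :: "nat list \<Rightarrow> nat set set" where
  "word_partition u = (\<lambda>j. {i \<in> {1..length u}. u ! (i - 1) = j}) ` set u"

definition lex_le :: "nat \<times> nat \<Rightarrow> nat \<times> nat \<Rightarrow> bool" where
  "lex_le b c \<longleftrightarrow> fst b < fst c \<or> (fst b = fst c \<and> snd b \<le> snd c)"

definition pack :: "nat list \<Rightarrow> nat list \<Rightarrow> nat list" where
  "pack u v = map (\<lambda>b. card {c \<in> set (zip u v). lex_le c b}) (zip u v)"


section \<open>The algebra and its two products\<close>

text \<open>
  Elements are finitely supported functions on all words; those supported on packed words
  form the algebra with basis \<open>NN u\<close>, \<open>u\<close> packed.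
\<close>

type_synonym 'k wqsym = "nat list \<Rightarrow>\<^sub>0 'k"

definition NN :: "nat list \<Rightarrow> 'k::field wqsym" where
  "NN u = Poly_Mapping.single u 1"

definition wscale :: "'k::field \<Rightarrow> 'k wqsym \<Rightarrow> 'k wqsym" where
  "wscale c F = Poly_Mapping.map ((*) c) F"

lemma lookup_wscale: "Poly_Mapping.lookup (wscale c F) u = c * Poly_Mapping.lookup F u"
  by (simp add: wscale_def Poly_Mapping.map.rep_eq when_def)

interpretation wq: vector_space "wscale :: 'k::field \<Rightarrow> 'k wqsym \<Rightarrow> 'k wqsym"
  by unfold_locales
    (auto intro!: poly_mapping_eqI simp: lookup_wscale lookup_add algebra_simps)

definition bilinear_extension ::
    "(nat list \<Rightarrow> nat list \<Rightarrow> 'k wqsym) \<Rightarrow> 'k wqsym \<Rightarrow> 'k wqsym \<Rightarrow> 'k::field wqsym" where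
  "bilinear_extension p F G =
    (\<Sum>u\<in>Poly_Mapping.keys F. \<Sum>v\<in>Poly_Mapping.keys G.
      wscale (Poly_Mapping.lookup F u * Poly_Mapping.lookup G v) (p u v))"

text \<open>
  The letters of \<open>u\<close> are disjoint from those of the shifted \<open>v\<close>, so every word occurs at most once
  in the shuffle and the set of shuffles is enough.
\<close>

definition outer_product :: "'k::field wqsym \<Rightarrow> 'k wqsym \<Rightarrow> 'k wqsym" (infixl "\<bullet>" 70) where
  "F \<bullet> G = bilinear_extension
     (\<lambda>u v. \<Sum>w\<in>shuffles u (map (\<lambda>i. i + max_letter u) v). NN w) F G"

text \<open>Words of different lengths are given internal product 0; this is never used below.\<close>

definition internal_product :: "'k::field wqsym \<Rightarrow> 'k wqsym \<Rightarrow> 'k wqsym" (infixl "\<star>" 70) where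
  "F \<star> G = bilinear_extension
     (\<lambda>u v. if length u = length v then NN (pack u v) else 0) F G"

definition WQ :: "nat \<Rightarrow> 'k::field wqsym set" where
  "WQ n = wq.span (NN ` packed_words n)"

definition S_sharp :: "nat \<Rightarrow> 'k::field_char_0 wqsym" where
  "S_sharp n = (\<Sum>i\<le>n. wscale ((-1) ^ i / fact i)
     (((\<lambda>F. NN [1] \<bullet> F) ^^ i) (NN []) \<bullet> NN (replicate (n - i) 1)))"

definition WQ_sharp :: "nat \<Rightarrow> 'k::field_char_0 wqsym set" where
  "WQ_sharp n = (\<lambda>F. F \<star> S_sharp n) ` WQ n"


section \<open>Set partitions and characters\<close>

definition set_partitions :: "nat \<Rightarrow> nat set set set" where
  "set_partitions n = {\<pi>. partition_on {1..n} \<pi>}"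

definition nonunitary_partitions :: "nat \<Rightarrow> nat set set set" where
  "nonunitary_partitions n = {\<pi> \<in> set_partitions n. \<forall>A\<in>\<pi>. card A \<noteq> 1}"

definition merges_two_blocks :: "nat set set \<Rightarrow> nat set set \<Rightarrow> bool" where
  "merges_two_blocks \<alpha> \<beta> \<longleftrightarrow>
    (\<exists>A\<in>\<alpha>. \<exists>A'\<in>\<alpha>. A \<noteq> A' \<and> \<beta> = insert (A \<union> A') (\<alpha> - {A, A'}))"

definition chi :: "nat set set \<Rightarrow> 'k::field wqsym \<Rightarrow> 'k" where
  "chi \<pi> F = (\<Sum>u\<in>Poly_Mapping.keys F. Poly_Mapping.lookup F u *
     (if refines {1..length u} \<pi> (word_partition u) then 1 else 0))"


section \<open>Algebras under the internal product\<close>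

text \<open>
  Throughout, \<open>B\<close> is a linear subspace closed under \<open>\<star>\<close> and having a unit for it (not
  necessarily the unit of the ambient algebra).
\<close>

definition left_ideal :: "'k::field wqsym set \<Rightarrow> 'k wqsym set \<Rightarrow> bool" where
  "left_ideal B I \<longleftrightarrow> I \<subseteq> B \<and> wq.subspace I \<and> (\<forall>b\<in>B. \<forall>x\<in>I. b \<star> x \<in> I)"

definition maximal_left_ideal :: "'k::field wqsym set \<Rightarrow> 'k wqsym set \<Rightarrow> bool" where
  "maximal_left_ideal B M \<longleftrightarrow> left_ideal B M \<and> M \<noteq> B \<and>
     (\<forall>J. left_ideal B J \<longrightarrow> M \<subseteq> J \<longrightarrow> J = M \<or> J = B)"

definition rad :: "'k::field wqsym set \<Rightarrow> 'k wqsym set" where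
  "rad B = {x \<in> B. \<forall>M. maximal_left_ideal B M \<longrightarrow> x \<in> M}"

primrec rad_power :: "'k::field wqsym set \<Rightarrow> nat \<Rightarrow> 'k wqsym set" where
  "rad_power B 0 = B"
| "rad_power B (Suc k) = wq.span {x \<star> y | x y. x \<in> rad_power B k \<and> y \<in> rad B}"

definition idempotent_in :: "'k::field wqsym set \<Rightarrow> 'k wqsym \<Rightarrow> bool" where
  "idempotent_in B e \<longleftrightarrow> e \<in> B \<and> e \<star> e = e"

definition primitive_idempotent :: "'k::field wqsym set \<Rightarrow> 'k wqsym \<Rightarrow> bool" where
  "primitive_idempotent B e \<longleftrightarrow> idempotent_in B e \<and> e \<noteq> 0 \<and>
     (\<forall>f g. idempotent_in B f \<longrightarrow> idempotent_in B g \<longrightarrow> f \<star> g = 0 \<longrightarrow> g \<star> f = 0 \<longrightarrow>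
        e = f + g \<longrightarrow> f = 0 \<or> g = 0)"

text \<open>
  The idempotent \<open>e \<pi>\<close> corresponds to the simple module with character \<open>chi \<pi>\<close>: it acts as the
  identity on that module and as zero on the other ones.
\<close>

definition labelled_idempotents ::
    "'k::field wqsym set \<Rightarrow> nat set set set \<Rightarrow> (nat set set \<Rightarrow> 'k wqsym) \<Rightarrow> bool" where
  "labelled_idempotents B P e \<longleftrightarrow>
    (\<forall>\<pi>\<in>P. primitive_idempotent B (e \<pi>) \<and>
       (\<forall>\<sigma>\<in>P. chi \<sigma> (e \<pi>) = (if \<sigma> = \<pi> then 1 else 0)))"

text \<open>
  The powers of the radical decrease and all spaces are finite-dimensional, so the coefficient of
  \<open>q ^ k\<close>, a dimension of a quotient space, is a difference of dimensions.
\<close>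

definition q_cartan_invariant ::
    "'k::field wqsym set \<Rightarrow> (nat set set \<Rightarrow> 'k wqsym) \<Rightarrow> nat set set \<Rightarrow> nat set set \<Rightarrow> nat fps" where
  "q_cartan_invariant B e \<alpha> \<beta> = Abs_fps (\<lambda>k.
     wq.dim ((\<lambda>x. e \<beta> \<star> x \<star> e \<alpha>) ` rad_power B k) -
     wq.dim ((\<lambda>x. e \<beta> \<star> x \<star> e \<alpha>) ` rad_power B (Suc k)))"

text \<open>
  \<open>C\<close> is the \<open>q\<close>-Cartan matrix of \<open>B\<close>, with rows and columns indexed by \<open>P\<close>: labelled primitive
  idempotents exist, and every choice of them yields the entries of \<open>C\<close>.
  Entries of \<open>C\<close> outside \<open>P \<times> P\<close> are irrelevant.
\<close>

definition is_q_cartan_matrix ::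
    "'k::field wqsym set \<Rightarrow> nat set set set \<Rightarrow> (nat set set \<Rightarrow> nat set set \<Rightarrow> nat fps) \<Rightarrow> bool" where
  "is_q_cartan_matrix B P C \<longleftrightarrow>
    (\<exists>e. labelled_idempotents B P e) \<and>
    (\<forall>e. labelled_idempotents B P e \<longrightarrow>
       (\<forall>\<alpha>\<in>P. \<forall>\<beta>\<in>P. q_cartan_invariant B e \<alpha> \<beta> = C \<alpha> \<beta>))"

definition num_arrows ::
    "(nat set set \<Rightarrow> nat set set \<Rightarrow> nat fps) \<Rightarrow> nat set set \<Rightarrow> nat set set \<Rightarrow> nat" where
  "num_arrows C \<alpha> \<beta> = fps_nth (C \<alpha> \<beta>) 1"

definition partition_cartan :: "nat \<Rightarrow> nat set set \<Rightarrow> nat set set \<Rightarrow> nat" where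
  "partition_cartan n \<alpha> \<beta> =
    (if refines {1..n} \<alpha> \<beta> then \<Prod>B\<in>\<beta>. fact (card {A \<in> \<alpha>. A \<subseteq> B} - 1) else 0)"

text \<open>The truncated subtraction is harmless: the coefficient vanishes unless \<open>card \<beta> \<le> card \<alpha>\<close>.\<close>

definition partition_q_cartan :: "nat \<Rightarrow> nat set set \<Rightarrow> nat set set \<Rightarrow> nat fps" where
  "partition_q_cartan n \<alpha> \<beta> = of_nat (partition_cartan n \<alpha> \<beta>) * fps_X ^ (card \<alpha> - card \<beta>)"


section \<open>Simple modules and vertices of the quiver\<close>

text \<open>
  A left module over \<open>B\<close> (with unit \<open>one\<close>) is carried by a type \<open>'v\<close> with scalar
  multiplication \<open>s\<close> and action \<open>a\<close>.
\<close>

definition simple_module ::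
    "'k::field wqsym set \<Rightarrow> 'k wqsym \<Rightarrow> ('k \<Rightarrow> 'v \<Rightarrow> 'v) \<Rightarrow> ('k wqsym \<Rightarrow> 'v \<Rightarrow> 'v::ab_group_add) \<Rightarrow> bool" where
  "simple_module B one s a \<longleftrightarrow>
    vector_space s \<and>
    (\<forall>x\<in>B. Vector_Spaces.linear s s (a x)) \<and>
    (\<forall>x\<in>B. \<forall>y\<in>B. \<forall>v. a (x + y) v = a x v + a y v) \<and>
    (\<forall>c. \<forall>x\<in>B. \<forall>v. a (wscale c x) v = s c (a x v)) \<and>
    (\<forall>x\<in>B. \<forall>y\<in>B. \<forall>v. a (x \<star> y) v = a x (a y v)) \<and>
    (\<forall>v. a one v = v) \<and>
    (UNIV :: 'v set) \<noteq> {0} \<and>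
    (\<forall>U. module.subspace s U \<longrightarrow> (\<forall>x\<in>B. \<forall>v\<in>U. a x v \<in> U) \<longrightarrow> U = {0} \<or> U = UNIV)"

definition isomorphic_modules ::
    "'k::field wqsym set \<Rightarrow> ('k \<Rightarrow> 'v \<Rightarrow> 'v) \<Rightarrow> ('k wqsym \<Rightarrow> 'v \<Rightarrow> 'v::ab_group_add) \<Rightarrow>
     ('k \<Rightarrow> 'w \<Rightarrow> 'w) \<Rightarrow> ('k wqsym \<Rightarrow> 'w \<Rightarrow> 'w::ab_group_add) \<Rightarrow> bool" where
  "isomorphic_modules B s a s' a' \<longleftrightarrow>
    (\<exists>f. Vector_Spaces.linear s s' f \<and> bij f \<and> (\<forall>x\<in>B. \<forall>v. f (a x v) = a' x (f v)))"

text \<open>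
  The vertices of the quiver of \<open>B\<close> are the isomorphism classes of simple modules. They are
  labelled by \<open>P\<close> if sending \<open>\<pi>\<close> to the one-dimensional module with character \<open>chi \<pi>\<close> is a bijection
  from \<open>P\<close> to these classes. Surjectivity concerns the modules carried by the type \<open>'v\<close>, which is
  arbitrary.
\<close>

definition quiver_vertices_labelled ::
    "'v::ab_group_add itself \<Rightarrow> 'k::field wqsym set \<Rightarrow> 'k wqsym \<Rightarrow> nat set set set \<Rightarrow> bool" where
  "quiver_vertices_labelled _ B one P \<longleftrightarrow>
    (\<forall>\<pi>\<in>P. simple_module B one (*) (\<lambda>x c. chi \<pi> x * c)) \<and>
    (\<forall>\<pi>\<in>P. \<forall>\<sigma>\<in>P.
       isomorphic_modules B (*) (\<lambda>x c. chi \<pi> x * c) (*) (\<lambda>x c. chi \<sigma> x * c) \<longrightarrow> \<pi> = \<sigma>) \<and>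
    (\<forall>(s :: 'k \<Rightarrow> 'v \<Rightarrow> 'v) a. simple_module B one s a \<longrightarrow>
       (\<exists>\<pi>\<in>P. isomorphic_modules B (*) (\<lambda>x c. chi \<pi> x * c) s a))"

end

(*
  The algebra of packed words of length n is the algebra of a left regular band, whose support
  lattice is the lattice of set partitions. For a chosen word x_X of each support X, Saliola's
  recursion e_X = x_X - sum_{Y < X} x_X e_Y gives a complete orthogonal family of primitive
  idempotents, such that W e_X has the basis x e_X, where x runs through the words of support X.
  This makes e_Y W e_X vanish unless X refines Y, so the common kernel N of the characters is
  nilpotent, is the radical, and satisfies e_Y N^k e_X = 0 for k > l(X) - l(Y). For the converse
  inclusion e_Y W e_X <= N^(l(X) - l(Y)) it is enough that e_Y N e_X <= N^2 for
  l(X) - l(Y) >= 2. Now N e_X is spanned by the elements D = (x - x') e_X with x, x' differing by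
  the exchange of two consecutive blocks; the word y that merges them satisfies y D = D, and
  e_Y y lies in N since Y does not refine the support of y, so e_Y D = (e_Y y) D lies in N^2.
  The dimension of y W e_X, where y has support S, is the number of words of support X fixed by
  y. It is also the sum of dim e_Y W e_X over Y <= S, because idempotents with equal characters are
  conjugate. Removing a block of X gives the same recursion for the number of these words and for the
  corresponding sum of the products of the (m_i - 1)!, which determines dim e_Y W e_X.

  For the sharp algebra, N_u * S_n^# = 0 if u has a singleton block, hence F -> F * S_n^# is a
  surjective algebra homomorphism onto a corner algebra, and it maps radical powers to radical
  powers; the idempotents of the corner are idempotents of the whole algebra.
*)

theory Submission
  imports Defs "HOL-Combinatorics.Transposition"
begin

section \<open>Packed words as weak orders on positions\<close>

text \<open>The matrix is asked for every labelled family of primitive idempotents, and the radical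
  is given by maximal left ideals, so a computation with Saliola's family alone proves nothing yet.
  An abstract layer closes this gap for both algebras at once: for a unital algebra with characters
  whose common kernel is nilpotent, that kernel is the radical, idempotents with the prescribed
  characters are automatically primitive, and the dimensions of \<open>p V q\<close> depend only on
  the characters of \<open>p\<close> and \<open>q\<close>. No conjugating unit is built for the last
  point; compression from one corner to the other is shown to be injective. The number (m - 1)!
  counts cyclic arrangements of m blocks. Summed over all \<beta> between \<alpha> and the support
  of a word y, the products count the permutations of the blocks of \<alpha> that preserve the
  letters of y, and these are as numerous as the orderings of the blocks that are sorted by those
  letters, that is, the words of support \<alpha> fixed by y. In the sharp element, the sign and the
  factorial are what makes its product with a word having a singleton block telescope.\<close>

lemma lex_le_refl: "lex_le b b"
  by (simp add: lex_le_def)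

lemma lex_le_trans: "lex_le a b \<Longrightarrow> lex_le b c \<Longrightarrow> lex_le a c"
  by (auto simp: lex_le_def)

lemma lex_le_antisym: "lex_le a b \<Longrightarrow> lex_le b a \<Longrightarrow> a = b"
  by (auto simp: lex_le_def prod_eq_iff)

lemma lex_le_total: "lex_le a b \<or> lex_le b a"
  by (auto simp: lex_le_def)

text \<open>Lower sets of a total order are nested, and in a finite set a strict inclusion is seen
  by the cardinality.\<close>

lemma lex_rank_le_iff:
  assumes "finite Z" "b \<in> Z" "c \<in> Z"
  shows "card {z \<in> Z. lex_le z b} \<le> card {z \<in> Z. lex_le z c} \<longleftrightarrow> lex_le b c"
proof
  assume "lex_le b c"
  then show "card {z \<in> Z. lex_le z b} \<le> card {z \<in> Z. lex_le z c}"
    using assms by (intro card_mono) (auto intro: lex_le_trans)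
next
  assume le: "card {z \<in> Z. lex_le z b} \<le> card {z \<in> Z. lex_le z c}"
  show "lex_le b c"
  proof (rule ccontr)
    assume "\<not> lex_le b c"
    moreover from this have "lex_le c b"
      using lex_le_total by blast
    ultimately have "{z \<in> Z. lex_le z c} \<subset> {z \<in> Z. lex_le z b}"
      using assms lex_le_refl[of b] by (blast intro: lex_le_trans)
    then have "card {z \<in> Z. lex_le z c} < card {z \<in> Z. lex_le z b}"
      using assms by (intro psubset_card_mono) auto
    then show False using le by simp
  qed
qed

section \<open>The monoid of packed words under \<open>pack\<close>\<close>

lemma length_pack [simp]: "length (pack u v) = min (length u) (length v)"
  by (simp add: pack_def)

text \<open>Ranks matter only through the order of positions that they induce, here the
  lexicographic one. This comparison replaces the definition of \<open>pack\<close> in most of what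
  follows.\<close>

lemma pack_le_iff:
  assumes "length u = length v" "i < length u" "j < length u"
  shows "pack u v ! i \<le> pack u v ! j \<longleftrightarrow> u ! i < u ! j \<or> (u ! i = u ! j \<and> v ! i \<le> v ! j)"
proof -
  have mem: "(u ! k, v ! k) \<in> set (zip u v)" if "k < length u" for k
    using that assms by (metis in_set_conv_nth length_zip min.idem nth_zip)
  show ?thesis
    using lex_rank_le_iff[OF _ mem[OF assms(2)] mem[OF assms(3)]] assms
    by (simp add: pack_def lex_le_def)
qed

lemma pack_eq_iff:
  assumes "length u = length v" "i < length u" "j < length u"
  shows "pack u v ! i = pack u v ! j \<longleftrightarrow> u ! i = u ! j \<and> v ! i = v ! j"
  unfolding order_eq_iff[of "pack u v ! i"] pack_le_iff[OF assms] pack_le_iff[OF assms(1,3,2)]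
  by auto

lemma packed_iff: "packed u \<longleftrightarrow> (\<exists>m. set u = {1..m})"
proof
  assume "\<exists>m. set u = {1..m}"
  then obtain m where m: "set u = {1..m}" ..
  have "max_letter u = m"
    unfolding max_letter_def m by (intro Max_eqI) auto
  with m show "packed u" by (simp add: packed_def)
qed (auto simp: packed_def)

lemma max_letter_eq: "set u = {1..m} \<Longrightarrow> max_letter u = m"
  unfolding max_letter_def by (intro Max_eqI) auto

text \<open>The rank is injective on the occurring biletters and takes values between 1 and their
  number, so it takes every such value.\<close>

lemma packed_pack: "packed (pack u v)"
proof -
  define Z where "Z = set (zip u v)"
  define r where "r b = card {z \<in> Z. lex_le z b}" for b
  have fin: "finite Z" by (simp add: Z_def)
  have "inj_on r Z"
  proof (rule inj_onI)
    fix b c assume "b \<in> Z" "c \<in> Z" "r b = r c"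
    then show "b = c"
      using lex_rank_le_iff[OF fin, of b c] lex_rank_le_iff[OF fin, of c b]
      by (auto simp: r_def intro: lex_le_antisym)
  qed
  then have "card (r ` Z) = card Z" by (rule card_image)
  moreover have "r ` Z \<subseteq> {1..card Z}"
  proof
    fix x assume "x \<in> r ` Z"
    then obtain b where b: "b \<in> Z" "x = r b" by auto
    have "{b} \<subseteq> {z \<in> Z. lex_le z b}" using b lex_le_refl[of b] by blast
    from card_mono[OF _ this] have "r b > 0" using fin unfolding r_def by simp
    moreover have "r b \<le> card Z" unfolding r_def using fin by (intro card_mono) auto
    ultimately show "x \<in> {1..card Z}" using b by auto
  qed
  ultimately have "r ` Z = {1..card Z}"
    by (intro card_subset_eq) auto
  moreover have "set (pack u v) = r ` Z"
    by (simp add: pack_def r_def Z_def)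
  ultimately show ?thesis by (auto simp: packed_iff)
qed

lemma pack_in_packed_words: "length u = n \<Longrightarrow> length v = n \<Longrightarrow> pack u v \<in> packed_words n"
  by (simp add: packed_words_def packed_pack)

text \<open>Both images are in bijection with the classes of the same equivalence relation on
  \<open>J\<close>.\<close>

lemma card_image_eq_kernel:
  assumes "\<And>j k. j \<in> J \<Longrightarrow> k \<in> J \<Longrightarrow> f j = f k \<longleftrightarrow> g j = g k"
  shows "card (f ` J) = card (g ` J)"
proof (rule bij_betw_same_card)
  have inv: "g (inv_into J f (f j)) = g j" if "j \<in> J" for j
    using assms[OF inv_into_into[of "f j" f J] that] f_inv_into_f[of "f j" f J] that by auto
  show "bij_betw (\<lambda>x. g (inv_into J f x)) (f ` J) (g ` J)"
    unfolding bij_betw_def inj_on_def image_image using inv assms by auto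
qed

text \<open>A packed word is determined by the weak order that it puts on the positions. Equalities
  between packed words thereby become comparisons of positions.\<close>

lemma packed_words_eqI:
  assumes u: "u \<in> packed_words n" and v: "v \<in> packed_words n"
    and le: "\<And>i j. i < n \<Longrightarrow> j < n \<Longrightarrow> u ! i \<le> u ! j \<longleftrightarrow> v ! i \<le> v ! j"
  shows "u = v"
proof (rule nth_equalityI)
  show "length u = length v" using u v by (simp add: packed_words_def)
  fix i assume "i < length u"
  then have i: "i < n" using u by (simp add: packed_words_def)
  \<comment> \<open>No letter is skipped in a packed word, so the letters up to \<open>w ! i\<close>
    that occur are exactly 1, ..., \<open>w ! i\<close>.\<close>
  have rank: "w ! i = card ((!) w ` {j. j < n \<and> w ! j \<le> w ! i})" if w: "w \<in> packed_words n" for w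
  proof -
    obtain m where m: "set w = {1..m}" and len: "length w = n"
      using w by (auto simp: packed_words_def packed_iff)
    have "(!) w ` {j. j < n \<and> w ! j \<le> w ! i} = set w \<inter> {..w ! i}"
      by (auto simp: set_conv_nth len)
    also have "\<dots> = {1..w ! i}"
    proof -
      have "w ! i \<in> {1..m}" using m i len nth_mem by blast
      then show ?thesis unfolding m by auto
    qed
    finally show ?thesis by simp
  qed
  have "card ((!) u ` {j. j < n \<and> u ! j \<le> u ! i}) = card ((!) v ` {j. j < n \<and> u ! j \<le> u ! i})"
    by (rule card_image_eq_kernel) (use le in \<open>auto simp: order_eq_iff\<close>)
  moreover have "{j. j < n \<and> u ! j \<le> u ! i} = {j. j < n \<and> v ! j \<le> v ! i}"
    using le i by auto
  ultimately have "card ((!) u ` {j. j < n \<and> u ! j \<le> u ! i}) = card ((!) v ` {j. j < n \<and> v ! j \<le> v ! i})"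
    by metis
  then show "u ! i = v ! i"
    by (simp only: rank[OF u, symmetric] rank[OF v, symmetric])
qed

text \<open>Both sides order the positions lexicographically by the three letters from
  \<open>u\<close>, \<open>v\<close> and \<open>w\<close>.\<close>

lemma pack_assoc:
  assumes "length u = n" "length v = n" "length w = n"
  shows "pack (pack u v) w = pack u (pack v w)"
proof (rule packed_words_eqI)
  fix i j assume "i < n" "j < n"
  then show "pack (pack u v) w ! i \<le> pack (pack u v) w ! j \<longleftrightarrow>
      pack u (pack v w) ! i \<le> pack u (pack v w) ! j"
    using assms by (auto simp: pack_le_iff pack_eq_iff less_le_not_le)
qed (use assms in \<open>auto intro: pack_in_packed_words\<close>)

lemma finite_packed_words: "finite (packed_words n)"
proof (rule finite_subset)
  show "packed_words n \<subseteq> {u. set u \<subseteq> {..n} \<and> length u = n}"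
  proof
    fix u assume u: "u \<in> packed_words n"
    then obtain m where m: "set u = {1..m}" "length u = n"
      by (auto simp: packed_words_def packed_iff)
    then have "m \<le> n"
      using card_length[of u] by simp
    with m show "u \<in> {u. set u \<subseteq> {..n} \<and> length u = n}" by auto
  qed
qed (simp add: finite_lists_length_eq)

lemma replicate_1_in_packed_words: "replicate n 1 \<in> packed_words n"
proof (cases n)
  case 0
  then show ?thesis by (auto simp: packed_words_def packed_iff intro: exI[of _ 0])
next
  case (Suc m)
  then have "set (replicate n 1) = {1..1::nat}" by auto
  then show ?thesis unfolding packed_words_def packed_iff by (intro CollectI conjI exI[of _ 1]) auto
qed

lemma pack_replicate_left: "u \<in> packed_words n \<Longrightarrow> pack (replicate n 1) u = u"
  by (rule packed_words_eqI[of _ n])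
     (auto simp: pack_le_iff pack_in_packed_words packed_words_def packed_pack)

lemma pack_replicate_right: "u \<in> packed_words n \<Longrightarrow> pack u (replicate n 1) = u"
  by (rule packed_words_eqI[of _ n])
     (auto simp: pack_le_iff pack_in_packed_words packed_words_def packed_pack)

subsection \<open>Underlying set partitions\<close>

lemma mem_word_partition_iff:
  "A \<in> word_partition u \<longleftrightarrow> (\<exists>k<length u. A = {i \<in> {1..length u}. u ! (i - 1) = u ! k})"
  unfolding word_partition_def image_iff Bex_def in_set_conv_nth by blast

lemma partition_on_word_partition: "partition_on {1..length u} (word_partition u)"
proof (rule partition_onI)
  show "\<Union> (word_partition u) = {1..length u}"
  proof
    show "{1..length u} \<subseteq> \<Union> (word_partition u)"
    proof
      fix i assume "i \<in> {1..length u}"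
      then have "i - 1 < length u \<and> i \<in> {i' \<in> {1..length u}. u ! (i' - 1) = u ! (i - 1)}" by auto
      then show "i \<in> \<Union> (word_partition u)"
        unfolding Union_iff Bex_def mem_word_partition_iff by blast
    qed
  qed (auto simp: mem_word_partition_iff)
  show "{} \<notin> word_partition u"
  proof
    assume "{} \<in> word_partition u"
    then obtain k where k: "k < length u" "{} = {i \<in> {1..length u}. u ! (i - 1) = u ! k}"
      unfolding mem_word_partition_iff by blast
    then have "Suc k \<in> {i \<in> {1..length u}. u ! (i - 1) = u ! k}" by auto
    then have "Suc k \<in> {}" using k(2) by blast
    then show False by simp
  qed
qed (auto simp: mem_word_partition_iff disjnt_def)

lemma word_partition_in_set_partitions: "length u = n \<Longrightarrow> word_partition u \<in> set_partitions n"
  using partition_on_word_partition by (auto simp: set_partitions_def)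

text \<open>Refinement of a support means that the word is constant on blocks. Elements of blocks
  start at 1 and list indices at 0, whence the shift by one.\<close>

lemma refines_word_partition_iff:
  assumes "\<alpha> \<in> set_partitions n" "length u = n"
  shows "refines {1..n} \<alpha> (word_partition u) \<longleftrightarrow>
    (\<forall>A\<in>\<alpha>. \<forall>i\<in>A. \<forall>j\<in>A. u ! (i - 1) = u ! (j - 1))" (is "?L \<longleftrightarrow> ?R")
proof
  assume ?L
  show ?R
  proof (intro ballI)
    fix A i j assume "A \<in> \<alpha>" "i \<in> A" "j \<in> A"
    with \<open>?L\<close> obtain B where "B \<in> word_partition u" "A \<subseteq> B"
      by (auto simp: refines_def)
    with \<open>i \<in> A\<close> \<open>j \<in> A\<close> have "B \<in> word_partition u" "i \<in> B" "j \<in> B" by auto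
    then show "u ! (i - 1) = u ! (j - 1)"
      by (auto simp: mem_word_partition_iff)
  qed
next
  assume R: ?R
  have "\<exists>B\<in>word_partition u. A \<subseteq> B" if A: "A \<in> \<alpha>" for A
  proof -
    have "A \<noteq> {}" "A \<subseteq> {1..n}"
      using A assms by (auto simp: set_partitions_def partition_on_def)
    then obtain i where i: "i \<in> A" "i \<in> {1..n}" by blast
    have "{i' \<in> {1..n}. u ! (i' - 1) = u ! (i - 1)} \<in> word_partition u"
      unfolding mem_word_partition_iff using i assms by (intro exI[of _ "i - 1"] conjI) auto
    moreover have "A \<subseteq> {i' \<in> {1..n}. u ! (i' - 1) = u ! (i - 1)}"
    proof
      fix i' assume "i' \<in> A"
      moreover from this have "u ! (i' - 1) = u ! (i - 1)" using R A i(1) by blast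
      ultimately show "i' \<in> {i' \<in> {1..n}. u ! (i' - 1) = u ! (i - 1)}"
        using \<open>A \<subseteq> {1..n}\<close> by auto
    qed
    ultimately show ?thesis by blast
  qed
  then show ?L
    using assms partition_on_word_partition[of u] by (auto simp: refines_def set_partitions_def)
qed

lemma word_partition_refines_iff:
  assumes "length u = n" "length v = n"
  shows "refines {1..n} (word_partition u) (word_partition v) \<longleftrightarrow>
    (\<forall>i<n. \<forall>j<n. u ! i = u ! j \<longrightarrow> v ! i = v ! j)" (is "?L \<longleftrightarrow> ?R")
proof -
  have "?L \<longleftrightarrow> (\<forall>A\<in>word_partition u. \<forall>i\<in>A. \<forall>j\<in>A. v ! (i - 1) = v ! (j - 1))"
    using assms by (intro refines_word_partition_iff word_partition_in_set_partitions)
  also have "\<dots> \<longleftrightarrow> ?R"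
  proof
    assume L: "\<forall>A\<in>word_partition u. \<forall>i\<in>A. \<forall>j\<in>A. v ! (i - 1) = v ! (j - 1)"
    show ?R
    proof (intro allI impI)
      fix i j assume ij: "i < n" "j < n" "u ! i = u ! j"
      define A where "A = {i' \<in> {1..length u}. u ! (i' - 1) = u ! i}"
      have "A \<in> word_partition u" using ij assms by (auto simp: mem_word_partition_iff A_def)
      moreover have "Suc i \<in> A" "Suc j \<in> A" using ij assms by (auto simp: A_def)
      ultimately have "v ! (Suc i - 1) = v ! (Suc j - 1)" using L by blast
      then show "v ! i = v ! j" by simp
    qed
  next
    assume R: ?R
    show "\<forall>A\<in>word_partition u. \<forall>i\<in>A. \<forall>j\<in>A. v ! (i - 1) = v ! (j - 1)"
    proof (intro ballI)
      fix A i j assume "A \<in> word_partition u" "i \<in> A" "j \<in> A"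
      then have "i - 1 < n" "j - 1 < n" "u ! (i - 1) = u ! (j - 1)"
        using assms by (auto simp: mem_word_partition_iff)
      then show "v ! (i - 1) = v ! (j - 1)" using R by blast
    qed
  qed
  finally show ?thesis .
qed

lemma word_partition_eq_iff:
  assumes "length u = n" "length v = n"
  shows "word_partition u = word_partition v \<longleftrightarrow> (\<forall>i<n. \<forall>j<n. u ! i = u ! j \<longleftrightarrow> v ! i = v ! j)"
proof -
  have "word_partition u = word_partition v \<longleftrightarrow>
      refines {1..n} (word_partition u) (word_partition v) \<and>
      refines {1..n} (word_partition v) (word_partition u)"
    using assms refines_asym refines_refl partition_on_word_partition by metis
  then show ?thesis
    unfolding word_partition_refines_iff[OF assms] word_partition_refines_iff[OF assms(2,1)]
    by blast
qed

text \<open>The support of a product is the common refinement of the supports of its factors. This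
  is the reason why the characters are multiplicative.\<close>

lemma refines_word_partition_pack_iff:
  assumes "\<alpha> \<in> set_partitions n" "length u = n" "length v = n"
  shows "refines {1..n} \<alpha> (word_partition (pack u v)) \<longleftrightarrow>
    refines {1..n} \<alpha> (word_partition u) \<and> refines {1..n} \<alpha> (word_partition v)"
proof -
  have "pack u v ! (i - 1) = pack u v ! (j - 1) \<longleftrightarrow>
      u ! (i - 1) = u ! (j - 1) \<and> v ! (i - 1) = v ! (j - 1)"
    if "A \<in> \<alpha>" "i \<in> A" "j \<in> A" for A i j
  proof -
    have "i \<in> {1..n}" "j \<in> {1..n}"
      using that assms by (auto simp: set_partitions_def partition_on_def)
    then show ?thesis using assms by (intro pack_eq_iff) auto
  qed
  then have "(\<forall>A\<in>\<alpha>. \<forall>i\<in>A. \<forall>j\<in>A. pack u v ! (i - 1) = pack u v ! (j - 1)) \<longleftrightarrow>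
      (\<forall>A\<in>\<alpha>. \<forall>i\<in>A. \<forall>j\<in>A. u ! (i - 1) = u ! (j - 1) \<and> v ! (i - 1) = v ! (j - 1))"
    by (intro ball_cong refl)
  moreover have "length (pack u v) = n" using assms by simp
  ultimately show ?thesis
    by (simp only: refines_word_partition_iff[OF assms(1)] assms ball_conj_distrib)
qed

text \<open>Right multiplication by \<open>v\<close> changes nothing when \<open>v\<close> separates
  no positions that \<open>u\<close> leaves together.\<close>

lemma pack_absorb_right_iff:
  assumes "u \<in> packed_words n" "v \<in> packed_words n"
  shows "pack u v = u \<longleftrightarrow> refines {1..n} (word_partition u) (word_partition v)"
proof -
  have len: "length u = n" "length v = n" using assms by (auto simp: packed_words_def)
  show ?thesis
  proof
    assume "pack u v = u"
    then have "refines {1..n} (word_partition u) (word_partition (pack u v))"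
      using len refines_refl partition_on_word_partition by metis
    then show "refines {1..n} (word_partition u) (word_partition v)"
      using refines_word_partition_pack_iff[OF word_partition_in_set_partitions len] len by blast
  next
    assume "refines {1..n} (word_partition u) (word_partition v)"
    then have const: "v ! i = v ! j" if "i < n" "j < n" "u ! i = u ! j" for i j
      unfolding word_partition_refines_iff[OF len] using that by blast
    show "pack u v = u"
    proof (rule packed_words_eqI[of _ n])
      fix i j assume ij: "i < n" "j < n"
      then show "pack u v ! i \<le> pack u v ! j \<longleftrightarrow> u ! i \<le> u ! j"
        using const[OF ij] len by (cases "u ! i = u ! j") (auto simp: pack_le_iff)
    qed (use len assms in \<open>auto intro: pack_in_packed_words\<close>)
  qed
qed

text \<open>In terms of set compositions, the condition says that \<open>y\<close> arises from
  \<open>x\<close> by merging consecutive blocks.\<close>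

lemma pack_absorb_left_iff:
  assumes "y \<in> packed_words n" "x \<in> packed_words n"
  shows "pack y x = x \<longleftrightarrow> (\<forall>i<n. \<forall>j<n. x ! i \<le> x ! j \<longrightarrow> y ! i \<le> y ! j)"
proof -
  have len: "length y = n" "length x = n" using assms by (auto simp: packed_words_def)
  show ?thesis
  proof
    assume *: "pack y x = x"
    show "\<forall>i<n. \<forall>j<n. x ! i \<le> x ! j \<longrightarrow> y ! i \<le> y ! j"
      using pack_le_iff[of y x] * len by (metis order.order_iff_strict)
  next
    assume *: "\<forall>i<n. \<forall>j<n. x ! i \<le> x ! j \<longrightarrow> y ! i \<le> y ! j"
    show "pack y x = x"
    proof (rule packed_words_eqI[of _ n])
      fix i j assume ij: "i < n" "j < n"
      have "x ! i \<le> x ! j \<Longrightarrow> y ! i \<le> y ! j" "x ! j \<le> x ! i \<Longrightarrow> y ! j \<le> y ! i"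
        using * ij by auto
      then show "pack y x ! i \<le> pack y x ! j \<longleftrightarrow> x ! i \<le> x ! j"
        using ij len by (cases "x ! i \<le> x ! j"; cases "x ! j \<le> x ! i") (auto simp: pack_le_iff)
    qed (use len assms in \<open>auto intro: pack_in_packed_words\<close>)
  qed
qed

declare One_nat_def [simp del]

section \<open>The internal product\<close>

lemma lookup_NN: "Poly_Mapping.lookup (NN u) v = (if u = v then 1 else 0)"
  by (simp add: NN_def lookup_single when_def)

lemma keys_NN [simp]: "Poly_Mapping.keys (NN u :: 'k::field wqsym) = {u}"
  by (simp add: NN_def)

lemma wq_expand: "F = (\<Sum>u\<in>Poly_Mapping.keys F. wscale (Poly_Mapping.lookup F u) (NN u))"
proof (rule poly_mapping_eqI)
  fix w
  have "Poly_Mapping.lookup (\<Sum>u\<in>Poly_Mapping.keys F. wscale (Poly_Mapping.lookup F u) (NN u)) w =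
      (\<Sum>u\<in>Poly_Mapping.keys F. if u = w then Poly_Mapping.lookup F w else 0)"
    unfolding lookup_sum lookup_wscale lookup_NN by (intro sum.cong) auto
  then show "Poly_Mapping.lookup F w =
      Poly_Mapping.lookup (\<Sum>u\<in>Poly_Mapping.keys F. wscale (Poly_Mapping.lookup F u) (NN u)) w"
    by (simp add: in_keys_iff)
qed

lemma wq_expandE: obtains A a where "F = (\<Sum>u\<in>A. wscale (a u) (NN u))"
  using that[of "Poly_Mapping.lookup F" "Poly_Mapping.keys F"] wq_expand[of F] by metis

text \<open>The support of a sum can be smaller than the union of the supports; sums over a common
  finite set make additivity a termwise matter.\<close>

lemma bilinear_extension_superset:
  assumes "finite A" "finite B" "Poly_Mapping.keys F \<subseteq> A" "Poly_Mapping.keys G \<subseteq> B"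
  shows "bilinear_extension p F G =
    (\<Sum>u\<in>A. \<Sum>v\<in>B. wscale (Poly_Mapping.lookup F u * Poly_Mapping.lookup G v) (p u v))"
proof -
  have "bilinear_extension p F G = (\<Sum>u\<in>Poly_Mapping.keys F. \<Sum>v\<in>B.
      wscale (Poly_Mapping.lookup F u * Poly_Mapping.lookup G v) (p u v))"
    unfolding bilinear_extension_def
    by (intro sum.cong refl sum.mono_neutral_left assms) (auto simp: in_keys_iff)
  also have "\<dots> = (\<Sum>u\<in>A. \<Sum>v\<in>B.
      wscale (Poly_Mapping.lookup F u * Poly_Mapping.lookup G v) (p u v))"
    by (intro sum.mono_neutral_left assms) (auto simp: in_keys_iff)
  finally show ?thesis .
qed

lemma bilinear_extension_add_left:
  "bilinear_extension p (F + F') G = bilinear_extension p F G + bilinear_extension p F' G"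
proof -
  let ?A = "Poly_Mapping.keys F \<union> Poly_Mapping.keys F'"
  have "Poly_Mapping.keys (F + F') \<subseteq> ?A" by (rule keys_add)
  then show ?thesis
    by (subst (1 2 3) bilinear_extension_superset[of ?A "Poly_Mapping.keys G"])
       (auto simp: lookup_add distrib_right wq.scale_left_distrib sum.distrib)
qed

lemma bilinear_extension_add_right:
  "bilinear_extension p F (G + G') = bilinear_extension p F G + bilinear_extension p F G'"
proof -
  let ?A = "Poly_Mapping.keys G \<union> Poly_Mapping.keys G'"
  have "Poly_Mapping.keys (G + G') \<subseteq> ?A" by (rule keys_add)
  then show ?thesis
    by (subst (1 2 3) bilinear_extension_superset[of "Poly_Mapping.keys F" ?A])
       (auto simp: lookup_add distrib_left wq.scale_left_distrib sum.distrib)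
qed

lemma keys_wscale: "Poly_Mapping.keys (wscale c F) \<subseteq> Poly_Mapping.keys F"
  by (auto simp: in_keys_iff lookup_wscale)

lemma bilinear_extension_scale_left:
  "bilinear_extension p (wscale c F) G = wscale c (bilinear_extension p F G)"
  by (subst bilinear_extension_superset[OF _ _ keys_wscale order_refl])
     (auto simp: bilinear_extension_def lookup_wscale wq.scale_sum_right mult.assoc)

lemma bilinear_extension_scale_right:
  "bilinear_extension p F (wscale c G) = wscale c (bilinear_extension p F G)"
  by (subst bilinear_extension_superset[OF _ _ order_refl keys_wscale])
     (auto simp: bilinear_extension_def lookup_wscale wq.scale_sum_right mult_ac)

lemma bilinear_extension_NN: "bilinear_extension p (NN u) (NN v) = p u v"
  by (simp add: bilinear_extension_def lookup_NN)

lemma bilinear_extension_linear_left: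
  "Vector_Spaces.linear wscale wscale (\<lambda>F. bilinear_extension p F (G :: 'k::field wqsym))"
  by unfold_locales (auto simp: bilinear_extension_add_left bilinear_extension_scale_left)

lemma bilinear_extension_linear_right:
  "Vector_Spaces.linear wscale wscale (\<lambda>G. bilinear_extension p (F :: 'k::field wqsym) G)"
  by unfold_locales (auto simp: bilinear_extension_add_right bilinear_extension_scale_right)

lemma star_linear_left: "Vector_Spaces.linear wscale wscale (\<lambda>F. F \<star> (G :: 'k::field wqsym))"
  unfolding internal_product_def by (rule bilinear_extension_linear_left)

lemma star_linear_right: "Vector_Spaces.linear wscale wscale (\<lambda>G. (F :: 'k::field wqsym) \<star> G)"
  unfolding internal_product_def by (rule bilinear_extension_linear_right)

interpretation wqp: vector_space_pair
  "wscale :: 'k::field \<Rightarrow> 'k wqsym \<Rightarrow> 'k wqsym" "wscale :: 'k::field \<Rightarrow> 'k wqsym \<Rightarrow> 'k wqsym"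
  by unfold_locales

lemmas star_add_left = wqp.linear_add[OF star_linear_left]
  and star_diff_left = wqp.linear_diff[OF star_linear_left]
  and star_scale_left = wqp.linear_scale[OF star_linear_left]
  and star_sum_left = wqp.linear_sum[OF star_linear_left]
  and star_zero_left [simp] = wqp.linear_0[OF star_linear_left]

lemmas star_add_right = wqp.linear_add[OF star_linear_right]
  and star_diff_right = wqp.linear_diff[OF star_linear_right]
  and star_scale_right = wqp.linear_scale[OF star_linear_right]
  and star_sum_right = wqp.linear_sum[OF star_linear_right]
  and star_zero_right [simp] = wqp.linear_0[OF star_linear_right]

lemma star_NN: "NN u \<star> NN v = (if length u = length v then NN (pack u v) else 0)"
  by (simp add: internal_product_def bilinear_extension_NN)

lemma star_assoc: "(F \<star> G) \<star> H = F \<star> (G \<star> H)" for F G H :: "'k::field wqsym"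
proof -
  have NN: "(NN u \<star> NN v) \<star> NN w = NN u \<star> (NN v \<star> NN w)" for u v w :: "nat list"
    by (simp add: star_NN pack_assoc)
  obtain A a where F: "F = (\<Sum>u\<in>A. wscale (a u) (NN u))" by (rule wq_expandE)
  obtain B b where G: "G = (\<Sum>u\<in>B. wscale (b u) (NN u))" by (rule wq_expandE)
  obtain C c where H: "H = (\<Sum>u\<in>C. wscale (c u) (NN u))" by (rule wq_expandE)
  show ?thesis
    unfolding F G H star_sum_left star_sum_right star_scale_left star_scale_right NN ..
qed

lemma WQ_iff: "F \<in> WQ n \<longleftrightarrow> Poly_Mapping.keys F \<subseteq> packed_words n"
proof
  assume "F \<in> WQ n"
  then show "Poly_Mapping.keys F \<subseteq> packed_words n"
    unfolding WQ_def
  proof (induction rule: wq.span_induct_alt)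
    case (step c x y)
    have "Poly_Mapping.keys (wscale c x + y) \<subseteq> Poly_Mapping.keys x \<union> Poly_Mapping.keys y"
      using keys_add[of "wscale c x" y] keys_wscale[of c x] by blast
    then show ?case using step by auto
  qed auto
next
  assume "Poly_Mapping.keys F \<subseteq> packed_words n"
  then show "F \<in> WQ n"
    unfolding WQ_def
    by (subst wq_expand, intro wq.span_sum wq.span_scale wq.span_base) auto
qed

lemma WQ_expand:
  assumes "F \<in> WQ n"
  obtains a where "F = (\<Sum>u\<in>packed_words n. wscale (a u) (NN u))"
proof
  show "F = (\<Sum>u\<in>packed_words n. wscale (Poly_Mapping.lookup F u) (NN u))"
    using assms by (subst wq_expand, intro sum.mono_neutral_left)
      (auto simp: WQ_iff finite_packed_words in_keys_iff)
qed

lemma subspace_WQ: "wq.subspace (WQ n)"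
  unfolding WQ_def by (rule wq.subspace_span)

lemma NN_in_WQ: "u \<in> packed_words n \<Longrightarrow> NN u \<in> WQ n"
  by (simp add: WQ_iff)

lemma star_in_WQ:
  assumes "F \<in> WQ n" "G \<in> WQ n"
  shows "F \<star> G \<in> WQ n"
proof -
  have "NN u \<star> NN v \<in> WQ n" if "u \<in> packed_words n" "v \<in> packed_words n" for u v
    using that by (auto simp: star_NN packed_words_def intro!: NN_in_WQ packed_pack)
  moreover obtain a where F: "F = (\<Sum>u\<in>packed_words n. wscale (a u) (NN u))"
    using assms(1) by (rule WQ_expand)
  moreover obtain b where G: "G = (\<Sum>u\<in>packed_words n. wscale (b u) (NN u))"
    using assms(2) by (rule WQ_expand)
  ultimately show ?thesis
    unfolding F G star_sum_left star_sum_right star_scale_left star_scale_right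
    by (intro wq.subspace_sum subspace_WQ wq.subspace_scale)
qed

lemma star_one_left:
  fixes F :: "'k::field wqsym"
  assumes "F \<in> WQ n"
  shows "NN (replicate n 1) \<star> F = F"
proof -
  obtain a where F: "F = (\<Sum>u\<in>packed_words n. wscale (a u) (NN u))"
    using assms by (rule WQ_expand)
  have "NN (replicate n 1) \<star> NN u = (NN u :: 'k wqsym)" if "u \<in> packed_words n" for u
    using pack_replicate_left[OF that] that by (simp add: star_NN packed_words_def)
  then show ?thesis
    unfolding F star_sum_right star_scale_right by (simp cong: sum.cong)
qed

lemma star_one_right:
  fixes F :: "'k::field wqsym"
  assumes "F \<in> WQ n"
  shows "F \<star> NN (replicate n 1) = F"
proof -
  obtain a where F: "F = (\<Sum>u\<in>packed_words n. wscale (a u) (NN u))"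
    using assms by (rule WQ_expand)
  have "NN u \<star> NN (replicate n 1) = (NN u :: 'k wqsym)" if "u \<in> packed_words n" for u
    using pack_replicate_right[OF that] that by (simp add: star_NN packed_words_def)
  then show ?thesis
    unfolding F star_sum_left star_scale_left by (simp cong: sum.cong)
qed

subsection \<open>Characters\<close>

lemma chi_superset:
  assumes "finite A" "Poly_Mapping.keys F \<subseteq> A"
  shows "chi \<pi> F = (\<Sum>u\<in>A. Poly_Mapping.lookup F u *
     (if refines {1..length u} \<pi> (word_partition u) then 1 else 0))"
  unfolding chi_def by (intro sum.mono_neutral_left assms) (auto simp: in_keys_iff)

lemma vector_space_mult: "vector_space ((*) :: 'k::field \<Rightarrow> 'k \<Rightarrow> 'k)"
  by unfold_locales (auto simp: algebra_simps)

lemma chi_linear: "Vector_Spaces.linear wscale (*) (chi \<pi> :: 'k::field wqsym \<Rightarrow> 'k)"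
proof unfold_locales
  fix F G :: "'k wqsym" and c
  let ?A = "Poly_Mapping.keys F \<union> Poly_Mapping.keys G"
  show "chi \<pi> (F + G) = chi \<pi> F + chi \<pi> G"
    using keys_add[of F G]
    by (subst (1 2 3) chi_superset[of ?A]) (auto simp: lookup_add distrib_right sum.distrib)
  show "chi \<pi> (wscale c F) = c * chi \<pi> F"
    by (subst chi_superset[OF _ keys_wscale])
       (auto simp: chi_def lookup_wscale sum_distrib_left mult.assoc)
qed (auto simp: algebra_simps)

lemma vector_space_pair_wq_field:
  "vector_space_pair (wscale :: 'k::field \<Rightarrow> 'k wqsym \<Rightarrow> 'k wqsym) ((*) :: 'k \<Rightarrow> 'k \<Rightarrow> 'k)"
  by (intro vector_space_pair.intro wq.vector_space_axioms vector_space_mult)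

lemmas chi_add = vector_space_pair.linear_add[OF vector_space_pair_wq_field chi_linear]
  and chi_diff = vector_space_pair.linear_diff[OF vector_space_pair_wq_field chi_linear]
  and chi_scale = vector_space_pair.linear_scale[OF vector_space_pair_wq_field chi_linear]
  and chi_sum = vector_space_pair.linear_sum[OF vector_space_pair_wq_field chi_linear]
  and chi_zero [simp] = vector_space_pair.linear_0[OF vector_space_pair_wq_field chi_linear]

lemma chi_NN: "chi \<pi> (NN u) = (if refines {1..length u} \<pi> (word_partition u) then 1 else 0)"
  by (simp add: chi_def lookup_NN)

lemma chi_star:
  assumes "\<pi> \<in> set_partitions n" "F \<in> WQ n" "G \<in> WQ n"
  shows "chi \<pi> (F \<star> G) = chi \<pi> F * chi \<pi> G"
proof -
  have NN: "chi \<pi> (NN u \<star> NN v) = chi \<pi> (NN u) * (chi \<pi> (NN v) :: 'a)"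
    if "u \<in> packed_words n" "v \<in> packed_words n" for u v
  proof -
    have "length u = n" "length v = n" using that by (auto simp: packed_words_def)
    then show ?thesis
      using refines_word_partition_pack_iff[OF assms(1)]
      by (simp add: star_NN chi_NN del: One_nat_def)
  qed
  obtain a where F: "F = (\<Sum>u\<in>packed_words n. wscale (a u) (NN u))"
    using assms(2) by (rule WQ_expand)
  obtain b where G: "G = (\<Sum>u\<in>packed_words n. wscale (b u) (NN u))"
    using assms(3) by (rule WQ_expand)
  have "chi \<pi> (F \<star> G) = (\<Sum>u\<in>packed_words n. \<Sum>v\<in>packed_words n.
      b v * (a u * chi \<pi> (NN u \<star> NN v)))"
    unfolding F G star_sum_left star_sum_right star_scale_left star_scale_right chi_sum chi_scale
    by (subst sum.swap) (simp only: sum_distrib_left)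
  also have "\<dots> = (\<Sum>u\<in>packed_words n. \<Sum>v\<in>packed_words n.
      (a u * chi \<pi> (NN u)) * (b v * chi \<pi> (NN v)))"
    by (intro sum.cong refl) (simp add: NN)
  also have "\<dots> = chi \<pi> F * chi \<pi> G"
    unfolding F G chi_sum chi_scale sum_product ..
  finally show ?thesis .
qed

section \<open>Subalgebras with one-dimensional simple modules\<close>

text \<open>The recursion of \<open>rad_power\<close> with an arbitrary set in place of the radical.
  It allows the powers of the common kernel to be studied before that kernel is known to be the
  radical.\<close>

primrec ideal_power :: "'k::field wqsym set \<Rightarrow> 'k wqsym set \<Rightarrow> nat \<Rightarrow> 'k wqsym set" where
  "ideal_power B N 0 = B"
| "ideal_power B N (Suc k) = wq.span {x \<star> y | x y. x \<in> ideal_power B N k \<and> y \<in> N}"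

lemma rad_power_eq_ideal_power: "rad_power B k = ideal_power B (rad B) k"
  by (induction k) auto

text \<open>The finite set \<open>A\<close> excludes an infinite basis of \<open>U'\<close>, whose
  \<open>card\<close>, and hence the dimension, would be 0 by convention.\<close>

lemma dim_le_of_inj_on:
  fixes f :: "'k::field wqsym \<Rightarrow> 'k wqsym"
  assumes f: "Vector_Spaces.linear wscale wscale f" and inj: "inj_on f U"
    and U: "wq.subspace U" and sub: "f ` U \<subseteq> U'" and fin: "finite A" "U' \<subseteq> wq.span A"
  shows "wq.dim U \<le> wq.dim U'"
proof -
  obtain b where b: "b \<subseteq> U" "wq.independent b" "U \<subseteq> wq.span b" "card b = wq.dim U"
    using wq.basis_exists by blast
  have span: "wq.span b = U"
    using b U wq.span_minimal by blast
  have "wq.independent (f ` b)"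
    using wqp.linear_independent_injective_image[OF f b(2)] inj span by simp
  moreover obtain b' where b': "b' \<subseteq> U'" "wq.independent b'" "U' \<subseteq> wq.span b'" "card b' = wq.dim U'"
    using wq.basis_exists by blast
  have "finite b'"
    using wq.independent_span_bound[OF fin(1) b'(2)] b'(1) fin(2) by auto
  ultimately have "card (f ` b) \<le> card b'"
    using wq.independent_span_bound[of b' "f ` b"] b(1) sub b'(3) by auto
  moreover have "card (f ` b) = card b"
    using inj b(1) by (intro card_image) (auto intro: inj_on_subset)
  ultimately show ?thesis using b b' by simp
qed

lemma star_linear_both: "Vector_Spaces.linear wscale wscale (\<lambda>x. a \<star> x \<star> (b :: 'k::field wqsym))"
  using Vector_Spaces.linear_compose[OF star_linear_right[of a] star_linear_left[of b]]
  by (simp add: comp_def)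

lemma subspace_field_trivial:
  fixes U :: "'k::field set"
  assumes sub: "module.subspace (*) U"
  shows "U = {0} \<or> U = UNIV"
proof (cases "U = {0}")
  case False
  interpret vs: vector_space "(*) :: 'k \<Rightarrow> 'k \<Rightarrow> 'k" by (rule vector_space_mult)
  obtain u where u: "u \<in> U" "u \<noteq> 0" using False vs.subspace_0[OF sub] by blast
  have "c \<in> U" for c
    using vs.subspace_scale[OF sub u(1), of "c / u"] u(2) by simp
  then show ?thesis by blast
qed simp

text \<open>To be instantiated both by the algebra of packed words and by the sharp algebra.
  Nilpotency of the common kernel is left to an extension of the locale, because for packed words it
  is itself obtained from the powers of that kernel.\<close>

locale pointed_algebra =
  fixes B :: "'k::field wqsym set" and one :: "'k wqsym" and P :: "nat set set set"
  assumes subspace: "wq.subspace B"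
    and star_closed: "x \<in> B \<Longrightarrow> y \<in> B \<Longrightarrow> x \<star> y \<in> B"
    and one_closed: "one \<in> B"
    and one_left: "x \<in> B \<Longrightarrow> one \<star> x = x"
    and one_right: "x \<in> B \<Longrightarrow> x \<star> one = x"
    and chi_mult: "\<pi> \<in> P \<Longrightarrow> x \<in> B \<Longrightarrow> y \<in> B \<Longrightarrow> chi \<pi> (x \<star> y) = chi \<pi> x * chi \<pi> y"
    and chi_one: "\<pi> \<in> P \<Longrightarrow> chi \<pi> one = 1"
begin

definition N :: "'k wqsym set" where
  "N = {x \<in> B. \<forall>\<pi>\<in>P. chi \<pi> x = 0}"

lemma N_I: "x \<in> B \<Longrightarrow> (\<And>\<pi>. \<pi> \<in> P \<Longrightarrow> chi \<pi> x = 0) \<Longrightarrow> x \<in> N"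
  by (simp add: N_def)

lemma N_closed: "x \<in> N \<Longrightarrow> x \<in> B"
  by (simp add: N_def)

lemma subspace_N: "wq.subspace N"
  using subspace by (auto simp: wq.subspace_def N_def chi_add chi_scale)

lemma N_left: "b \<in> B \<Longrightarrow> x \<in> N \<Longrightarrow> b \<star> x \<in> N"
  by (auto simp: N_def star_closed chi_mult)

lemma N_right: "x \<in> N \<Longrightarrow> b \<in> B \<Longrightarrow> x \<star> b \<in> N"
  by (auto simp: N_def star_closed chi_mult)

section \<open>Powers of the common kernel of the characters\<close>

lemma subspace_ideal_power: "wq.subspace (ideal_power B N k)"
  by (cases k) (auto simp: subspace)

lemma ideal_power_Suc_I: "x \<in> ideal_power B N k \<Longrightarrow> y \<in> N \<Longrightarrow> x \<star> y \<in> ideal_power B N (Suc k)"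
  by (auto intro!: wq.span_base)

lemma ideal_power_Suc_induct [consumes 1, case_names zero add scale star]:
  assumes "z \<in> ideal_power B N (Suc k)"
    and "Q 0" "\<And>x y. Q x \<Longrightarrow> Q y \<Longrightarrow> Q (x + y)" "\<And>c x. Q x \<Longrightarrow> Q (wscale c x)"
    and "\<And>x y. x \<in> ideal_power B N k \<Longrightarrow> y \<in> N \<Longrightarrow> Q (x \<star> y)"
  shows "Q z"
  using assms(1) unfolding ideal_power.simps
  by (induction rule: wq.span_induct_alt) (use assms in blast)+

lemma ideal_power_closed: "x \<in> ideal_power B N k \<Longrightarrow> x \<in> B"
proof (induction k arbitrary: x)
  case (Suc k)
  from Suc.prems show ?case
    by (induction rule: ideal_power_Suc_induct)
       (use Suc.IH N_closed star_closed subspace in \<open>auto simp: wq.subspace_def\<close>)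
qed simp

lemma ideal_power_left: "b \<in> B \<Longrightarrow> x \<in> ideal_power B N k \<Longrightarrow> b \<star> x \<in> ideal_power B N k"
proof (induction k arbitrary: x)
  case (Suc k)
  have sub: "wq.subspace (ideal_power B N (Suc k))" by (rule subspace_ideal_power)
  from Suc.prems(2) show ?case
  proof (induction rule: ideal_power_Suc_induct)
    case (star x y)
    then have "(b \<star> x) \<star> y \<in> ideal_power B N (Suc k)"
      using Suc.IH Suc.prems by (intro ideal_power_Suc_I)
    then show ?case by (simp only: star_assoc)
  next
    case zero
    then show ?case by (simp only: star_zero_right wq.subspace_0[OF sub])
  qed (simp_all only: star_add_right star_scale_right wq.subspace_add[OF sub] wq.subspace_scale[OF sub])
qed (simp add: star_closed)

lemma ideal_power_right: "x \<in> ideal_power B N k \<Longrightarrow> b \<in> B \<Longrightarrow> x \<star> b \<in> ideal_power B N k"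
proof (cases k)
  case (Suc j)
  assume prems: "x \<in> ideal_power B N k" "b \<in> B"
  have sub: "wq.subspace (ideal_power B N (Suc j))" by (rule subspace_ideal_power)
  from prems(1) show ?thesis unfolding Suc
  proof (induction rule: ideal_power_Suc_induct)
    case (star x y)
    then have "x \<star> (y \<star> b) \<in> ideal_power B N (Suc j)"
      using prems by (intro ideal_power_Suc_I N_right)
    then show ?case by (simp only: star_assoc)
  next
    case zero
    then show ?case by (simp only: star_zero_left wq.subspace_0[OF sub])
  qed (simp_all only: star_add_left star_scale_left wq.subspace_add[OF sub] wq.subspace_scale[OF sub])
qed (simp add: star_closed)

lemma ideal_power_Suc_subset: "ideal_power B N (Suc k) \<subseteq> ideal_power B N k"
proof
  fix z assume "z \<in> ideal_power B N (Suc k)"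
  then show "z \<in> ideal_power B N k"
    by (induction rule: ideal_power_Suc_induct)
       (auto intro: wq.subspace_0 wq.subspace_add wq.subspace_scale subspace_ideal_power
          ideal_power_right N_closed)
qed

lemma ideal_power_antimono: "j \<le> k \<Longrightarrow> ideal_power B N k \<subseteq> ideal_power B N j"
  using lift_Suc_antimono_le[of "ideal_power B N"] ideal_power_Suc_subset by blast

lemma ideal_power_1: "ideal_power B N 1 = N"
proof
  show "ideal_power B N 1 \<subseteq> N"
  proof
    fix z assume "z \<in> ideal_power B N 1"
    then show "z \<in> N" unfolding One_nat_def
      by (induction rule: ideal_power_Suc_induct)
         (auto intro: wq.subspace_0 wq.subspace_add wq.subspace_scale subspace_N N_left)
  qed
  show "N \<subseteq> ideal_power B N 1"
  proof
    fix z assume z: "z \<in> N"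
    then have "one \<star> z \<in> ideal_power B N (Suc 0)"
      by (intro ideal_power_Suc_I) (auto simp: one_closed)
    then show "z \<in> ideal_power B N 1"
      using z by (simp only: One_nat_def one_left N_closed)
  qed
qed

lemma ideal_power_add:
  "x \<in> ideal_power B N i \<Longrightarrow> y \<in> ideal_power B N j \<Longrightarrow> x \<star> y \<in> ideal_power B N (i + j)"
proof (induction j arbitrary: y)
  case 0
  then show ?case by (simp add: ideal_power_right)
next
  case (Suc j)
  have sub: "wq.subspace (ideal_power B N (Suc (i + j)))" by (rule subspace_ideal_power)
  from Suc.prems(2) have "x \<star> y \<in> ideal_power B N (Suc (i + j))"
  proof (induction rule: ideal_power_Suc_induct)
    case (star z y)
    then have "(x \<star> z) \<star> y \<in> ideal_power B N (Suc (i + j))"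
      using Suc.IH Suc.prems by (intro ideal_power_Suc_I)
    then show ?case by (simp only: star_assoc)
  next
    case zero
    then show ?case by (simp only: star_zero_right wq.subspace_0[OF sub])
  qed (simp_all only: star_add_right star_scale_right wq.subspace_add[OF sub] wq.subspace_scale[OF sub])
  then show ?case by simp
qed

end

section \<open>Consequences of nilpotency: the radical, primitive idempotents and simple
  modules\<close>

locale basic_algebra = pointed_algebra +
  assumes nil: "x \<in> N \<Longrightarrow> \<exists>k. (((\<star>) x) ^^ k) one = 0"
begin

text \<open>Substituting the equation into itself gives \<open>y = x^k \<star> y\<close> for every
  exponent.\<close>

lemma nil_left:
  assumes "x \<in> N" "y \<in> B" "y = x \<star> y"
  shows "y = 0"
proof -
  obtain k where k: "(((\<star>) x) ^^ k) one = 0" using nil assms by blast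
  have "y = (((\<star>) x) ^^ j) one \<star> y" for j
  proof (induction j)
    case (Suc j)
    have "y = x \<star> ((((\<star>) x) ^^ j) one \<star> y)" using Suc assms(3) by simp
    then show ?case by (simp add: star_assoc)
  qed (use assms one_left in simp)
  from this[of k] k show ?thesis by simp
qed

lemma nil_right:
  assumes "x \<in> N" "y \<in> B" "y = y \<star> x"
  shows "y = 0"
proof -
  obtain k where k: "(((\<star>) x) ^^ k) one = 0" using nil assms by blast
  have "y = y \<star> (((\<star>) x) ^^ j) one" for j
  proof (induction j)
    case (Suc j)
    have "y = (y \<star> x) \<star> (((\<star>) x) ^^ j) one" using Suc assms(3) by simp
    then show ?case by (simp add: star_assoc)
  qed (use assms one_right in simp)
  from this[of k] k show ?thesis by simp
qed

text \<open>The inverse is the geometric sum of the powers of \<open>x\<close>, which is finite by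
  nilpotency.\<close>

lemma one_minus_left_invertible:
  assumes "x \<in> N"
  obtains z where "z \<in> B" "z \<star> (one - x) = one"
proof -
  obtain k where k: "(((\<star>) x) ^^ k) one = 0" using nil assms by blast
  have xB: "x \<in> B" using assms N_closed by blast
  have pow_right: "(((\<star>) x) ^^ j) one \<star> x = (((\<star>) x) ^^ Suc j) one" for j
    by (induction j) (use xB in \<open>auto simp: one_left one_right star_assoc\<close>)
  have "\<exists>z\<in>B. z \<star> (one - x) = one - (((\<star>) x) ^^ j) one" for j
  proof (induction j)
    case 0
    show ?case using subspace by (auto intro!: bexI[of _ 0] simp: wq.subspace_0)
  next
    case (Suc j)
    then obtain z where z: "z \<in> B" "z \<star> (one - x) = one - (((\<star>) x) ^^ j) one" by blast
    \<comment> \<open>Horner's rule: from a partial geometric sum \<open>z\<close> the next one is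
      \<open>z \<star> x + one\<close>.\<close>
    have "(z \<star> x + one) \<star> (one - x) = z \<star> (x \<star> (one - x)) + one \<star> (one - x)"
      by (simp add: star_add_left star_assoc)
    also have "x \<star> (one - x) = (one - x) \<star> x"
      by (simp add: star_diff_left star_diff_right xB one_left one_right)
    also have "z \<star> ((one - x) \<star> x) = (one - (((\<star>) x) ^^ j) one) \<star> x"
      by (simp add: z(2) flip: star_assoc)
    also have "\<dots> = x - (((\<star>) x) ^^ Suc j) one"
      unfolding star_diff_left pow_right by (simp add: xB one_left)
    also have "one \<star> (one - x) = one - x"
      by (simp add: star_diff_right xB one_left one_closed)
    finally have "(z \<star> x + one) \<star> (one - x) = one - (((\<star>) x) ^^ Suc j) one" by simp
    moreover have "z \<star> x + one \<in> B"
      using z xB by (intro wq.subspace_add[OF subspace] star_closed one_closed)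
    ultimately show ?case by blast
  qed
  from this[of k] k that show thesis by auto
qed

text \<open>The kernel of a character has codimension one: any \<open>j\<close> outside it, suitably
  scaled, corrects an arbitrary \<open>b\<close> to an element of the kernel.\<close>

lemma maximal_left_ideal_chi:
  assumes "\<pi> \<in> P"
  shows "maximal_left_ideal B {x \<in> B. chi \<pi> x = 0}"
proof -
  let ?M = "{x \<in> B. chi \<pi> x = 0}"
  have "left_ideal B ?M"
    using subspace assms
    by (auto simp: left_ideal_def wq.subspace_def chi_add chi_scale chi_mult star_closed)
  moreover have "?M \<noteq> B" using one_closed chi_one[OF assms] by force
  moreover have "J = ?M \<or> J = B" if J: "left_ideal B J" "?M \<subseteq> J" for J
  proof (cases "J = ?M")
    case False
    then obtain j where j: "j \<in> J" "chi \<pi> j \<noteq> 0" "j \<in> B"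
      using J by (auto simp: left_ideal_def)
    have "b \<in> J" if b: "b \<in> B" for b
    proof -
      define c where "c = wscale (chi \<pi> b / chi \<pi> j) j"
      have "c \<in> J" "c \<in> B"
        using j J subspace by (auto simp: c_def left_ideal_def wq.subspace_scale)
      moreover have "chi \<pi> (b - c) = 0" using j by (simp add: c_def chi_diff chi_scale)
      ultimately have "b - c \<in> J" using J b subspace by (auto simp: wq.subspace_diff)
      then have "(b - c) + c \<in> J" using \<open>c \<in> J\<close> J unfolding left_ideal_def by (metis wq.subspace_add)
      then show ?thesis by simp
    qed
    then show ?thesis using J by (auto simp: left_ideal_def)
  qed simp
  ultimately show ?thesis unfolding maximal_left_ideal_def by blast
qed

text \<open>If \<open>x\<close> were outside \<open>M\<close>, then \<open>M + B x\<close> would be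
  all of \<open>B\<close>, so that the unit is \<open>m + b \<star> x\<close> with \<open>m\<close>
  in \<open>M\<close>. But then \<open>m\<close> is the unit minus an element of the ideal
  \<open>N\<close>, hence left invertible, and \<open>M\<close> contains the unit.\<close>

lemma N_subset_maximal_left_ideal:
  assumes M: "maximal_left_ideal B M" and x: "x \<in> N"
  shows "x \<in> M"
proof (rule ccontr)
  assume "x \<notin> M"
  have LM: "left_ideal B M" "M \<noteq> B" using M by (auto simp: maximal_left_ideal_def)
  then have sM: "wq.subspace M" "M \<subseteq> B" "\<And>b m. b \<in> B \<Longrightarrow> m \<in> M \<Longrightarrow> b \<star> m \<in> M"
    by (auto simp: left_ideal_def)
  define J where "J = {m + b \<star> x | m b. m \<in> M \<and> b \<in> B}"
  have xB: "x \<in> B" using x N_closed by blast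
  have "left_ideal B J"
    unfolding left_ideal_def
  proof (intro conjI ballI)
    show "J \<subseteq> B"
      using sM(2) xB subspace by (auto simp: J_def intro!: wq.subspace_add star_closed)
    show "wq.subspace J"
      unfolding wq.subspace_def
    proof (intro conjI ballI allI)
      have "0 = 0 + 0 \<star> x" by simp
      then show "0 \<in> J" unfolding J_def using wq.subspace_0[OF sM(1)] wq.subspace_0[OF subspace] by blast
    next
      fix y z assume "y \<in> J" "z \<in> J"
      then obtain m b m' b' where y: "y = m + b \<star> x" "m \<in> M" "b \<in> B"
        and z: "z = m' + b' \<star> x" "m' \<in> M" "b' \<in> B" unfolding J_def by blast
      have "y + z = (m + m') + (b + b') \<star> x" by (simp add: y z star_add_left)
      moreover have "m + m' \<in> M" "b + b' \<in> B"
        using y z sM(1) subspace by (auto simp: wq.subspace_add)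
      ultimately show "y + z \<in> J" unfolding J_def by blast
    next
      fix c y assume "y \<in> J"
      then obtain m b where y: "y = m + b \<star> x" "m \<in> M" "b \<in> B" unfolding J_def by blast
      have "wscale c y = wscale c m + wscale c b \<star> x"
        by (simp add: y wq.scale_right_distrib star_scale_left)
      moreover have "wscale c m \<in> M" "wscale c b \<in> B"
        using y sM(1) subspace by (auto simp: wq.subspace_scale)
      ultimately show "wscale c y \<in> J" unfolding J_def by blast
    qed
  next
    fix a y assume a: "a \<in> B" and "y \<in> J"
    then obtain m b where y: "y = m + b \<star> x" "m \<in> M" "b \<in> B" unfolding J_def by blast
    have "a \<star> y = a \<star> m + (a \<star> b) \<star> x" by (simp add: y star_add_right star_assoc)
    then show "a \<star> y \<in> J" unfolding J_def using sM(3) a y star_closed by blast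
  qed
  moreover have "M \<subseteq> J"
  proof
    fix m assume "m \<in> M"
    moreover have "m = m + 0 \<star> x" by simp
    ultimately show "m \<in> J" unfolding J_def using wq.subspace_0[OF subspace] by blast
  qed
  moreover have "x \<in> J"
  proof -
    have "x = 0 + one \<star> x" using one_left xB by simp
    then show ?thesis unfolding J_def using wq.subspace_0[OF sM(1)] one_closed by blast
  qed
  ultimately have "J = B" using M \<open>x \<notin> M\<close> unfolding maximal_left_ideal_def by blast
  then obtain m b where mb: "one = m + b \<star> x" "m \<in> M" "b \<in> B"
    using one_closed unfolding J_def by blast
  then obtain z where z: "z \<in> B" "z \<star> (one - b \<star> x) = one"
    using one_minus_left_invertible[OF N_left[OF mb(3) x]] by blast
  moreover have "one - b \<star> x = m" using mb(1) by simp
  ultimately have "one \<in> M" using sM(3) mb(2) by metis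
  then have "b \<in> M" if "b \<in> B" for b
    using sM(3)[OF that] one_right[OF that] by metis
  then show False using LM(2) sM(2) by blast
qed

lemma rad_eq_N: "rad B = N"
proof
  show "rad B \<subseteq> N"
    unfolding rad_def N_def using maximal_left_ideal_chi by blast
  show "N \<subseteq> rad B"
    unfolding rad_def using N_subset_maximal_left_ideal N_closed by blast
qed

lemma rad_power_eq: "rad_power B k = ideal_power B N k"
  by (simp add: rad_power_eq_ideal_power rad_eq_N)

text \<open>Primitivity is automatic. If the idempotent is a sum of orthogonal idempotents
  \<open>f\<close> and \<open>g\<close>, then at each character the product of the two values is 0,
  so the value 1 at \<pi> belongs to only one of them. The other one lies in the nilpotent ideal
  \<open>N\<close>, and an idempotent there is zero.\<close>

lemma labelled_idempotents_iff:
  "labelled_idempotents B P e \<longleftrightarrow>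
    (\<forall>\<pi>\<in>P. idempotent_in B (e \<pi>) \<and> (\<forall>\<sigma>\<in>P. chi \<sigma> (e \<pi>) = (if \<sigma> = \<pi> then 1 else 0)))"
proof -
  have "primitive_idempotent B x"
    if x: "idempotent_in B x" and \<pi>: "\<pi> \<in> P" and chi: "\<And>\<sigma>. \<sigma> \<in> P \<Longrightarrow> chi \<sigma> x = (if \<sigma> = \<pi> then 1 else 0)"
    for x \<pi>
  proof -
    have "x \<noteq> 0" using chi[OF \<pi>] by auto
    moreover have "f = 0 \<or> g = 0"
      if f: "idempotent_in B f" and g: "idempotent_in B g" and fg: "f \<star> g = 0" "x = f + g" for f g
    proof -
      have zero: "h = 0" if "idempotent_in B h" "\<And>\<sigma>. \<sigma> \<in> P \<Longrightarrow> chi \<sigma> h = 0" for h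
        using nil_left[of h h] that by (auto simp: idempotent_in_def N_def)
      have fB: "f \<in> B" "g \<in> B" using f g by (auto simp: idempotent_in_def)
      have prod: "chi \<sigma> f * chi \<sigma> g = 0" if "\<sigma> \<in> P" for \<sigma>
        using chi_mult[OF that fB] fg by simp
      have sum: "chi \<sigma> f + chi \<sigma> g = (if \<sigma> = \<pi> then 1 else 0)" if "\<sigma> \<in> P" for \<sigma>
        using chi[OF that] fg by (simp add: chi_add)
      have off: "chi \<sigma> f = 0 \<and> chi \<sigma> g = 0" if "\<sigma> \<in> P" "\<sigma> \<noteq> \<pi>" for \<sigma>
        using prod[OF that(1)] sum[OF that(1)] that(2) by auto
      from prod[OF \<pi>] consider "chi \<pi> f = 0" | "chi \<pi> g = 0" by auto
      then show ?thesis
      proof cases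
        case 1
        then show ?thesis using zero[OF f] off by metis
      next
        case 2
        then show ?thesis using zero[OF g] off by metis
      qed
    qed
    ultimately show ?thesis using x by (auto simp: primitive_idempotent_def)
  qed
  moreover have "idempotent_in B x" if "primitive_idempotent B x" for x
    using that by (simp add: primitive_idempotent_def)
  ultimately show ?thesis
    unfolding labelled_idempotents_def by blast
qed

text \<open>Compression by \<open>q\<close> and \<open>q'\<close> is injective on
  \<open>p V p'\<close>: since \<open>p - q\<close> lies in \<open>N\<close>, the element
  \<open>p q p\<close> differs from the unit \<open>p\<close> of the corner by a nilpotent one and
  can be cancelled, and likewise \<open>p' q' p'\<close> on the other side. Exchanging the roles of
  the two pairs gives equality of dimensions.\<close>

lemma dim_peirce_le:
  assumes V: "V \<subseteq> B" "wq.subspace V" "\<And>b x. b \<in> B \<Longrightarrow> x \<in> V \<Longrightarrow> b \<star> x \<in> V"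
      "\<And>b x. b \<in> B \<Longrightarrow> x \<in> V \<Longrightarrow> x \<star> b \<in> V"
    and fin: "finite A" "V \<subseteq> wq.span A"
    and idem: "idempotent_in B p" "idempotent_in B p'" "q \<in> B" "q' \<in> B"
    and chi: "\<And>\<sigma>. \<sigma> \<in> P \<Longrightarrow> chi \<sigma> p = chi \<sigma> q" "\<And>\<sigma>. \<sigma> \<in> P \<Longrightarrow> chi \<sigma> p' = chi \<sigma> q'"
  shows "wq.dim ((\<lambda>x. p \<star> x \<star> p') ` V) \<le> wq.dim ((\<lambda>x. q \<star> x \<star> q') ` V)"
proof (rule dim_le_of_inj_on)
  note lin = star_linear_both
  show "Vector_Spaces.linear wscale wscale (\<lambda>x. q \<star> x \<star> q')" by (rule lin)
  let ?U = "(\<lambda>x. p \<star> x \<star> p') ` V"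
  show U: "wq.subspace ?U" by (rule wqp.linear_subspace_image[OF lin V(2)])
  have pB: "p \<in> B" "p' \<in> B" and pp: "p \<star> p = p" "p' \<star> p' = p'"
    using idem by (auto simp: idempotent_in_def)
  have UV: "?U \<subseteq> V" using V pB by auto
  then show "(\<lambda>x. q \<star> x \<star> q') ` ?U \<subseteq> (\<lambda>x. q \<star> x \<star> q') ` V" by blast
  have "(\<lambda>x. q \<star> x \<star> q') ` V \<subseteq> V" using V idem by auto
  then show "(\<lambda>x. q \<star> x \<star> q') ` V \<subseteq> wq.span A" using fin by blast
  show "finite A" by fact
  define r where "r = p \<star> (p - q) \<star> p"
  define r' where "r' = p' \<star> (p' - q') \<star> p'"
  have N: "p - q \<in> N" "p' - q' \<in> N"
    using chi pB idem subspace by (auto intro!: N_I simp: chi_diff wq.subspace_diff)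
  have rN: "r \<in> N" "r' \<in> N"
    using N_right[OF N_left[OF pB(1) N(1)] pB(1)] N_right[OF N_left[OF pB(2) N(2)] pB(2)]
    by (simp_all add: r_def r'_def)
  show "inj_on (\<lambda>x. q \<star> x \<star> q') ?U"
  proof (subst wqp.linear_inj_on_iff_eq_0[OF lin U], safe)
    fix v assume "v \<in> V" and zero: "q \<star> (p \<star> v \<star> p') \<star> q' = 0"
    define x where "x = p \<star> v \<star> p'"
    have x: "p \<star> x = x" "x \<star> p' = x" "x \<in> B"
      using pp \<open>v \<in> V\<close> V pB by (simp_all add: x_def star_assoc star_closed subsetD flip: star_assoc[of p p] )
    have q: "p \<star> q \<star> p = p - r" "p' \<star> q' \<star> p' = p' - r'"
      by (simp_all add: r_def r'_def star_diff_left star_diff_right pp)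
    \<comment> \<open>By the second equation of \<open>q\<close> this is
      \<open>p' \<star> q' \<star> p'\<close>; the factor on the left of \<open>x\<close> is
      cancelled first, then this one.\<close>
    define z where "z = p' - r'"
    have zB: "z \<in> B" using rN pB N_closed subspace by (auto simp: z_def wq.subspace_diff)
    have "(p \<star> q \<star> p) \<star> (x \<star> z) = p \<star> (q \<star> ((p \<star> x) \<star> p') \<star> q') \<star> p'"
      unfolding z_def q(2)[symmetric] by (simp only: star_assoc)
    also have "\<dots> = 0" using zero x by (simp add: x_def)
    finally have "(p - r) \<star> (x \<star> z) = 0" by (simp only: q)
    moreover have "p \<star> (x \<star> z) = x \<star> z" using x(1) by (simp flip: star_assoc)
    ultimately have "x \<star> z = r \<star> (x \<star> z)" by (simp add: star_diff_left)
    then have "x \<star> z = 0" using nil_left rN x zB star_closed by blast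
    then have "x = x \<star> r'" using x by (simp add: z_def star_diff_right)
    then show "p \<star> v \<star> p' = 0" using nil_right rN x x_def by blast
  qed
qed

lemma dim_peirce_eq:
  assumes V: "V \<subseteq> B" "wq.subspace V" "\<And>b x. b \<in> B \<Longrightarrow> x \<in> V \<Longrightarrow> b \<star> x \<in> V"
      "\<And>b x. b \<in> B \<Longrightarrow> x \<in> V \<Longrightarrow> x \<star> b \<in> V"
    and fin: "finite A" "V \<subseteq> wq.span A"
    and idem: "idempotent_in B p" "idempotent_in B p'" "idempotent_in B q" "idempotent_in B q'"
    and chi: "\<And>\<sigma>. \<sigma> \<in> P \<Longrightarrow> chi \<sigma> p = chi \<sigma> q" "\<And>\<sigma>. \<sigma> \<in> P \<Longrightarrow> chi \<sigma> p' = chi \<sigma> q'"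
  shows "wq.dim ((\<lambda>x. p \<star> x \<star> p') ` V) = wq.dim ((\<lambda>x. q \<star> x \<star> q') ` V)"
  using assms by (intro antisym dim_peirce_le[OF V fin]) (auto simp: idempotent_in_def)

text \<open>The elements \<open>e \<pi>\<close> separate the characters, so different labels give
  non-isomorphic modules. In an arbitrary simple module the common kernel acts as zero, and then a
  nonzero vector in the image of some \<open>e \<pi>\<close> spans a submodule on which the algebra
  acts through \<open>chi \<pi>\<close>.\<close>

lemma quiver_vertices_labelled:
  fixes e :: "nat set set \<Rightarrow> 'a wqsym"
  assumes "finite P"
    and e: "\<And>\<pi>. \<pi> \<in> P \<Longrightarrow> e \<pi> \<in> B"
      "\<And>\<pi> \<sigma>. \<pi> \<in> P \<Longrightarrow> \<sigma> \<in> P \<Longrightarrow> chi \<sigma> (e \<pi>) = (if \<sigma> = \<pi> then 1 else 0)"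
  shows "quiver_vertices_labelled TYPE('v::ab_group_add) B one P"
  unfolding quiver_vertices_labelled_def
proof (intro conjI ballI allI impI)
  fix \<pi> assume \<pi>: "\<pi> \<in> P"
  show "simple_module B one (*) (\<lambda>x c. chi \<pi> x * c)"
    unfolding simple_module_def
  proof (intro conjI)
    show "vector_space ((*) :: 'a \<Rightarrow> 'a \<Rightarrow> 'a)"
      by (rule vector_space_mult)
    show "\<forall>x\<in>B. Vector_Spaces.linear (*) (*) ((*) (chi \<pi> x))"
      by (intro ballI vector_space.linear_scale_self[OF vector_space_mult])
    show "\<forall>U. module.subspace (*) U \<longrightarrow> (\<forall>x\<in>B. \<forall>v\<in>U. chi \<pi> x * v \<in> U) \<longrightarrow> U = {0} \<or> U = UNIV"
      using subspace_field_trivial by blast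
    show "(UNIV :: 'a set) \<noteq> {0}"
    proof
      assume "(UNIV :: 'a set) = {0}"
      then have "(1 :: 'a) \<in> {0}" by (rule subst) (rule UNIV_I)
      then show False by simp
    qed
    show "\<forall>x\<in>B. \<forall>y\<in>B. \<forall>v. chi \<pi> (x + y) * v = chi \<pi> x * v + chi \<pi> y * v"
      by (simp add: chi_add distrib_right)
    show "\<forall>c. \<forall>x\<in>B. \<forall>v. chi \<pi> (wscale c x) * v = c * (chi \<pi> x * v)"
      by (simp add: chi_scale mult.assoc)
    show "\<forall>x\<in>B. \<forall>y\<in>B. \<forall>v. chi \<pi> (x \<star> y) * v = chi \<pi> x * (chi \<pi> y * v)"
      by (simp add: chi_mult[OF \<pi>] mult.assoc)
    show "\<forall>v. chi \<pi> one * v = v"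
      by (simp add: chi_one[OF \<pi>])
  qed
next
  fix \<pi> \<sigma> assume \<pi>\<sigma>: "\<pi> \<in> P" "\<sigma> \<in> P"
    and "isomorphic_modules B (*) (\<lambda>x c. chi \<pi> x * c) (*) (\<lambda>x c. chi \<sigma> x * c)"
  then obtain f where f: "Vector_Spaces.linear (*) (*) f" "bij f"
      "\<And>x v. x \<in> B \<Longrightarrow> f (chi \<pi> x * v) = chi \<sigma> x * f v"
    unfolding isomorphic_modules_def by blast
  interpret f: Vector_Spaces.linear "(*)" "(*)" f by (rule f(1))
  have "f 1 \<noteq> 0" using injD[OF bij_is_inj[OF f(2)], of 1 0] f.zero by auto
  moreover have "f 1 = chi \<sigma> (e \<pi>) * f 1"
    using f(3)[OF e(1)[OF \<pi>\<sigma>(1)], of 1] e(2)[OF \<pi>\<sigma>(1) \<pi>\<sigma>(1)] by simp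
  ultimately show "\<pi> = \<sigma>" using e(2)[OF \<pi>\<sigma>] by (auto split: if_splits)
next
  fix s :: "'a \<Rightarrow> 'v \<Rightarrow> 'v" and a :: "'a wqsym \<Rightarrow> 'v \<Rightarrow> 'v"
  assume "simple_module B one s a"
  then have vs: "vector_space s" and lin: "\<And>x. x \<in> B \<Longrightarrow> Vector_Spaces.linear s s (a x)"
    and add: "\<And>x y v. x \<in> B \<Longrightarrow> y \<in> B \<Longrightarrow> a (x + y) v = a x v + a y v"
    and scale: "\<And>c x v. x \<in> B \<Longrightarrow> a (wscale c x) v = s c (a x v)"
    and mult: "\<And>x y v. x \<in> B \<Longrightarrow> y \<in> B \<Longrightarrow> a (x \<star> y) v = a x (a y v)"
    and unit: "\<And>v. a one v = v" and nontriv: "(UNIV :: 'v set) \<noteq> {0}"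
    and simple: "\<And>U. module.subspace s U \<Longrightarrow> (\<And>x v. x \<in> B \<Longrightarrow> v \<in> U \<Longrightarrow> a x v \<in> U) \<Longrightarrow> U = {0} \<or> U = UNIV"
    unfolding simple_module_def by blast+
  interpret vs: vector_space s by (rule vs)
  have a_add: "a x (v + w) = a x v + a x w" and a_scale: "a x (s c v) = s c (a x v)"
    and a_zero: "a x 0 = 0" if "x \<in> B" for x v w c
  proof -
    interpret ax: Vector_Spaces.linear s s "a x" by (rule lin[OF that])
    show "a x (v + w) = a x v + a x w" "a x (s c v) = s c (a x v)" "a x 0 = 0"
      by (simp_all add: ax.add ax.scale ax.zero)
  qed
  have zeroB: "0 \<in> B" and diffB: "\<And>x y. x \<in> B \<Longrightarrow> y \<in> B \<Longrightarrow> x - y \<in> B"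
    and scaleB: "\<And>c x. x \<in> B \<Longrightarrow> wscale c x \<in> B"
    using subspace by (auto simp: wq.subspace_0 wq.subspace_diff wq.subspace_scale)
  have zero: "a 0 v = 0" for v
    using add[OF zeroB zeroB, of v] by simp
  have diff: "a (x - y) v = a x v - a y v" if "x \<in> B" "y \<in> B" for x y v
    using add[OF diffB[OF that] that(2), of v] by simp
  \<comment> \<open>\<open>N v\<close> is a submodule; if it were everything, then \<open>v = r v\<close> with \<open>r\<close> nilpotent.\<close>
  have kill: "a r v = 0" if "r \<in> N" for r v
  proof (cases "v = 0")
    case False
    define U where "U = (\<lambda>r. a r v) ` N"
    have "vs.subspace U"
      unfolding vs.subspace_def U_def
    proof (intro conjI ballI allI)
      show "0 \<in> (\<lambda>r. a r v) ` N"
        using wq.subspace_0[OF subspace_N] zero by (metis imageI)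
    next
      fix x y assume "x \<in> (\<lambda>r. a r v) ` N" "y \<in> (\<lambda>r. a r v) ` N"
      then obtain r r' where "r \<in> N" "r' \<in> N" "x = a r v" "y = a r' v" by blast
      then show "x + y \<in> (\<lambda>r. a r v) ` N"
        using add[of r r' v] wq.subspace_add[OF subspace_N, of r r'] N_closed by (metis imageI)
    next
      fix c x assume "x \<in> (\<lambda>r. a r v) ` N"
      then obtain r where "r \<in> N" "x = a r v" by blast
      then show "s c x \<in> (\<lambda>r. a r v) ` N"
        using scale[of r c v] wq.subspace_scale[OF subspace_N, of r c] N_closed by (metis imageI)
    qed
    moreover have "a x w \<in> U" if xw: "x \<in> B" "w \<in> U" for x w
    proof -
      obtain r where "r \<in> N" "w = a r v" using xw by (auto simp: U_def)
      then show ?thesis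
        using mult[of x r v] xw N_left N_closed unfolding U_def by (metis imageI)
    qed
    ultimately have "U = {0} \<or> U = UNIV" by (rule simple)
    moreover have "U \<noteq> UNIV"
    proof
      assume "U = UNIV"
      then obtain r where r: "r \<in> N" "a r v = v" unfolding U_def by (metis UNIV_I imageE)
      obtain z where z: "z \<in> B" "z \<star> (one - r) = one"
        using one_minus_left_invertible[OF r(1)] .
      have "v = a (z \<star> (one - r)) v" by (simp only: z unit)
      also have "\<dots> = a z (a one v - a r v)"
        using z(1) N_closed[OF r(1)] one_closed by (simp add: mult diff diffB)
      also have "\<dots> = 0" using r z unit a_zero by simp
      finally show False using False by simp
    qed
    ultimately show ?thesis using that by (auto simp: U_def)
  qed (use that N_closed a_zero in blast)
  obtain v :: 'v where v: "v \<noteq> 0" using nontriv by blast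
  define E where "E = (\<Sum>\<pi>\<in>P. e \<pi>)"
  have sumB: "(\<Sum>\<pi>\<in>Q. e \<pi>) \<in> B" if "Q \<subseteq> P" for Q
    using that e(1) by (intro wq.subspace_sum[OF subspace]) blast
  have a_sum: "a (\<Sum>\<pi>\<in>Q. e \<pi>) v = (\<Sum>\<pi>\<in>Q. a (e \<pi>) v)" if "Q \<subseteq> P" for Q
    using finite_subset[OF that \<open>finite P\<close>] that
  proof (induction Q rule: finite_induct)
    case (insert \<pi> Q)
    then show ?case using add[OF e(1)[of \<pi>] sumB[of Q]] by simp
  qed (simp add: zero)
  \<comment> \<open>Each character is 1 on exactly one summand of \<open>E\<close>. Hence
    \<open>one - E\<close> acts as zero, \<open>v\<close> is the sum of the vectors
    \<open>a (e \<pi>) v\<close>, and one of these is nonzero.\<close>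
  have "chi \<sigma> (one - E) = 0" if "\<sigma> \<in> P" for \<sigma>
  proof -
    have "chi \<sigma> E = (\<Sum>\<pi>\<in>P. if \<sigma> = \<pi> then 1 else 0)"
      unfolding E_def chi_sum using e(2) that by (intro sum.cong) auto
    then show ?thesis using that \<open>finite P\<close> by (simp add: chi_diff chi_one)
  qed
  then have "one - E \<in> N"
    using sumB[of P] one_closed by (intro N_I diffB) (auto simp: E_def)
  then have "a (one - E) v = 0" by (rule kill)
  then have "v = (\<Sum>\<pi>\<in>P. a (e \<pi>) v)"
    using diff[OF one_closed sumB[of P], of v] a_sum[of P] by (simp add: E_def unit)
  then obtain \<pi> where \<pi>: "\<pi> \<in> P" "a (e \<pi>) v \<noteq> 0"
    using v by (metis (no_types, lifting) sum.neutral)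
  define w where "w = a (e \<pi>) v"
  have w: "a x w = s (chi \<pi> x) w" if x: "x \<in> B" for x
  proof -
    \<comment> \<open>Every character vanishes on this element: those other than
      \<open>chi \<pi>\<close> kill \<open>e \<pi>\<close>, and \<open>chi \<pi>\<close> takes the
      same value on both terms. Its action being zero makes \<open>w\<close> an eigenvector of
      \<open>x\<close>.\<close>
    have "x \<star> e \<pi> - wscale (chi \<pi> x) (e \<pi>) \<in> N"
      using x e \<pi> by (intro N_I diffB scaleB star_closed) (auto simp: chi_diff chi_scale chi_mult)
    from kill[OF this, of v] show ?thesis
      using x e(1)[OF \<pi>(1)] by (simp add: w_def diff mult scale star_closed scaleB)
  qed
  have "range (\<lambda>c. s c w) = {0} \<or> range (\<lambda>c. s c w) = UNIV"
  proof (rule simple)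
    show "vs.subspace (range (\<lambda>c. s c w))"
      using vs.subspace_span[of "{w}"] by (simp add: vs.span_singleton)
    show "a x v \<in> range (\<lambda>c. s c w)" if xv: "x \<in> B" "v \<in> range (\<lambda>c. s c w)" for x v
      using xv by (auto simp: a_scale w)
  qed
  moreover have "w \<in> range (\<lambda>c. s c w)" by (metis rangeI vs.scale_one)
  ultimately have surj: "range (\<lambda>c. s c w) = UNIV" using \<pi>(2) by (auto simp: w_def)
  have "Vector_Spaces.linear (*) s (\<lambda>c. s c w)"
    by (rule vs.linear_scale_left)
  moreover have "bij (\<lambda>c. s c w)"
    using surj \<pi>(2) by (auto simp: bij_def inj_on_def w_def)
  moreover have "\<forall>x\<in>B. \<forall>c. s (chi \<pi> x * c) w = a x (s c w)"
    by (simp add: a_scale w mult.commute)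
  ultimately show "\<exists>\<pi>\<in>P. isomorphic_modules B (*) (\<lambda>x c. chi \<pi> x * c) s a"
    unfolding isomorphic_modules_def using \<pi>(1) by blast
qed

end

section \<open>Set compositions\<close>

text \<open>The inverse of reading off the blocks of a packed word in the order of their letters.
  List indices start at 0 and letters at 1, whence \<open>Suc\<close>; for a list of disjoint blocks
  \<open>LEAST\<close> picks the only possible index.\<close>

definition composition_word :: "nat \<Rightarrow> nat set list \<Rightarrow> nat list" where
  "composition_word n Bs = map (\<lambda>p. Suc (LEAST i. i < length Bs \<and> p \<in> Bs ! i)) [1..<Suc n]"

lemma length_composition_word [simp]: "length (composition_word n Bs) = n"
  by (simp add: composition_word_def)

context
  fixes n :: nat and Bs :: "nat set list"
  assumes Bs: "distinct Bs" "partition_on {1..n} (set Bs)"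
begin

lemma composition_block_unique:
  assumes "i < length Bs" "j < length Bs" "p \<in> Bs ! i" "p \<in> Bs ! j"
  shows "i = j"
  using assms Bs unfolding partition_on_def disjoint_def
  by (metis disjoint_iff nth_eq_iff_index_eq nth_mem)

lemma composition_word_nth:
  assumes "i < length Bs" "p \<in> Bs ! i"
  shows "composition_word n Bs ! (p - 1) = Suc i"
proof -
  have "p \<in> {1..n}" using assms Bs unfolding partition_on_def by (metis UnionI nth_mem)
  then have "p - 1 < n" "1 + (p - 1) = p" by auto
  then have "composition_word n Bs ! (p - 1) = Suc (LEAST i. i < length Bs \<and> p \<in> Bs ! i)"
    by (simp add: composition_word_def del: upt_Suc)
  also have "(LEAST i. i < length Bs \<and> p \<in> Bs ! i) = i"
    using assms by (intro Least_equality) (auto dest: composition_block_unique[of i _ p])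
  finally show ?thesis .
qed

lemma composition_block_exists:
  assumes "p \<in> {1..n}"
  obtains i where "i < length Bs" "p \<in> Bs ! i"
proof -
  from assms Bs(2) have "p \<in> \<Union> (set Bs)" by (simp add: partition_on_def)
  then show thesis using that by (auto simp: in_set_conv_nth)
qed

lemma composition_block_eq:
  assumes "i < length Bs"
  shows "{p \<in> {1..n}. composition_word n Bs ! (p - 1) = Suc i} = Bs ! i"
proof
  show "Bs ! i \<subseteq> {p \<in> {1..n}. composition_word n Bs ! (p - 1) = Suc i}"
  proof
    fix p assume p: "p \<in> Bs ! i"
    then have "p \<in> {1..n}" using assms Bs unfolding partition_on_def by (metis UnionI nth_mem)
    then show "p \<in> {p \<in> {1..n}. composition_word n Bs ! (p - 1) = Suc i}"
      using composition_word_nth[OF assms p] by simp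
  qed
next
  show "{p \<in> {1..n}. composition_word n Bs ! (p - 1) = Suc i} \<subseteq> Bs ! i"
  proof
    fix p assume "p \<in> {p \<in> {1..n}. composition_word n Bs ! (p - 1) = Suc i}"
    then have p: "p \<in> {1..n}" "composition_word n Bs ! (p - 1) = Suc i" by auto
    from composition_block_exists[OF p(1)] obtain j where j: "j < length Bs" "p \<in> Bs ! j" .
    with composition_word_nth[OF j] p show "p \<in> Bs ! i" by simp
  qed
qed

lemma set_composition_word: "set (composition_word n Bs) = {1..length Bs}"
proof
  show "set (composition_word n Bs) \<subseteq> {1..length Bs}"
  proof
    fix x assume "x \<in> set (composition_word n Bs)"
    then obtain k where k: "k < n" "x = composition_word n Bs ! k" by (auto simp: in_set_conv_nth)
    then have "Suc k \<in> {1..n}" by auto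
    then obtain i where i: "i < length Bs" "Suc k \<in> Bs ! i" by (rule composition_block_exists)
    with composition_word_nth[OF i] k show "x \<in> {1..length Bs}" by simp
  qed
  show "{1..length Bs} \<subseteq> set (composition_word n Bs)"
  proof
    fix x assume "x \<in> {1..length Bs}"
    then obtain i where i: "i < length Bs" "x = Suc i" by (cases x) auto
    have "Bs ! i \<noteq> {}" using Bs(2) i(1) nth_mem unfolding partition_on_def by metis
    then obtain p where p: "p \<in> Bs ! i" by blast
    have "p \<in> {1..n}" using p composition_block_eq[OF i(1)] by blast
    then have "composition_word n Bs ! (p - 1) \<in> set (composition_word n Bs)"
      by (intro nth_mem) auto
    then show "x \<in> set (composition_word n Bs)"
      using composition_word_nth[OF i(1) p] i by simp
  qed
qed

lemma composition_word_packed: "composition_word n Bs \<in> packed_words n"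
  unfolding packed_words_def packed_iff using set_composition_word by auto

lemma word_partition_composition_word: "word_partition (composition_word n Bs) = set Bs"
proof -
  have "word_partition (composition_word n Bs) =
      (\<lambda>i. {p \<in> {1..n}. composition_word n Bs ! (p - 1) = Suc i}) ` {..<length Bs}"
    unfolding word_partition_def set_composition_word length_composition_word
    by (simp add: image_image flip: image_Suc_lessThan)
  also have "\<dots> = (!) Bs ` {..<length Bs}"
    using composition_block_eq by (intro image_cong refl) auto
  also have "\<dots> = set Bs" by (auto simp: set_conv_nth)
  finally show ?thesis .
qed

text \<open>Here \<open>g\<close> is the letter of \<open>y\<close> on a block. Being fixed by
  \<open>y\<close> becomes a sorting condition on the list of blocks, which is the form in which
  fixed words are counted.\<close>

lemma pack_composition_word_iff:
  assumes y: "y \<in> packed_words n" and g: "\<And>A p. A \<in> set Bs \<Longrightarrow> p \<in> A \<Longrightarrow> g A = y ! (p - 1)"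
  shows "pack y (composition_word n Bs) = composition_word n Bs \<longleftrightarrow> sorted (map g Bs)"
proof -
  let ?w = "composition_word n Bs"
  have "pack y ?w = ?w \<longleftrightarrow> (\<forall>i<n. \<forall>j<n. ?w ! i \<le> ?w ! j \<longrightarrow> y ! i \<le> y ! j)"
    by (rule pack_absorb_left_iff[OF y composition_word_packed])
  also have "\<dots> \<longleftrightarrow> (\<forall>i<length Bs. \<forall>j<length Bs. i \<le> j \<longrightarrow> g (Bs ! i) \<le> g (Bs ! j))"
  proof (intro iffI allI impI)
    fix i j assume *: "\<forall>i<n. \<forall>j<n. ?w ! i \<le> ?w ! j \<longrightarrow> y ! i \<le> y ! j"
      and ij: "i < length Bs" "j < length Bs" "i \<le> j"
    have ne: "\<exists>p. p \<in> Bs ! k" if "k < length Bs" for k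
      using Bs(2) nth_mem[OF that] unfolding partition_on_def by (metis ex_in_conv)
    obtain p q where pq: "p \<in> Bs ! i" "q \<in> Bs ! j" using ne ij by meson
    then have "p \<in> {1..n}" "q \<in> {1..n}" using composition_block_eq ij by blast+
    then have "p - 1 < n" "q - 1 < n" by auto
    moreover have "?w ! (p - 1) \<le> ?w ! (q - 1)"
      using composition_word_nth[OF ij(1) pq(1)] composition_word_nth[OF ij(2) pq(2)] ij by simp
    ultimately have "y ! (p - 1) \<le> y ! (q - 1)" using * by blast
    then show "g (Bs ! i) \<le> g (Bs ! j)"
      using g[OF nth_mem[OF ij(1)] pq(1)] g[OF nth_mem[OF ij(2)] pq(2)] by simp
  next
    fix k l assume *: "\<forall>i<length Bs. \<forall>j<length Bs. i \<le> j \<longrightarrow> g (Bs ! i) \<le> g (Bs ! j)"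
      and kl: "k < n" "l < n" "?w ! k \<le> ?w ! l"
    have "Suc k \<in> {1..n}" "Suc l \<in> {1..n}" using kl by auto
    then obtain i j where i: "i < length Bs" "Suc k \<in> Bs ! i" and j: "j < length Bs" "Suc l \<in> Bs ! j"
      by (meson composition_block_exists)
    have "i \<le> j" using composition_word_nth[OF i] composition_word_nth[OF j] kl by simp
    then have "g (Bs ! i) \<le> g (Bs ! j)" using * i j by blast
    then show "y ! k \<le> y ! l"
      using g[OF nth_mem[OF i(1)] i(2)] g[OF nth_mem[OF j(1)] j(2)] by simp
  qed
  also have "\<dots> \<longleftrightarrow> sorted (map g Bs)"
    by (auto simp: sorted_iff_nth_mono)
  finally show ?thesis .
qed

end

text \<open>A packed word of support \<alpha> is the same as a linear order on the blocks of
  \<alpha>.\<close>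

lemma bij_betw_composition_word:
  assumes "\<alpha> \<in> set_partitions n"
  shows "bij_betw (composition_word n) {Bs. distinct Bs \<and> set Bs = \<alpha>}
    {u \<in> packed_words n. word_partition u = \<alpha>}"
proof (rule bij_betwI')
  have part: "partition_on {1..n} \<alpha>" using assms by (simp add: set_partitions_def)
  fix Bs Cs assume "Bs \<in> {Bs. distinct Bs \<and> set Bs = \<alpha>}" "Cs \<in> {Bs. distinct Bs \<and> set Bs = \<alpha>}"
  then have Bs: "distinct Bs" "set Bs = \<alpha>" "partition_on {1..n} (set Bs)"
    and Cs: "distinct Cs" "set Cs = \<alpha>" "partition_on {1..n} (set Cs)"
    using part by auto
  show "composition_word n Bs = composition_word n Cs \<longleftrightarrow> Bs = Cs"
  proof
    assume eq: "composition_word n Bs = composition_word n Cs"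
    show "Bs = Cs"
    proof (rule nth_equalityI)
      show len: "length Bs = length Cs" using Bs Cs by (metis distinct_card)
      fix i assume "i < length Bs"
      then show "Bs ! i = Cs ! i"
        using composition_block_eq[OF Bs(1,3), of i] composition_block_eq[OF Cs(1,3), of i] eq len
        by simp
    qed
  qed simp
  show "composition_word n Bs \<in> {u \<in> packed_words n. word_partition u = \<alpha>}"
    using composition_word_packed[OF Bs(1,3)] word_partition_composition_word[OF Bs(1,3)] Bs by simp
next
  fix u assume "u \<in> {u \<in> packed_words n. word_partition u = \<alpha>}"
  then obtain m where u: "set u = {1..m}" "length u = n" "word_partition u = \<alpha>" "u \<in> packed_words n"
    by (auto simp: packed_words_def packed_iff)
  define F where "F j = {p \<in> {1..n}. u ! (p - 1) = j}" for j
  define Bs where "Bs = map F [1..<Suc m]"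
  have img: "set Bs = \<alpha>"
    using u by (simp add: Bs_def F_def word_partition_def atLeastLessThanSuc_atLeastAtMost del: upt_Suc)
  have "inj_on F {1..m}"
  proof (rule inj_onI)
    fix j k assume jk: "j \<in> {1..m}" "k \<in> {1..m}" "F j = F k"
    then obtain i where i: "i < n" "u ! i = j" using u by (metis in_set_conv_nth)
    then have "Suc i \<in> F j" by (simp add: F_def)
    then have "Suc i \<in> F k" using jk by simp
    then show "j = k" using i by (simp add: F_def)
  qed
  then have dist: "distinct Bs"
    by (simp add: Bs_def distinct_map atLeastLessThanSuc_atLeastAtMost del: upt_Suc)
  have part: "partition_on {1..n} (set Bs)" using img assms by (simp add: set_partitions_def)
  have "u = composition_word n Bs"
  proof (rule nth_equalityI)
    fix k assume k: "k < length u"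
    then have "u ! k \<in> {1..m}" using u nth_mem by blast
    then obtain i where i: "i < m" "u ! k = Suc i" by (cases "u ! k") auto
    have len: "length Bs = m" by (simp add: Bs_def del: upt_Suc)
    have "Suc k \<in> Bs ! i" using i k u by (simp add: Bs_def F_def del: upt_Suc)
    from composition_word_nth[OF dist part _ this] show "u ! k = composition_word n Bs ! k"
      using i len by simp
  qed (use u in simp)
  then show "\<exists>x\<in>{Bs. distinct Bs \<and> set Bs = \<alpha>}. u = composition_word n x"
    using dist img by blast
qed

text \<open>The arbitrary representative \<open>x_X\<close> of each support that Saliola's recursion
  starts from.\<close>

definition partition_word :: "nat \<Rightarrow> nat set set \<Rightarrow> nat list" where
  "partition_word n \<pi> = (SOME u. u \<in> packed_words n \<and> word_partition u = \<pi>)"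

lemma finite_set_partition: "\<pi> \<in> set_partitions n \<Longrightarrow> finite \<pi>"
  by (auto simp: set_partitions_def intro: finite_elements)

lemma finite_set_partitions: "finite (set_partitions n)"
  unfolding set_partitions_def by (rule finitely_many_partition_on) simp

lemma partition_word:
  assumes "\<pi> \<in> set_partitions n"
  shows "partition_word n \<pi> \<in> packed_words n" "word_partition (partition_word n \<pi>) = \<pi>"
proof -
  obtain Bs where "set Bs = \<pi>" "distinct Bs"
    using finite_distinct_list[OF finite_set_partition[OF assms]] by blast
  then have "\<exists>u. u \<in> packed_words n \<and> word_partition u = \<pi>"
    using bij_betwE[OF bij_betw_composition_word[OF assms]] by blast
  then have "partition_word n \<pi> \<in> packed_words n \<and> word_partition (partition_word n \<pi>) = \<pi>"
    unfolding partition_word_def by (rule someI_ex)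
  then show "partition_word n \<pi> \<in> packed_words n" "word_partition (partition_word n \<pi>) = \<pi>" by auto
qed

lemma length_partition_word: "\<pi> \<in> set_partitions n \<Longrightarrow> length (partition_word n \<pi>) = n"
  using partition_word(1) by (simp add: packed_words_def)

text \<open>Sending a block of \<open>X\<close> to the block of \<open>Y\<close> containing it is
  surjective. If the cardinalities agree it is also injective, and then a block of \<open>Y\<close>
  cannot contain a second block of \<open>X\<close>.\<close>

lemma refines_card:
  assumes ref: "refines A X Y" and "finite A"
  shows "card Y \<le> card X" "card Y = card X \<Longrightarrow> X = Y"
proof -
  have X: "partition_on A X" and Y: "partition_on A Y" using ref by (auto simp: refines_def)
  have fin: "finite X" using X \<open>finite A\<close> by (rule finite_elements[rotated])
  obtain f where f: "\<And>x. x \<in> X \<Longrightarrow> f x \<in> Y \<and> x \<subseteq> f x"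
    using ref unfolding refines_def by metis
  have f_eq: "y = f x" if "x \<in> X" "y \<in> Y" "x \<inter> y \<noteq> {}" for x y
  proof -
    have "f x \<inter> y \<noteq> {}" using f[OF that(1)] that(3) by blast
    then show ?thesis using f[OF that(1)] that(2) Y unfolding partition_on_def disjoint_def by metis
  qed
  have surj: "f ` X = Y"
  proof
    show "Y \<subseteq> f ` X"
    proof
      fix y assume y: "y \<in> Y"
      then obtain p where p: "p \<in> y" using Y unfolding partition_on_def by (metis ex_in_conv)
      then have "p \<in> A" using y Y unfolding partition_on_def by blast
      then obtain x where x: "x \<in> X" "p \<in> x" using X unfolding partition_on_def by blast
      then have "y = f x" using f_eq[OF x(1) y] p by blast
      then show "y \<in> f ` X" using x by blast
    qed
  qed (use f in blast)
  then show "card Y \<le> card X" using card_image_le[OF fin] by blast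
  show "X = Y" if "card Y = card X"
  proof -
    have inj: "inj_on f X" using eq_card_imp_inj_on[OF fin] surj that by metis
    have "f x = x" if x: "x \<in> X" for x
    proof
      show "x \<subseteq> f x" using f[OF x] by blast
      show "f x \<subseteq> x"
      proof
        fix p assume p: "p \<in> f x"
        then have "p \<in> A" using f[OF x] Y unfolding partition_on_def by blast
        then obtain x' where x': "x' \<in> X" "p \<in> x'" using X unfolding partition_on_def by blast
        then have "f x = f x'" using f_eq[OF x'(1), of "f x"] f[OF x] p by blast
        then show "p \<in> x" using inj x x' unfolding inj_on_def by metis
      qed
    qed
    then show "X = Y" using surj by force
  qed
qed

lemma card_set_partition_le: "\<pi> \<in> set_partitions n \<Longrightarrow> card \<pi> \<le> n"
proof -
  assume \<pi>: "\<pi> \<in> set_partitions n"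
  then have "refines {1..n} ((\<lambda>i. {i}) ` {1..n}) \<pi>"
    unfolding refines_def using partition_on_singletons[of "{1..n}"]
    by (auto simp: set_partitions_def partition_on_def)
  then have "card \<pi> \<le> card ((\<lambda>i. {i}) ` {1..n})"
    by (intro refines_card(1)[of "{1..n}"]) auto
  also have "\<dots> \<le> n" using card_image_le[of "{1..n}" "\<lambda>i. {i}"] by simp
  finally show ?thesis .
qed

lemma refines_in_set_partitions:
  "refines {1..n} X Y \<Longrightarrow> X \<in> set_partitions n" "refines {1..n} X Y \<Longrightarrow> Y \<in> set_partitions n"
  by (auto simp: refines_def set_partitions_def)

definition strictly_finer :: "nat \<Rightarrow> nat set set \<Rightarrow> nat set set set" where
  "strictly_finer n X = {Y. refines {1..n} Y X \<and> Y \<noteq> X}"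

text \<open>The reason why Saliola's recursion terminates: it descends to partitions with more
  blocks, of which there are at most \<open>n\<close>.\<close>

lemma strictly_finer_card:
  assumes "Y \<in> strictly_finer n X"
  shows "card X < card Y" "card Y \<le> n"
proof -
  have Y: "refines {1..n} Y X" "Y \<noteq> X" using assms by (auto simp: strictly_finer_def)
  have "card X \<noteq> card Y" using refines_card(2)[OF Y(1)] Y(2) by auto
  then show "card X < card Y" using refines_card(1)[OF Y(1)] by simp
  show "card Y \<le> n" using card_set_partition_le refines_in_set_partitions(1)[OF Y(1)] .
qed

lemma finite_strictly_finer [simp]: "finite (strictly_finer n X)"
  by (rule finite_subset[OF _ finite_set_partitions[of n]])
     (use refines_in_set_partitions in \<open>auto simp: strictly_finer_def\<close>)

section \<open>Saliola's idempotents\<close>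

function saliola :: "nat \<Rightarrow> nat set set \<Rightarrow> 'k::field wqsym" where
  "saliola n X = NN (partition_word n X) -
    (\<Sum>Y\<in>strictly_finer n X. NN (partition_word n X) \<star> saliola n Y)"
  by pat_completeness auto
termination
proof (relation "measure (\<lambda>(n, X). n - card X)")
  fix n X Y assume "Y \<in> strictly_finer n X"
  from strictly_finer_card[OF this] show "((n, Y), n, X) \<in> measure (\<lambda>(n, X). n - card X)" by auto
qed simp

declare saliola.simps [simp del]

lemma keys_star:
  assumes "w \<in> Poly_Mapping.keys (F \<star> G)"
  shows "\<exists>u\<in>Poly_Mapping.keys F. \<exists>v\<in>Poly_Mapping.keys G. length u = length v \<and> w = pack u v"
proof (rule ccontr)
  assume *: "\<not> ?thesis"
  have "Poly_Mapping.lookup (F \<star> G) w = 0"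
    unfolding internal_product_def bilinear_extension_def lookup_sum
    by (intro sum.neutral ballI) (use * in \<open>auto simp: lookup_wscale lookup_NN\<close>)
  then show False using assms by (simp add: in_keys_iff)
qed

definition words_of_partition :: "nat \<Rightarrow> nat set set \<Rightarrow> nat list set" where
  "words_of_partition n \<alpha> = {u \<in> packed_words n. word_partition u = \<alpha>}"

lemma words_of_partition_packed: "u \<in> words_of_partition n \<alpha> \<Longrightarrow> u \<in> packed_words n"
  by (simp add: words_of_partition_def)

lemma length_words_of_partition: "u \<in> words_of_partition n \<alpha> \<Longrightarrow> length u = n"
  by (simp add: words_of_partition_def packed_words_def)

lemma finite_words_of_partition [simp]: "finite (words_of_partition n \<alpha>)"
  by (rule finite_subset[OF _ finite_packed_words[of n]]) (auto simp: words_of_partition_def)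

lemma partition_word_in_words: "\<alpha> \<in> set_partitions n \<Longrightarrow> partition_word n \<alpha> \<in> words_of_partition n \<alpha>"
  using partition_word by (simp add: words_of_partition_def)

lemma word_partition_packed_words: "u \<in> packed_words n \<Longrightarrow> word_partition u \<in> set_partitions n"
  by (simp add: packed_words_def word_partition_in_set_partitions)

lemma refines_refl': "\<alpha> \<in> set_partitions n \<Longrightarrow> refines {1..n} \<alpha> \<alpha>"
  by (simp add: set_partitions_def refines_refl)

lemma word_partition_pack_refines:
  assumes "length u = n" "length v = n"
  shows "refines {1..n} (word_partition (pack u v)) (word_partition u)"
    and "refines {1..n} (word_partition (pack u v)) (word_partition v)"
proof -
  have "length (pack u v) = n" using assms by simp
  then have *: "word_partition (pack u v) \<in> set_partitions n" by (rule word_partition_in_set_partitions)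
  from refines_word_partition_pack_iff[OF * assms] refines_refl'[OF *]
  show "refines {1..n} (word_partition (pack u v)) (word_partition u)"
    and "refines {1..n} (word_partition (pack u v)) (word_partition v)" by auto
qed

lemma word_partition_pack_eq:
  assumes u: "u \<in> packed_words n" and v: "v \<in> words_of_partition n \<alpha>"
    and ref: "refines {1..n} \<alpha> (word_partition u)"
  shows "pack u v \<in> words_of_partition n \<alpha>"
proof -
  have len: "length u = n" "length v = n" "word_partition v = \<alpha>"
    using u v by (auto simp: packed_words_def words_of_partition_def)
  have "\<alpha> \<in> set_partitions n" using ref refines_in_set_partitions by blast
  then have "refines {1..n} \<alpha> (word_partition (pack u v))"
    using refines_word_partition_pack_iff[of \<alpha> n u v] len ref refines_refl' by auto
  then show ?thesis
    using refines_asym word_partition_pack_refines(2)[OF len(1,2)] len pack_in_packed_words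
    unfolding words_of_partition_def by blast
qed

lemma star_NN_packed:
  "u \<in> packed_words n \<Longrightarrow> v \<in> packed_words n \<Longrightarrow> NN u \<star> NN v = NN (pack u v)"
  by (simp add: star_NN packed_words_def)

text \<open>The left regular band law \<open>x y = x\<close> for elements of equal support; in
  particular every packed word is idempotent.\<close>

lemma NN_star_same_partition:
  assumes "u \<in> words_of_partition n \<alpha>" "v \<in> words_of_partition n \<alpha>"
  shows "NN u \<star> NN v = NN u"
proof -
  have "pack u v = u"
    using assms pack_absorb_right_iff[of u n v] refines_refl'[of \<alpha> n] word_partition_packed_words[of u n]
    by (auto simp: words_of_partition_def)
  then show ?thesis
    by (simp add: star_NN_packed[OF assms[THEN words_of_partition_packed]])
qed

lemma saliola_in_WQ: "X \<in> set_partitions n \<Longrightarrow> (saliola n X :: 'k::field wqsym) \<in> WQ n"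
proof (induction n X rule: saliola.induct)
  case (1 n X)
  have "(saliola n Y :: 'k wqsym) \<in> WQ n" if "Y \<in> strictly_finer n X" for Y
    using 1(1)[OF that] that refines_in_set_partitions by (auto simp: strictly_finer_def)
  then show ?case
    using partition_word(1)[OF 1(2)]
    by (subst saliola.simps, intro wq.subspace_diff wq.subspace_sum subspace_WQ star_in_WQ NN_in_WQ)
qed

text \<open>The whole right-hand side of the recursion is a left multiple of the idempotent
  \<open>partition_word n X\<close>.\<close>

lemma partition_word_star_saliola:
  assumes "X \<in> set_partitions n"
  shows "NN (partition_word n X) \<star> saliola n X = saliola n X"
  by (subst (1 2) saliola.simps)
     (simp only: star_diff_right star_sum_right star_assoc[symmetric]
        NN_star_same_partition[OF partition_word_in_words partition_word_in_words, OF assms assms])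

text \<open>Being fixed by left multiplication with the word of support \<open>X\<close>, the
  element involves only products that begin with this word, and their supports are finer than
  \<open>X\<close>.\<close>

lemma keys_saliola:
  assumes "X \<in> set_partitions n" "u \<in> Poly_Mapping.keys (saliola n X :: 'k::field wqsym)"
  shows "u \<in> packed_words n" "refines {1..n} (word_partition u) X"
proof -
  show pu: "u \<in> packed_words n" using saliola_in_WQ[OF assms(1)] assms(2) by (auto simp: WQ_iff)
  have "\<exists>v\<in>packed_words n. u = pack (partition_word n X) v"
  proof -
    have "u \<in> Poly_Mapping.keys (NN (partition_word n X) \<star> (saliola n X :: 'k wqsym))"
      using assms by (simp add: partition_word_star_saliola)
    from keys_star[OF this] show ?thesis
      using saliola_in_WQ[OF assms(1)] by (auto simp: WQ_iff)
  qed
  then obtain v where "v \<in> packed_words n" "u = pack (partition_word n X) v" by blast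
  then show "refines {1..n} (word_partition u) X"
    using word_partition_pack_refines(1)[of "partition_word n X" n v] partition_word[OF assms(1)]
      length_partition_word[OF assms(1)] by (simp add: packed_words_def)
qed

lemma strictly_finer_in_set_partitions: "Y \<in> strictly_finer n X \<Longrightarrow> Y \<in> set_partitions n"
  using refines_in_set_partitions by (auto simp: strictly_finer_def)

text \<open>For the chosen word this is the recursion with all terms moved to one side;
  multiplication by \<open>z\<close>, which absorbs the chosen word, gives it for every word of the
  same support.\<close>

lemma NN_eq_sum_saliola:
  assumes z: "z \<in> words_of_partition n X" and X: "X \<in> set_partitions n"
  shows "NN z = (\<Sum>Y | refines {1..n} Y X. NN z \<star> (saliola n Y :: 'k::field wqsym))"
proof -
  let ?x = "NN (partition_word n X) :: 'k wqsym"
  have set: "{Y. refines {1..n} Y X} = insert X (strictly_finer n X)" "X \<notin> strictly_finer n X"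
    using refines_refl'[OF X] by (auto simp: strictly_finer_def)
  have "?x = saliola n X + (\<Sum>Y\<in>strictly_finer n X. ?x \<star> saliola n Y)"
    by (subst saliola.simps) simp
  then have x: "?x = ?x \<star> saliola n X + (\<Sum>Y\<in>strictly_finer n X. ?x \<star> saliola n Y)"
    by (simp only: partition_word_star_saliola[OF X])
  have zx: "NN z \<star> ?x = NN z"
    using z partition_word_in_words[OF X] by (rule NN_star_same_partition)
  then have "NN z = NN z \<star> ?x" by simp
  also have "\<dots> = NN z \<star> (?x \<star> saliola n X + (\<Sum>Y\<in>strictly_finer n X. ?x \<star> saliola n Y))"
    by (subst x) (rule refl)
  also have "\<dots> = NN z \<star> saliola n X + (\<Sum>Y\<in>strictly_finer n X. NN z \<star> saliola n Y)"
    by (simp only: star_add_right star_sum_right star_assoc[symmetric] zx)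
  finally show ?thesis by (simp add: set)
qed

text \<open>Source of all the triangularity. The product of \<open>y\<close> with the word of
  \<open>X\<close> is a word \<open>z\<close> of support \<open>Z\<close> strictly finer than
  \<open>X\<close>. In the recursion the terms for \<open>Y\<close> not below \<open>Z\<close>
  vanish by induction, and the remaining ones add up to \<open>z\<close> itself, which
  cancels.\<close>

lemma NN_star_saliola_eq_0:
  assumes "y \<in> packed_words n" "X \<in> set_partitions n" "\<not> refines {1..n} X (word_partition y)"
  shows "NN y \<star> saliola n X = (0 :: 'k::field wqsym)"
  using assms
proof (induction n X arbitrary: y rule: saliola.induct)
  case (1 n X)
  let ?x = "partition_word n X"
  define z where "z = pack y ?x"
  define Z where "Z = word_partition z"
  have x: "?x \<in> packed_words n" "length ?x = n" "word_partition ?x = X"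
    using partition_word[OF "1.prems"(2)] length_partition_word[OF "1.prems"(2)] by auto
  have y: "length y = n" using "1.prems"(1) by (simp add: packed_words_def)
  have z: "z \<in> packed_words n" using x y by (simp add: z_def pack_in_packed_words)
  then have Z: "z \<in> words_of_partition n Z" "Z \<in> set_partitions n"
    by (auto simp: words_of_partition_def Z_def word_partition_packed_words)
  have ZX: "refines {1..n} Z X" and Zy: "refines {1..n} Z (word_partition y)"
    using word_partition_pack_refines[OF y x(2)] x by (auto simp: Z_def z_def)
  then have "Z \<noteq> X" using "1.prems"(3) by auto
  have sub: "{Y. refines {1..n} Y Z} \<subseteq> strictly_finer n X"
    using ZX \<open>Z \<noteq> X\<close> refines_trans refines_asym unfolding strictly_finer_def by blast
  have zero: "NN z \<star> saliola n Y = (0 :: 'k wqsym)" if "Y \<in> strictly_finer n X - {Y. refines {1..n} Y Z}" for Y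
    using "1.IH"[of Y z] that z strictly_finer_in_set_partitions[of Y n X] by (auto simp: Z_def)
  have "NN y \<star> saliola n X = NN z - (\<Sum>Y\<in>strictly_finer n X. NN z \<star> (saliola n Y :: 'k wqsym))"
    unfolding saliola.simps[of n X] star_diff_right star_sum_right star_assoc[symmetric]
      star_NN_packed[OF "1.prems"(1) x(1)] z_def[symmetric] ..
  also have "(\<Sum>Y\<in>strictly_finer n X. NN z \<star> (saliola n Y :: 'k wqsym)) = (\<Sum>Y | refines {1..n} Y Z. NN z \<star> saliola n Y)"
    using sub zero by (intro sum.mono_neutral_right) auto
  also have "\<dots> = NN z" using NN_eq_sum_saliola[OF Z] ..
  finally show ?case by simp
qed

lemma star_saliola_eq_0:
  assumes "F \<in> WQ n" "X \<in> set_partitions n"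
    and "\<And>u. u \<in> Poly_Mapping.keys F \<Longrightarrow> \<not> refines {1..n} X (word_partition u)"
  shows "F \<star> saliola n X = 0"
proof -
  have "F \<star> saliola n X = (\<Sum>u\<in>Poly_Mapping.keys F. wscale (Poly_Mapping.lookup F u) (NN u \<star> saliola n X))"
    by (subst wq_expand) (simp add: star_sum_left star_scale_left)
  also have "\<dots> = 0"
    using assms NN_star_saliola_eq_0[OF _ assms(2)] by (intro sum.neutral) (auto simp: WQ_iff)
  finally show ?thesis .
qed

text \<open>The corrections in \<open>x \<star> saliola n X\<close> only involve words of strictly
  finer support. Coefficients at words of support \<open>X\<close> therefore serve as coordinates
  and give linear independence.\<close>

lemma lookup_NN_star_saliola:
  assumes X: "X \<in> set_partitions n" and x: "x \<in> words_of_partition n X" and w: "w \<in> words_of_partition n X"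
  shows "Poly_Mapping.lookup (NN x \<star> saliola n X :: 'k::field wqsym) w = (if x = w then 1 else 0)"
proof -
  have zero: "Poly_Mapping.lookup (NN x \<star> saliola n Y :: 'k wqsym) w = 0" if Y: "Y \<in> strictly_finer n X" for Y
  proof (rule ccontr)
    assume "Poly_Mapping.lookup (NN x \<star> saliola n Y :: 'k wqsym) w \<noteq> 0"
    then have "w \<in> Poly_Mapping.keys (NN x \<star> saliola n Y :: 'k wqsym)" by (simp add: in_keys_iff)
    from keys_star[OF this] obtain v where v: "v \<in> Poly_Mapping.keys (saliola n Y :: 'k wqsym)"
      "length x = length v" "w = pack x v" by auto
    have YP: "Y \<in> set_partitions n" using Y by (rule strictly_finer_in_set_partitions)
    have "refines {1..n} X (word_partition v)"
      using word_partition_pack_refines(2)[of x n v] v x w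
      by (auto simp: words_of_partition_def packed_words_def)
    then have "refines {1..n} X Y" using keys_saliola(2)[OF YP v(1)] refines_trans by blast
    then show False using Y refines_asym by (auto simp: strictly_finer_def)
  qed
  have "NN x \<star> saliola n X = NN x - (\<Sum>Y\<in>strictly_finer n X. NN x \<star> (saliola n Y :: 'k wqsym))"
    unfolding saliola.simps[of n X] star_diff_right star_sum_right star_assoc[symmetric]
      NN_star_same_partition[OF x partition_word_in_words[OF X]] ..
  then show ?thesis
    using zero by (simp add: lookup_minus lookup_sum lookup_NN)
qed

text \<open>Any word \<open>z\<close> may be replaced by \<open>z\<close> times the chosen word of
  \<open>X\<close>, which has support \<open>X\<close> unless the product with
  \<open>saliola n X\<close> is zero.\<close>

lemma star_saliola_expand:
  fixes F :: "'k::field wqsym"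
  assumes F: "F \<in> WQ n" and X: "X \<in> set_partitions n"
  shows "F \<star> saliola n X = (\<Sum>x\<in>words_of_partition n X.
    wscale (Poly_Mapping.lookup (F \<star> saliola n X) x) (NN x \<star> saliola n X))"
proof -
  let ?S = "(\<lambda>x. NN x \<star> saliola n X :: 'k wqsym) ` words_of_partition n X"
  have NN: "NN z \<star> (saliola n X :: 'k wqsym) \<in> wq.span ?S" if z: "z \<in> packed_words n" for z
  proof (cases "refines {1..n} X (word_partition z)")
    case True
    let ?x = "partition_word n X"
    have "NN z \<star> saliola n X = NN z \<star> (NN ?x \<star> saliola n X)"
      by (simp add: partition_word_star_saliola X)
    also have "\<dots> = NN (pack z ?x) \<star> saliola n X"
      using z partition_word(1)[OF X] by (simp add: star_NN_packed flip: star_assoc)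
    finally show ?thesis
      using word_partition_pack_eq[OF z partition_word_in_words[OF X] True]
      by (auto intro: wq.span_base)
  qed (simp add: NN_star_saliola_eq_0[OF z X] wq.span_zero)
  obtain a where a: "F = (\<Sum>u\<in>packed_words n. wscale (a u) (NN u))"
    using F by (rule WQ_expand)
  have "F \<star> saliola n X \<in> wq.span ?S"
    unfolding a star_sum_left star_scale_left by (intro wq.span_sum wq.span_scale NN)
  then show ?thesis
  proof (induction rule: wq.span_induct_alt)
    case (step c v G)
    then obtain y where y: "y \<in> words_of_partition n X" "v = NN y \<star> saliola n X" by blast
    have "(\<Sum>x\<in>words_of_partition n X. wscale (Poly_Mapping.lookup v x) (NN x \<star> saliola n X)) =
        (\<Sum>x\<in>words_of_partition n X. if y = x then NN x \<star> saliola n X else 0)"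
      unfolding y(2) by (intro sum.cong refl) (simp add: lookup_NN_star_saliola[OF X y(1)])
    also have "\<dots> = v" using y by simp
    finally have v: "(\<Sum>x\<in>words_of_partition n X. wscale (Poly_Mapping.lookup v x) (NN x \<star> saliola n X)) = v" .
    have "(\<Sum>x\<in>words_of_partition n X. wscale (Poly_Mapping.lookup (wscale c v + G) x) (NN x \<star> saliola n X)) =
        wscale c (\<Sum>x\<in>words_of_partition n X. wscale (Poly_Mapping.lookup v x) (NN x \<star> saliola n X)) +
        (\<Sum>x\<in>words_of_partition n X. wscale (Poly_Mapping.lookup G x) (NN x \<star> saliola n X))"
      by (simp add: lookup_add lookup_wscale wq.scale_left_distrib sum.distrib wq.scale_sum_right)
    then show ?case unfolding v step.IH[symmetric] by simp
  qed simp
qed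

text \<open>By induction the term of \<open>Y\<close> contributes 1 exactly when \<sigma> is
  \<open>Y\<close>. So the value is 1 for \<sigma> finer than \<open>X\<close>, corrected by 1 if
  \<sigma> is strictly finer.\<close>

lemma chi_saliola:
  assumes "X \<in> set_partitions n" "\<sigma> \<in> set_partitions n"
  shows "chi \<sigma> (saliola n X :: 'k::field wqsym) = (if \<sigma> = X then 1 else 0)"
  using assms
proof (induction n X rule: saliola.induct)
  case (1 n X)
  have x: "chi \<sigma> (NN (partition_word n X) :: 'k wqsym) = (if refines {1..n} \<sigma> X then 1 else 0)"
    using partition_word[OF "1.prems"(1)] length_partition_word[OF "1.prems"(1)] by (simp add: chi_NN)
  have IH: "chi \<sigma> (NN (partition_word n X) \<star> saliola n Y :: 'k wqsym) = (if \<sigma> = Y then 1 else 0)"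
    if Y: "Y \<in> strictly_finer n X" for Y
  proof -
    have YP: "Y \<in> set_partitions n" using Y by (rule strictly_finer_in_set_partitions)
    have "chi \<sigma> (NN (partition_word n X) \<star> saliola n Y :: 'k wqsym) =
        chi \<sigma> (NN (partition_word n X) :: 'k wqsym) * chi \<sigma> (saliola n Y :: 'k wqsym)"
      by (rule chi_star[OF "1.prems"(2) NN_in_WQ[OF partition_word(1)[OF "1.prems"(1)]] saliola_in_WQ[OF YP]])
    then show ?thesis
      using Y "1.IH"[OF Y YP "1.prems"(2)] x by (auto simp: strictly_finer_def)
  qed
  have "chi \<sigma> (saliola n X :: 'k wqsym) = chi \<sigma> (NN (partition_word n X) :: 'k wqsym) -
      (\<Sum>Y\<in>strictly_finer n X. chi \<sigma> (NN (partition_word n X) \<star> saliola n Y :: 'k wqsym))"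
    by (subst saliola.simps) (simp only: chi_diff chi_sum)
  also have "\<dots> = (if refines {1..n} \<sigma> X then 1 else 0) - (if \<sigma> \<in> strictly_finer n X then 1 else 0)"
    unfolding x by (simp add: IH)
  also have "\<dots> = (if \<sigma> = X then 1 else 0)"
    using refines_refl'[OF "1.prems"(1)] by (auto simp: strictly_finer_def)
  finally show ?case .
qed

text \<open>All words in \<open>saliola n Y \<star> F\<close> have supports finer than
  \<open>Y\<close>, so \<open>X\<close> refines none of them.\<close>

lemma saliola_peirce_eq_0:
  assumes "X \<in> set_partitions n" "Y \<in> set_partitions n" "F \<in> WQ n" "\<not> refines {1..n} X Y"
  shows "saliola n Y \<star> F \<star> saliola n X = (0 :: 'k::field wqsym)"
proof (rule star_saliola_eq_0)
  show "(saliola n Y :: 'k wqsym) \<star> F \<in> WQ n"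
    using assms by (intro star_in_WQ saliola_in_WQ)
  fix w assume "w \<in> Poly_Mapping.keys ((saliola n Y :: 'k wqsym) \<star> F)"
  from keys_star[OF this] obtain u v where uv: "u \<in> Poly_Mapping.keys (saliola n Y :: 'k wqsym)"
    "length u = length v" "w = pack u v" by auto
  then have "refines {1..n} (word_partition w) (word_partition u)"
    using word_partition_pack_refines(1)[of u n v] keys_saliola(1)[OF assms(2) uv(1)]
    by (simp add: packed_words_def)
  then have "refines {1..n} (word_partition w) Y"
    using keys_saliola(2)[OF assms(2) uv(1)] refines_trans by blast
  then show "\<not> refines {1..n} X (word_partition w)"
    using assms(4) refines_trans by blast
qed (rule assms(1))

lemma saliola_star_eq_0:
  assumes "X \<in> set_partitions n" "Y \<in> set_partitions n" "\<not> refines {1..n} X Y"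
  shows "saliola n Y \<star> saliola n X = (0 :: 'k::field wqsym)"
proof -
  have "saliola n Y \<star> NN (replicate n 1) \<star> saliola n X = (0 :: 'k wqsym)"
    using assms by (intro saliola_peirce_eq_0 NN_in_WQ replicate_1_in_packed_words)
  then show ?thesis by (simp only: star_one_right[OF saliola_in_WQ[OF assms(2)]])
qed

text \<open>Unless \<open>Y\<close> refines \<open>X\<close> triangularity applies. If
  \<open>Y\<close> is strictly finer, then in the recursion for \<open>X\<close> the leading term
  and the single surviving correction cancel.\<close>

lemma saliola_orthogonal:
  assumes "X \<in> set_partitions n" "Y \<in> set_partitions n"
  shows "saliola n X \<star> saliola n Y = (if X = Y then saliola n X else (0 :: 'k::field wqsym))"
  using assms
proof (induction n X rule: saliola.induct)
  case (1 n X)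
  let ?x = "NN (partition_word n X) :: 'k wqsym"
  have IH: "saliola n Z \<star> saliola n Y = (if Z = Y then saliola n Z else (0 :: 'k wqsym))"
    if "Z \<in> strictly_finer n X" for Z
    using "1.IH"[OF that strictly_finer_in_set_partitions[OF that] "1.prems"(2)] .
  have "saliola n X \<star> saliola n Y = ?x \<star> saliola n Y -
      (\<Sum>Z\<in>strictly_finer n X. ?x \<star> (saliola n Z \<star> saliola n Y))"
    by (subst saliola.simps[of n X]) (simp only: star_diff_left star_sum_left star_assoc)
  also have "(\<Sum>Z\<in>strictly_finer n X. ?x \<star> (saliola n Z \<star> saliola n Y)) =
      (\<Sum>Z\<in>strictly_finer n X. if Z = Y then ?x \<star> saliola n Y else 0)"
    using IH by (intro sum.cong) auto
  also have "\<dots> = (if Y \<in> strictly_finer n X then ?x \<star> saliola n Y else 0)"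
    by (simp add: eq_commute[of _ Y])
  finally have *: "saliola n X \<star> saliola n Y =
      ?x \<star> saliola n Y - (if Y \<in> strictly_finer n X then ?x \<star> saliola n Y else 0)" .
  show ?case
  proof (cases "refines {1..n} Y X")
    case True
    then show ?thesis
      using * partition_word_star_saliola[OF "1.prems"(1), where 'a='k] by (auto simp: strictly_finer_def)
  next
    case False
    then show ?thesis using saliola_star_eq_0[OF "1.prems"(2,1) False] refines_refl'[OF "1.prems"(1)] by auto
  qed
qed

text \<open>The diagonal corners are one-dimensional: on \<open>NN x \<star> saliola n X\<close>
  with \<open>x\<close> of support \<open>X\<close>, the idempotent acts like the chosen word, which
  turns \<open>x\<close> into itself. What remains of \<open>F\<close> is the sum of its
  coordinates, the value of the character.\<close>

lemma saliola_peirce_diagonal: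
  assumes X: "X \<in> set_partitions n" and F: "F \<in> WQ n"
  shows "saliola n X \<star> F \<star> saliola n X = wscale (chi X F) (saliola n X :: 'k::field wqsym)"
proof -
  let ?e = "saliola n X :: 'k wqsym" and ?x = "NN (partition_word n X) :: 'k wqsym"
  let ?c = "\<lambda>x. Poly_Mapping.lookup (F \<star> ?e) x"
  have e: "?e \<in> WQ n" using X by (rule saliola_in_WQ)
  have diag: "?e \<star> (NN x \<star> ?e) = ?e" if x: "x \<in> words_of_partition n X" for x
  proof -
    have "saliola n Y \<star> (NN x \<star> ?e) = 0" if Y: "Y \<in> strictly_finer n X" for Y
    proof -
      have "\<not> refines {1..n} X Y" using Y refines_asym by (auto simp: strictly_finer_def)
      then show ?thesis
        using saliola_peirce_eq_0[OF X strictly_finer_in_set_partitions[OF Y] NN_in_WQ, of x]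
          words_of_partition_packed[OF x] by (simp add: star_assoc)
    qed
    then have "?e \<star> (NN x \<star> ?e) = ?x \<star> (NN x \<star> ?e)"
      by (subst saliola.simps[of n X]) (simp add: star_diff_left star_sum_left star_assoc)
    also have "\<dots> = ?e"
      by (simp only: star_assoc[symmetric] NN_star_same_partition[OF partition_word_in_words[OF X] x]
          partition_word_star_saliola[OF X])
    finally show ?thesis .
  qed
  have chi_x: "chi X (NN x \<star> ?e) = 1" if "x \<in> words_of_partition n X" for x
  proof -
    have "chi X (NN x :: 'k wqsym) = 1"
      using that refines_refl'[OF X] length_words_of_partition[OF that]
      by (simp add: chi_NN words_of_partition_def)
    then show ?thesis
      using chi_star[OF X NN_in_WQ[OF words_of_partition_packed[OF that]] e] chi_saliola[OF X X, where 'k='k]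
      by simp
  qed
  have "chi X (F \<star> ?e) = (\<Sum>x\<in>words_of_partition n X. ?c x * chi X (NN x \<star> ?e))"
    by (subst star_saliola_expand[OF F X]) (simp only: chi_sum chi_scale)
  then have chi: "chi X F = (\<Sum>x\<in>words_of_partition n X. ?c x)"
    using chi_star[OF X F e] chi_saliola[OF X X, where 'k='k] by (simp add: chi_x)
  have "?e \<star> (F \<star> ?e) = (\<Sum>x\<in>words_of_partition n X. wscale (?c x) (?e \<star> (NN x \<star> ?e)))"
    by (subst star_saliola_expand[OF F X]) (simp only: star_sum_right star_scale_right)
  also have "\<dots> = wscale (chi X F) ?e"
    unfolding chi wq.scale_sum_left by (intro sum.cong refl) (simp add: diag)
  finally show ?thesis by (simp add: star_assoc)
qed

lemma refines_top:
  assumes Y: "Y \<in> set_partitions n"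
  shows "refines {1..n} Y (word_partition (replicate n 1))"
proof -
  have "i - 1 < n" if "A \<in> Y" "i \<in> A" for A i
  proof -
    have "i \<in> {1..n}" using that Y by (auto simp: set_partitions_def partition_on_def)
    then show ?thesis by auto
  qed
  then show ?thesis
    by (subst refines_word_partition_iff[OF Y]) auto
qed

text \<open>The unit has the coarsest support, so the expansion of a word into left multiples of the
  idempotents runs over all partitions.\<close>

lemma sum_saliola:
  shows "(\<Sum>X\<in>set_partitions n. saliola n X) = (NN (replicate n 1) :: 'k::field wqsym)"
proof -
  let ?top = "word_partition (replicate n 1)"
  have top: "?top \<in> set_partitions n" by (rule word_partition_in_set_partitions) simp
  have "replicate n 1 \<in> words_of_partition n ?top"
    by (simp add: words_of_partition_def replicate_1_in_packed_words)
  from NN_eq_sum_saliola[OF this top]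
  have "NN (replicate n 1) = (\<Sum>Y | refines {1..n} Y ?top. NN (replicate n 1) \<star> (saliola n Y :: 'k wqsym))" .
  also have "{Y. refines {1..n} Y ?top} = set_partitions n"
    using refines_top refines_in_set_partitions by blast
  also have "(\<Sum>Y\<in>set_partitions n. NN (replicate n 1) \<star> (saliola n Y :: 'k wqsym)) = (\<Sum>Y\<in>set_partitions n. saliola n Y)"
    by (intro sum.cong refl star_one_left saliola_in_WQ)
  finally show ?thesis ..
qed

section \<open>The radical filtration of the algebra of packed words\<close>

lemma card_word_partition: "card (word_partition u) = card (set u)"
  unfolding word_partition_def
proof (rule card_image, rule inj_onI)
  fix j k assume j: "j \<in> set u" and eq: "{i \<in> {1..length u}. u ! (i - 1) = j} = {i \<in> {1..length u}. u ! (i - 1) = k}"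
  from j obtain i where "i < length u" "u ! i = j" by (auto simp: in_set_conv_nth)
  then have "Suc i \<in> {i \<in> {1..length u}. u ! (i - 1) = j}" by auto
  then have "Suc i \<in> {i \<in> {1..length u}. u ! (i - 1) = k}" by (simp only: eq)
  then have "u ! i = k" by simp
  then show "j = k" using \<open>u ! i = j\<close> by simp
qed

text \<open>
  The word \<open>y\<close> is obtained by merging the letters \<open>k\<close> and \<open>k + 1\<close>.
\<close>

lemma exchange_letters:
  assumes x: "x \<in> words_of_partition n \<alpha>" and k: "k \<in> set x" "Suc k \<in> set x"
  defines "x' \<equiv> map (Transposition.transpose k (Suc k)) x"
  obtains y where "x' \<in> words_of_partition n \<alpha>" "y \<in> packed_words n" "pack y x = x" "pack y x' = x'"
    "card \<alpha> \<le> Suc (card (word_partition y))"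
proof -
  obtain m where m: "set x = {1..m}" and len: "length x = n" and \<alpha>: "word_partition x = \<alpha>"
    using x by (auto simp: words_of_partition_def packed_words_def packed_iff)
  have px: "x \<in> packed_words n" using x by (rule words_of_partition_packed)
  \<comment> \<open>\<open>h\<close> identifies \<open>k + 1\<close> with \<open>k\<close> and
    closes the gap above.\<close>
  define h where "h l = (if l \<le> k then l else l - 1)" for l
  define y where "y = map h x"
  have ly: "length y = n" and lx': "length x' = n" using len by (auto simp: y_def x'_def)
  have "set x' = Transposition.transpose k (Suc k) ` {1..m}" by (simp add: x'_def m)
  also have "\<dots> = {1..m}" using k m by (intro transpose_image_eq) auto
  finally have px': "x' \<in> packed_words n" using lx' by (auto simp: packed_words_def packed_iff)
  have "word_partition x' = word_partition x"
    by (subst word_partition_eq_iff[OF lx' len]) (auto simp: x'_def len inj_eq)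
  then have x'\<alpha>: "x' \<in> words_of_partition n \<alpha>" using px' \<alpha> by (simp add: words_of_partition_def)
  have ht: "h (Transposition.transpose k (Suc k) l) = h l" for l
    by (auto simp: h_def transpose_def)
  have "mono h" by (intro monoI) (auto simp: h_def)
  \<comment> \<open>\<open>pack y y\<close> orders the positions as \<open>y\<close> does and is
    packed by construction.\<close>
  have p: "pack y y \<in> packed_words n" using ly by (simp add: pack_in_packed_words)
  have yy: "pack y y ! i \<le> pack y y ! j \<longleftrightarrow> h (x ! i) \<le> h (x ! j)" if "i < n" "j < n" for i j
    using that ly len by (auto simp: pack_le_iff y_def)
  have "pack (pack y y) x = x"
    by (subst pack_absorb_left_iff[OF p px]) (auto simp: yy intro: monoD[OF \<open>mono h\<close>])
  moreover have "pack (pack y y) x' = x'"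
  proof (subst pack_absorb_left_iff[OF p px'], intro allI impI)
    fix i j assume ij: "i < n" "j < n" "x' ! i \<le> x' ! j"
    then have "h (x' ! i) \<le> h (x' ! j)" by (intro monoD[OF \<open>mono h\<close>])
    then show "pack y y ! i \<le> pack y y ! j" using ij len by (simp add: yy x'_def ht)
  qed
  moreover have "card \<alpha> \<le> Suc (card (word_partition (pack y y)))"
  proof -
    have "word_partition (pack y y) = word_partition y"
      using ly by (subst word_partition_eq_iff[of _ n]) (auto simp: pack_eq_iff)
    moreover have "set x \<subseteq> insert (Suc k) (set x - {Suc k})" by auto
    \<comment> \<open>Only \<open>k\<close> and \<open>k + 1\<close> are identified, so merging
      costs one letter and hence one block.\<close>
    moreover have "inj_on h (set x - {Suc k})" by (auto simp: inj_on_def h_def)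
    then have "card (set x - {Suc k}) \<le> card (set y)"
      unfolding y_def by (subst card_image[symmetric]) (auto intro: card_mono)
    moreover have "card (set x) = Suc (card (set x - {Suc k}))"
      using k by (simp only: card_Suc_Diff1 finite_set)
    ultimately show ?thesis
      using card_word_partition[of x] card_word_partition[of y] \<alpha> by simp
  qed
  ultimately show thesis using that x'\<alpha> p by blast
qed

text \<open>Bubble sort towards \<open>x0\<close>: an exchange of two consecutive letters lowers the
  number of inversions relative to \<open>x0\<close>, and without inversions the two words
  agree.\<close>

lemma words_of_partition_exchange_induct [consumes 2, case_names base exchange]:
  assumes x0: "x0 \<in> words_of_partition n \<alpha>" and x: "x \<in> words_of_partition n \<alpha>"
    and base: "Q x0"
    and step: "\<And>x k. x \<in> words_of_partition n \<alpha> \<Longrightarrow> k \<in> set x \<Longrightarrow> Suc k \<in> set x \<Longrightarrow>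
      Q (map (Transposition.transpose k (Suc k)) x) \<Longrightarrow> Q x"
  shows "Q x"
proof -
  define Inv :: "nat list \<Rightarrow> (nat \<times> nat) set" where "Inv x = {(p, q). p < n \<and> q < n \<and> x ! p < x ! q \<and> x0 ! q < x0 ! p}" for x
  have finI: "finite (Inv x)" for x
    by (rule finite_subset[of _ "{..<n} \<times> {..<n}"]) (auto simp: Inv_def)
  have x0': "length x0 = n" "x0 \<in> packed_words n" "word_partition x0 = \<alpha>"
    using x0 by (auto simp: words_of_partition_def packed_words_def)
  show ?thesis using x
  proof (induction "card (Inv x)" arbitrary: x rule: less_induct)
    case less
    have x': "length x = n" "x \<in> packed_words n" "word_partition x = \<alpha>"
      using less.prems by (auto simp: words_of_partition_def packed_words_def)
    have eq: "x ! p = x ! q \<longleftrightarrow> x0 ! p = x0 ! q" if "p < n" "q < n" for p q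
      using that x' x0' word_partition_eq_iff[of x n x0] by metis
    show ?case
    proof (cases "Inv x = {}")
      case True
      then have inv: "x0 ! p \<le> x0 ! q" if "p < n" "q < n" "x ! p < x ! q" for p q
        using that by (force simp: Inv_def)
      have "x = x0"
      proof (rule packed_words_eqI[OF x'(2) x0'(2)])
        fix p q assume pq: "p < n" "q < n"
        show "x ! p \<le> x ! q \<longleftrightarrow> x0 ! p \<le> x0 ! q"
          using inv[OF pq] inv[OF pq(2,1)] eq[OF pq] by linarith
      qed
      then show ?thesis using base by simp
    next
      case False
      \<comment> \<open>An inversion of minimal letter difference involves consecutive letters.
        Otherwise the letter \<open>k + 1\<close> occurs at some \<open>r\<close>, the word being
        packed, and one of the pairs (p, r) and (r, q) is an inversion of smaller
        difference.\<close>
      obtain p q where pq: "(p, q) \<in> Inv x"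
        and min: "\<And>p' q'. (p', q') \<in> Inv x \<Longrightarrow> x ! q - x ! p \<le> x ! q' - x ! p'"
        using False ex_has_least_nat[of "\<lambda>r. r \<in> Inv x" _ "\<lambda>(p, q). x ! q - x ! p"] by fast
      have pq': "p < n" "q < n" "x ! p < x ! q" "x0 ! q < x0 ! p" using pq by (auto simp: Inv_def)
      obtain m where m: "set x = {1..m}" using x'(2) by (auto simp: packed_words_def packed_iff)
      define k where "k = x ! p"
      have "x ! q = Suc k"
      proof (rule ccontr)
        assume "x ! q \<noteq> Suc k"
        then have gt: "Suc k < x ! q" using pq' by (simp add: k_def)
        have "x ! p \<in> {1..m}" "x ! q \<in> {1..m}" using pq' x' m nth_mem by metis+
        then have "Suc k \<in> set x" using gt m by (auto simp: k_def)
        then obtain r where r: "r < n" "x ! r = Suc k" using x' by (auto simp: in_set_conv_nth)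
        show False
        proof (cases "x0 ! r < x0 ! p")
          case True
          then have "(p, r) \<in> Inv x" using r pq' by (simp add: Inv_def k_def)
          from min[OF this] show False using r gt by (simp add: k_def)
        next
          case False
          then have "(r, q) \<in> Inv x" using r pq' gt by (simp add: Inv_def)
          from min[OF this] show False using r gt by (simp add: k_def)
        qed
      qed
      then have k: "k \<in> set x" "Suc k \<in> set x" using pq' x' nth_mem k_def by metis+
      define x1 where "x1 = map (Transposition.transpose k (Suc k)) x"
      have x1: "x1 ! r = Transposition.transpose k (Suc k) (x ! r)" if "r < n" for r
        using that x' by (simp add: x1_def)
      have "x1 \<in> words_of_partition n \<alpha>"
        using exchange_letters[OF less.prems k] unfolding x1_def by blast
      \<comment> \<open>The exchange reverses only pairs carrying \<open>k\<close> and
        \<open>k + 1\<close>. Both words having the same support, \<open>x0\<close> compares all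
        such pairs as it compares p and q, so no inversion is created.\<close>
      moreover have "Inv x1 \<subset> Inv x"
      proof
        show "Inv x1 \<subseteq> Inv x"
        proof (clarify)
          fix a b assume ab: "(a, b) \<in> Inv x1"
          then have ab': "a < n" "b < n" "x1 ! a < x1 ! b" "x0 ! b < x0 ! a" by (auto simp: Inv_def)
          have "x ! a < x ! b"
          proof (rule ccontr)
            assume "\<not> x ! a < x ! b"
            with ab' have "x ! a = Suc k" "x ! b = k"
              by (auto simp: x1 transpose_def split: if_splits)
            then have "x0 ! a = x0 ! q" "x0 ! b = x0 ! p"
              using eq[of a q] eq[of b p] ab' pq' \<open>x ! q = Suc k\<close> k_def by auto
            then show False using ab' pq' by simp
          qed
          then show "(a, b) \<in> Inv x" using ab' by (simp add: Inv_def)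
        qed
        have "(p, q) \<notin> Inv x1" using pq' \<open>x ! q = Suc k\<close> by (auto simp: Inv_def x1 k_def)
        then show "Inv x1 \<noteq> Inv x" using pq by blast
      qed
      then have "card (Inv x1) < card (Inv x)" using finI by (rule psubset_card_mono[rotated])
      ultimately have "Q x1" using less.hyps by blast
      then show ?thesis using step[OF less.prems k] by (simp add: x1_def)
    qed
  qed
qed

section \<open>Peirce decomposition with respect to Saliola's idempotents\<close>

locale wq_level =
  fixes n :: nat and scalars :: "'k::field itself"
  assumes n_pos: "1 \<le> n"
begin

abbreviation finer :: "nat set set \<Rightarrow> nat set set \<Rightarrow> bool" where
  "finer \<equiv> refines {1..n}"

abbreviation partitions :: "nat set set set" where
  "partitions \<equiv> set_partitions n"

abbreviation W :: "'k wqsym set" where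
  "W \<equiv> WQ n"

abbreviation W_one :: "'k wqsym" where
  "W_one \<equiv> NN (replicate n 1)"

abbreviation e :: "nat set set \<Rightarrow> 'k wqsym" where
  "e \<equiv> saliola n"

lemma e_in_W: "X \<in> partitions \<Longrightarrow> e X \<in> W"
  by (rule saliola_in_WQ)

end

sublocale wq_level \<subseteq> pointed_algebra W W_one partitions
proof unfold_locales
  show "wq.subspace W" by (rule subspace_WQ)
  fix \<pi> assume \<pi>: "\<pi> \<in> partitions"
  show "chi \<pi> W_one = 1"
    using refines_top[OF \<pi>] by (simp add: chi_NN)
  fix x y :: "'k wqsym" assume "x \<in> W" "y \<in> W"
  then show "chi \<pi> (x \<star> y) = chi \<pi> x * chi \<pi> y" by (rule chi_star[OF \<pi>])
qed (auto intro: star_in_WQ NN_in_WQ replicate_1_in_packed_words star_one_left star_one_right)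

context wq_level begin

lemma sum_e: "(\<Sum>X\<in>partitions. e X) = W_one"
  by (rule sum_saliola)

lemma peirce_decomposition:
  assumes "x \<in> W"
  shows "x = (\<Sum>X\<in>partitions. \<Sum>Y\<in>partitions. e X \<star> x \<star> e Y)"
proof -
  have "x = W_one \<star> x \<star> W_one" using assms one_left one_right by simp
  then show ?thesis
    unfolding sum_e[symmetric] star_sum_left star_sum_right by (subst sum.swap)
qed

text \<open>A factor \<open>y\<close> from \<open>N\<close> forces a strict coarsening:
  \<open>e Z \<star> y \<star> e X\<close> vanishes by triangularity unless \<open>X\<close> refines
  \<open>Z\<close>, and for \<open>Z = X\<close> because it is a multiple of \<open>chi X y\<close>.
  Each factor thus costs at least one block.\<close>

lemma peirce_ideal_power_eq_0:
  assumes "x \<in> ideal_power W N k" "X \<in> partitions" "Y \<in> partitions"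
    and "\<not> (finer X Y \<and> card Y + k \<le> card X)"
  shows "e Y \<star> x \<star> e X = 0"
  using assms
proof (induction k arbitrary: x X Y)
  case 0
  show ?case
  proof (cases "finer X Y")
    case True
    then show ?thesis using 0 refines_card(1)[OF True] by simp
  next
    case False
    then show ?thesis using 0 saliola_peirce_eq_0 by simp
  qed
next
  case (Suc k)
  from Suc.prems(1) show ?case
  proof (induction rule: ideal_power_Suc_induct)
    case (star x y)
    have yW: "y \<in> W" using star N_closed by blast
    have zero: "(e Y \<star> x \<star> e Z) \<star> (e Z \<star> y \<star> e X) = 0" if Z: "Z \<in> partitions" for Z
    proof (cases "finer X Z \<and> X \<noteq> Z")
      case True
      then have "card Z \<le> card X" "card Z \<noteq> card X"
        using refines_card[of "{1..n}" X Z] by blast+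
      then have "\<not> (finer Z Y \<and> card Y + k \<le> card Z)"
        using Suc.prems(4) True refines_trans[of "{1..n}" X Z Y] by linarith
      then show ?thesis using Suc.IH[OF star(1) Z Suc.prems(3)] by simp
    next
      case False
      have "e Z \<star> y \<star> e X = 0"
      proof (cases "X = Z")
        case True
        have "chi X y = 0" using star(2) Suc.prems(2) by (simp add: N_def)
        then show ?thesis using True saliola_peirce_diagonal[OF Suc.prems(2) yW] by simp
      next
        case neq: False
        then show ?thesis using False saliola_peirce_eq_0[OF Suc.prems(2) Z yW] by simp
      qed
      then show ?thesis by simp
    qed
    have "e Y \<star> (x \<star> y) \<star> e X = e Y \<star> x \<star> W_one \<star> y \<star> e X"
      using one_left[OF yW] by (simp add: star_assoc)
    also have "\<dots> = (\<Sum>Z\<in>partitions. e Y \<star> x \<star> (e Z \<star> e Z) \<star> y \<star> e X)"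
      unfolding sum_e[symmetric] star_sum_left star_sum_right
      by (intro sum.cong refl) (simp add: saliola_orthogonal)
    also have "\<dots> = 0" using zero by (intro sum.neutral) (simp add: star_assoc)
    finally show ?case .
  qed (simp_all add: star_add_left star_add_right star_scale_left star_scale_right)
qed

lemma card_partition_pos: "X \<in> partitions \<Longrightarrow> 1 \<le> card X"
  using n_pos finite_set_partition[of X n]
  by (auto simp: set_partitions_def partition_on_def Suc_le_eq card_gt_0_iff One_nat_def)

text \<open>Block numbers lie between 1 and \<open>n\<close>, so \<open>n\<close> strict coarsenings
  are impossible.\<close>

lemma ideal_power_n: "ideal_power W N n = {0}"
proof
  show "ideal_power W N n \<subseteq> {0}"
  proof
    fix x assume x: "x \<in> ideal_power W N n"
    have "e X \<star> x \<star> e Y = 0" if "X \<in> partitions" "Y \<in> partitions" for X Y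
      using that card_partition_pos[of X] card_set_partition_le[of Y n]
      by (intro peirce_ideal_power_eq_0[OF x]) auto
    then have "(\<Sum>X\<in>partitions. \<Sum>Y\<in>partitions. e X \<star> x \<star> e Y) = 0" by (simp cong: sum.cong)
    then show "x \<in> {0}" using peirce_decomposition[OF ideal_power_closed[OF x]] by simp
  qed
  show "{0} \<subseteq> ideal_power W N n" using wq.subspace_0[OF subspace_ideal_power] by simp
qed

end

text \<open>The powers of an element of \<open>N\<close> lie in the corresponding powers of the
  ideal, of which the one with exponent \<open>n\<close> is zero.\<close>

sublocale wq_level \<subseteq> basic_algebra W W_one partitions
proof unfold_locales
  fix x assume x: "x \<in> N"
  have "(((\<star>) x) ^^ k) W_one \<in> ideal_power W N k" for k
  proof (induction k)
    case (Suc k)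
    have "x \<star> (((\<star>) x) ^^ k) W_one \<in> ideal_power W N (1 + k)"
      using x Suc by (intro ideal_power_add) (simp_all only: ideal_power_1)
    then show ?case by (simp only: plus_1_eq_Suc funpow.simps comp_apply)
  qed (simp add: one_closed)
  then show "\<exists>k. (((\<star>) x) ^^ k) W_one = 0" using ideal_power_n by blast
qed

context wq_level begin

lemma labelled_e: "labelled_idempotents W partitions e"
  unfolding labelled_idempotents_iff idempotent_in_def
  using e_in_W chi_saliola saliola_orthogonal by (metis (full_types))

text \<open>Differences of words suffice because the coordinates of \<open>r \<star> e X\<close> add
  up to \<open>chi X (r \<star> e X)\<close>, which is 0 for \<open>r\<close> in \<open>N\<close>; a
  chosen word can then be subtracted from every term.\<close>

lemma peirce_N_in_square:
  assumes r: "r \<in> N" and X: "X \<in> partitions" and Y: "Y \<in> partitions" and gap: "card Y + 2 \<le> card X"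
  shows "e Y \<star> r \<star> e X \<in> ideal_power W N 2"
proof -
  let ?I = "ideal_power W N 2"
  have sub: "wq.subspace ?I" by (rule subspace_ideal_power)
  let ?x0 = "partition_word n X"
  have x0: "?x0 \<in> words_of_partition n X" by (rule partition_word_in_words[OF X])
  have chi_x: "chi \<sigma> (NN x :: 'k wqsym) = (if finer \<sigma> X then 1 else 0)" if "x \<in> words_of_partition n X" for x \<sigma>
    using that length_words_of_partition[OF that] by (simp add: chi_NN words_of_partition_def)
  have diff: "e Y \<star> (NN x - NN ?x0) \<star> e X \<in> ?I" if "x \<in> words_of_partition n X" for x
    using x0 that
  proof (induction rule: words_of_partition_exchange_induct)
    case base
    then show ?case using wq.subspace_0[OF sub] by simp
  next
    case (exchange x k)
    let ?x' = "map (Transposition.transpose k (Suc k)) x"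
    obtain y where y: "?x' \<in> words_of_partition n X" "y \<in> packed_words n" "pack y x = x" "pack y ?x' = ?x'"
      "card X \<le> Suc (card (word_partition y))"
      using exchange_letters[OF exchange(1-3)] .
    define D where "D = NN x - (NN ?x' :: 'k wqsym)"
    have DW: "D \<in> W" unfolding D_def
      using exchange y by (intro wq.subspace_diff subspace_WQ NN_in_WQ words_of_partition_packed)
    have "D \<star> e X \<in> N"
    proof (rule N_right[OF N_I[OF DW]])
      show "chi \<sigma> D = 0" for \<sigma>
        unfolding D_def chi_diff using chi_x[OF exchange(1)] chi_x[OF y(1)] by simp
    qed (rule e_in_W[OF X])
    moreover have "e Y \<star> NN y \<in> N"
    proof (rule N_I)
      show "e Y \<star> NN y \<in> W" using y Y by (intro star_in_WQ e_in_W NN_in_WQ)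
      fix \<sigma> assume \<sigma>: "\<sigma> \<in> partitions"
      \<comment> \<open>The support of \<open>y\<close> has at least \<open>card X - 1\<close>
        blocks, more than \<open>Y\<close> has; a partition refined by \<open>Y\<close> has no more
        blocks than \<open>Y\<close>.\<close>
      have "\<not> finer Y (word_partition y)"
        using refines_card(1)[of "{1..n}" Y "word_partition y"] gap y(5) by auto
      moreover have "length y = n" using y by (simp add: packed_words_def)
      ultimately show "chi \<sigma> (e Y \<star> NN y) = 0"
        using chi_star[OF \<sigma> e_in_W[OF Y] NN_in_WQ[OF y(2)]] chi_saliola[OF Y \<sigma>, where 'k='k]
        by (auto simp: chi_NN)
    qed
    ultimately have "(e Y \<star> NN y) \<star> (D \<star> e X) \<in> ideal_power W N (1 + 1)"
      by (intro ideal_power_add) (simp_all only: ideal_power_1)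
    moreover have "NN y \<star> D = D"
      using exchange(1) y by (simp add: D_def star_diff_right star_NN_packed words_of_partition_packed)
    then have "(e Y \<star> NN y) \<star> (D \<star> e X) = e Y \<star> D \<star> e X"
      by (simp only: star_assoc star_assoc[symmetric, of "NN y" D])
    ultimately have "e Y \<star> D \<star> e X \<in> ?I" by (simp only: one_add_one)
    \<comment> \<open>The difference to the chosen word telescopes along the chain of
      exchanges.\<close>
    then have "e Y \<star> D \<star> e X + e Y \<star> (NN ?x' - NN ?x0) \<star> e X \<in> ?I"
      using exchange(4) by (intro wq.subspace_add[OF sub])
    then show ?case
      by (simp add: D_def star_diff_left star_diff_right)
  qed
  let ?c = "\<lambda>x. Poly_Mapping.lookup (r \<star> e X) x"
  have rW: "r \<in> W" using r N_closed by blast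
  have rX: "r \<star> e X = (\<Sum>x\<in>words_of_partition n X. wscale (?c x) (NN x \<star> e X))"
    by (rule star_saliola_expand[OF rW X])
  have chi_xe: "chi X (NN x \<star> e X) = 1" if "x \<in> words_of_partition n X" for x
    using chi_star[OF X NN_in_WQ[OF words_of_partition_packed[OF that]] e_in_W[OF X]]
      chi_x[OF that] chi_saliola[OF X X, where 'k='k] refines_refl'[OF X] by simp
  have "chi X (r \<star> e X) = 0" using N_right[OF r e_in_W[OF X]] X by (simp add: N_def)
  moreover have "chi X (r \<star> e X) = (\<Sum>x\<in>words_of_partition n X. ?c x)"
    by (subst rX) (simp only: chi_sum chi_scale, simp add: chi_xe)
  ultimately have sum0: "(\<Sum>x\<in>words_of_partition n X. ?c x) = 0" by simp
  have "e Y \<star> (r \<star> e X) = (\<Sum>x\<in>words_of_partition n X. wscale (?c x) (e Y \<star> (NN x \<star> e X)))"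
    by (subst rX) (simp only: star_sum_right star_scale_right)
  \<comment> \<open>The subtracted term is zero, since its coefficient is the sum of the
    coordinates.\<close>
  also have "\<dots> = (\<Sum>x\<in>words_of_partition n X. wscale (?c x) (e Y \<star> (NN x \<star> e X))) -
      wscale (\<Sum>x\<in>words_of_partition n X. ?c x) (e Y \<star> (NN ?x0 \<star> e X))"
    by (simp add: sum0)
  also have "\<dots> = (\<Sum>x\<in>words_of_partition n X. wscale (?c x) (e Y \<star> (NN x - NN ?x0) \<star> e X))"
    unfolding wq.scale_sum_left sum_subtractf[symmetric]
    by (simp add: star_diff_left star_diff_right wq.scale_right_diff_distrib star_assoc)
  also have "\<dots> \<in> ?I"
    by (intro wq.subspace_sum[OF sub] wq.subspace_scale[OF sub] diff)
  finally show ?thesis by (simp add: star_assoc)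
qed

text \<open>Induction on the difference of block numbers. Beyond 1 the element is in the square of
  \<open>N\<close>; inserting the unit as the sum of the idempotents between the two factors leaves
  pieces with smaller differences, to which the hypothesis applies.\<close>

lemma peirce_in_ideal_power:
  assumes "x \<in> W" "X \<in> partitions" "Y \<in> partitions"
  shows "e Y \<star> x \<star> e X \<in> ideal_power W N (card X - card Y)"
  using assms
proof (induction "card X - card Y" arbitrary: x X Y rule: less_induct)
  case less
  note X = less.prems(2) and Y = less.prems(3)
  let ?d = "card X - card Y"
  have sub: "wq.subspace (ideal_power W N k)" for k by (rule subspace_ideal_power)
  have inW: "e Y \<star> x \<star> e X \<in> W" using less.prems by (intro star_in_WQ e_in_W)
  have inN: "e Y \<star> x \<star> e X \<in> N" if "X \<noteq> Y"
  proof (rule N_I[OF inW])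
    fix \<sigma> assume \<sigma>: "\<sigma> \<in> partitions"
    have "chi \<sigma> (e Y \<star> x \<star> e X) = chi \<sigma> (e Y \<star> x) * chi \<sigma> (e X)"
      using less.prems by (intro chi_star[OF \<sigma>] star_in_WQ e_in_W)
    also have "chi \<sigma> (e Y \<star> x) = chi \<sigma> (e Y) * chi \<sigma> x"
      using less.prems by (intro chi_star[OF \<sigma>] e_in_W)
    finally show "chi \<sigma> (e Y \<star> x \<star> e X) = 0"
      using that chi_saliola[OF X \<sigma>, where 'k='k] chi_saliola[OF Y \<sigma>, where 'k='k] by auto
  qed
  consider "?d = 0" | "?d = 1" | "?d \<ge> 2" by linarith
  then show ?case
  proof cases
    case 1
    then show ?thesis using inW by simp
  next
    case 2
    then have "X \<noteq> Y" by auto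
    then show ?thesis unfolding 2 ideal_power_1 by (rule inN)
  next
    case 3
    then have "X \<noteq> Y" "card Y + 2 \<le> card X" by auto
    have idem: "e Y \<star> e Y = e Y" "e X \<star> e X = e X" by (simp_all add: saliola_orthogonal X Y)
    have sq: "e Y \<star> (e Y \<star> x \<star> e X) \<star> e X \<in> ideal_power W N (Suc (Suc 0))"
      using peirce_N_in_square[OF inN[OF \<open>X \<noteq> Y\<close>] X Y \<open>card Y + 2 \<le> card X\<close>]
      by (simp only: numeral_2_eq_2)
    have "e Y \<star> z \<star> e X \<in> ideal_power W N ?d" if "z \<in> ideal_power W N (Suc (Suc 0))" for z
      using that
    proof (induction rule: ideal_power_Suc_induct)
      case (star r s)
      have rN: "r \<in> N" using star(1) ideal_power_1 by (simp only: One_nat_def)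
      have rW: "r \<in> W" "s \<in> W" using rN star(2) N_closed by auto
      have summand: "(e Y \<star> r \<star> e Z) \<star> (e Z \<star> s \<star> e X) \<in> ideal_power W N ?d" if Z: "Z \<in> partitions" for Z
      \<comment> \<open>For \<open>Z\<close> strictly in between, the two differences add up to
        \<open>?d\<close> and so do the exponents. Otherwise one factor would stay in
        \<open>N\<close> without losing a block, and it is zero.\<close>
      proof (cases "card Y + 1 \<le> card Z \<and> card Z + 1 \<le> card X")
        case True
        then have "e Y \<star> r \<star> e Z \<in> ideal_power W N (card Z - card Y)"
            "e Z \<star> s \<star> e X \<in> ideal_power W N (card X - card Z)"
          using Z X Y rW by (auto intro!: less.hyps)
        from ideal_power_add[OF this] True show ?thesis by simp
      next
        case False
        then have "e Y \<star> r \<star> e Z = 0 \<or> e Z \<star> s \<star> e X = 0"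
          using peirce_ideal_power_eq_0[of r 1 Z Y] peirce_ideal_power_eq_0[of s 1 X Z] rN star(2) X Y Z
          by (auto simp: ideal_power_1)
        then show ?thesis using wq.subspace_0[OF sub] by auto
      qed
      have "e Y \<star> (r \<star> s) \<star> e X = e Y \<star> r \<star> W_one \<star> s \<star> e X"
        using one_left[OF rW(2)] by (simp add: star_assoc)
      also have "\<dots> = (\<Sum>Z\<in>partitions. e Y \<star> r \<star> (e Z \<star> e Z) \<star> s \<star> e X)"
        unfolding sum_e[symmetric] star_sum_left star_sum_right
        by (intro sum.cong refl) (simp add: saliola_orthogonal)
      also have "\<dots> = (\<Sum>Z\<in>partitions. (e Y \<star> r \<star> e Z) \<star> (e Z \<star> s \<star> e X))"
        by (simp add: star_assoc)
      also have "\<dots> \<in> ideal_power W N ?d" by (intro wq.subspace_sum[OF sub] summand)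
      finally show ?case .
    next
      case zero
      then show ?case using wq.subspace_0[OF sub] by simp
    qed (simp_all add: star_add_left star_add_right star_scale_left star_scale_right
        wq.subspace_add[OF sub] wq.subspace_scale[OF sub])
    from this[OF sq] have "e Y \<star> (e Y \<star> (e Y \<star> x \<star> e X) \<star> e X) \<star> e X \<in> ideal_power W N ?d" .
    also have "e Y \<star> (e Y \<star> (e Y \<star> x \<star> e X) \<star> e X) \<star> e X = (e Y \<star> e Y) \<star> (e Y \<star> x \<star> e X) \<star> (e X \<star> e X)"
      by (simp only: star_assoc)
    also have "\<dots> = (e Y \<star> e Y) \<star> x \<star> (e X \<star> e X)"
      unfolding idem by (simp only: star_assoc idem) (simp only: star_assoc[symmetric] idem)
    finally show ?thesis unfolding idem .
  qed
qed

end

section \<open>Counting sorted enumerations by set partitions\<close>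

definition partitions_within :: "('a \<Rightarrow> nat) \<Rightarrow> 'a set \<Rightarrow> 'a set set set" where
  "partitions_within g T = {Q. partition_on T Q \<and> (\<forall>B\<in>Q. \<forall>a\<in>B. \<forall>b\<in>B. g a = g b)}"

text \<open>The number of permutations whose cycles have the blocks of \<open>Q\<close> as
  underlying sets. Summed over \<open>partitions_within g T\<close> it counts the permutations of
  \<open>T\<close> that preserve \<open>g\<close>.\<close>

definition cycle_weight :: "'a set set \<Rightarrow> nat" where
  "cycle_weight Q = (\<Prod>B\<in>Q. fact (card B - 1))"

lemma finite_partitions_within: "finite T \<Longrightarrow> finite (partitions_within g T)"
  by (rule finite_subset[OF _ finitely_many_partition_on[of T]]) (auto simp: partitions_within_def)

lemma partition_on_block_unique:
  "partition_on T Q \<Longrightarrow> B \<in> Q \<Longrightarrow> C \<in> Q \<Longrightarrow> x \<in> B \<Longrightarrow> x \<in> C \<Longrightarrow> B = C"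
  unfolding partition_on_def disjoint_def by blast

text \<open>
  Removing \<open>t\<close> from its block \<open>insert t B\<close> (where \<open>B = {}\<close> if the block is a singleton) is
  inverted by choosing a block \<open>B\<close> of the remaining partition, or the empty set.
\<close>

lemma sum_cycle_weight_remove:
  assumes fin: "finite T" and t: "t \<in> T"
  shows "(\<Sum>Q\<in>partitions_within g T. cycle_weight Q) =
    card {s \<in> T. g s = g t} * (\<Sum>Q\<in>partitions_within g (T - {t}). cycle_weight Q)"
proof -
  define Bl where "Bl Q = insert {} {B \<in> Q. \<forall>s\<in>B. g s = g t}" for Q
  let ?S = "Sigma (partitions_within g (T - {t})) Bl"
  define i where "i Q = (let C = (THE C. C \<in> Q \<and> t \<in> C) in (Q - {C} \<union> ({C - {t}} - {{}}), C - {t}))" for Q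
  define j where "j = (\<lambda>(Q, B). insert (insert t B) (Q - {B}))"
  have finQ: "finite Q" if "Q \<in> partitions_within g (T - {t})" for Q
    using that fin by (auto simp: partitions_within_def intro: finite_elements[of "T - {t}"])
  have the: "(THE C. C \<in> Q \<and> t \<in> C) = C" if "partition_on T Q" "C \<in> Q" "t \<in> C" for Q C
    using that by (intro the_equality) (auto dest: partition_on_block_unique)
  have j: "j (Q, B) \<in> partitions_within g T" "i (j (Q, B)) = (Q, B)"
      "cycle_weight (j (Q, B)) = (if B = {} then 1 else card B) * cycle_weight Q"
    if Q: "Q \<in> partitions_within g (T - {t})" and B: "B \<in> Bl Q" for Q B
  proof -
    have part: "partition_on (T - {t}) Q" and const: "\<And>B a b. B \<in> Q \<Longrightarrow> a \<in> B \<Longrightarrow> b \<in> B \<Longrightarrow> g a = g b"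
      using Q unfolding partitions_within_def by blast+
    have BQ: "B = {} \<or> B \<in> Q" and gB: "\<And>s. s \<in> B \<Longrightarrow> g s = g t" using B by (auto simp: Bl_def)
    have ne: "{} \<notin> Q" and un: "\<Union> Q = T - {t}" using part by (auto simp: partition_on_def)
    have tQ: "t \<notin> C" if "C \<in> Q" for C using un that by blast
    have tB: "t \<notin> B" using BQ tQ by auto
    have disj: "disjnt B (\<Union> (Q - {B}))"
      using BQ partition_on_block_unique[OF part] unfolding disjnt_iff by blast
    have partB: "partition_on (T - {t} - B) (Q - {B})"
    proof (cases "B = {}")
      case False
      then have "insert B (Q - {B}) = Q" using BQ by auto
      then show ?thesis using partition_on_insert[OF disj, of "T - {t}"] part by simp
    qed (use part ne in simp)
    have disj': "disjnt (insert t B) (\<Union> (Q - {B}))" using disj tQ by (auto simp: disjnt_iff)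
    have "B \<subseteq> T" using BQ un by blast
    moreover have "T - insert t B = T - {t} - B" by blast
    ultimately have pj: "partition_on T (j (Q, B))"
      unfolding j_def prod.case using partition_on_insert[OF disj'] partB t by simp
    then show "j (Q, B) \<in> partitions_within g T"
      using const gB unfolding partitions_within_def j_def by auto
    have C: "(THE C. C \<in> j (Q, B) \<and> t \<in> C) = insert t B"
      by (rule the[OF pj]) (auto simp: j_def)
    have notin: "insert t B \<notin> Q - {B}" using tQ by blast
    show "i (j (Q, B)) = (Q, B)"
    proof -
      have "j (Q, B) - {insert t B} = Q - {B}" using notin by (auto simp: j_def)
      moreover have "insert t B - {t} = B" using tB by auto
      moreover have "Q - {B} \<union> ({B} - {{}}) = Q" using BQ ne by auto
      ultimately show ?thesis by (simp add: i_def C Let_def)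
    qed
    have finB: "finite B" using \<open>B \<subseteq> T\<close> fin by (rule finite_subset)
    \<comment> \<open>The enlarged block has weight \<open>fact (card B)\<close>, which is
      \<open>card B\<close> times the old one: \<open>t\<close> can be placed after any element of
      the cycle. A new singleton has weight 1.\<close>
    have "cycle_weight (j (Q, B)) = fact (card B) * cycle_weight (Q - {B})"
      using notin finQ[OF Q] tB finB by (simp add: cycle_weight_def j_def)
    also have "\<dots> = (if B = {} then 1 else card B) * cycle_weight Q"
    proof (cases "B = {}")
      case False
      then have "cycle_weight Q = fact (card B - 1) * cycle_weight (Q - {B})"
        using BQ finQ[OF Q] unfolding cycle_weight_def by (subst prod.remove[of Q B]) auto
      moreover have "fact (card B) = card B * (fact (card B - 1) :: nat)"
        using False finB fact_reduce[of "card B", where 'a=nat] by (simp add: card_gt_0_iff)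
      ultimately show ?thesis using False by simp
    qed (use ne in simp)
    finally show "cycle_weight (j (Q, B)) = (if B = {} then 1 else card B) * cycle_weight Q" .
  qed
  have i: "i Q \<in> ?S" "j (i Q) = Q" if Q: "Q \<in> partitions_within g T" for Q
  proof -
    have part: "partition_on T Q" and const: "\<And>B a b. B \<in> Q \<Longrightarrow> a \<in> B \<Longrightarrow> b \<in> B \<Longrightarrow> g a = g b"
      using Q unfolding partitions_within_def by blast+
    have "t \<in> \<Union> Q" using part t by (simp add: partition_on_def)
    then obtain C where C: "C \<in> Q" "t \<in> C" by blast
    have iQ: "i Q = (Q - {C} \<union> ({C - {t}} - {{}}), C - {t})"
      using the[OF part C] by (simp add: i_def)
    have insC: "insert C (Q - {C}) = Q" using C by auto
    have dC: "disjnt C (\<Union> (Q - {C}))"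
      using C partition_on_block_unique[OF part] unfolding disjnt_iff by blast
    then have pC: "partition_on (T - C) (Q - {C})" and CT: "C \<subseteq> T"
      using partition_on_insert[OF dC, of T] part insC by auto
    have pQ': "partition_on (T - {t}) (Q - {C} \<union> ({C - {t}} - {{}}))"
    proof (cases "C = {t}")
      case False
      then have eq: "Q - {C} \<union> ({C - {t}} - {{}}) = insert (C - {t}) (Q - {C})" and ne: "C - {t} \<noteq> {}"
        using C by auto
      have "disjnt (C - {t}) (\<Union> (Q - {C}))" using dC by (auto simp: disjnt_iff)
      moreover have "T - {t} - (C - {t}) = T - C" using C by blast
      ultimately show ?thesis
        unfolding eq using partition_on_insert pC CT ne by (metis Diff_mono order_refl)
    qed (use pC in simp)
    have "Q - {C} \<union> ({C - {t}} - {{}}) \<in> partitions_within g (T - {t})"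
      using pQ' const C unfolding partitions_within_def by blast
    moreover have "C - {t} \<in> Bl (Q - {C} \<union> ({C - {t}} - {{}}))"
      using const C unfolding Bl_def by blast
    ultimately show "i Q \<in> ?S" by (simp add: iQ)
    have notin: "C - {t} \<notin> Q - {C}"
    proof
      assume a: "C - {t} \<in> Q - {C}"
      then obtain x where "x \<in> C - {t}" using part unfolding partition_on_def by (metis DiffD1 ex_in_conv)
      then show False using a C partition_on_block_unique[OF part, of "C - {t}" C x] by blast
    qed
    have "insert t (C - {t}) = C" using C by auto
    moreover have "(Q - {C} \<union> ({C - {t}} - {{}})) - {C - {t}} = Q - {C}"
      using notin by auto
    ultimately show "j (i Q) = Q" using insC by (simp add: iQ j_def)
  qed
  have "(\<Sum>Q\<in>partitions_within g T. cycle_weight Q) =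
      (\<Sum>(Q, B)\<in>?S. (if B = {} then 1 else card B) * cycle_weight Q)"
    by (rule sum.reindex_bij_witness[of _ i j, symmetric]) (use i j in auto)
  also have "\<dots> = (\<Sum>Q\<in>partitions_within g (T - {t}). \<Sum>B\<in>Bl Q. (if B = {} then 1 else card B) * cycle_weight Q)"
    using fin finQ by (intro sum.Sigma[symmetric]) (auto simp: Bl_def finite_partitions_within)
  also have "\<dots> = (\<Sum>Q\<in>partitions_within g (T - {t}). card {s \<in> T. g s = g t} * cycle_weight Q)"
  proof (intro sum.cong refl)
    fix Q assume Q: "Q \<in> partitions_within g (T - {t})"
    then have part: "partition_on (T - {t}) Q" and const: "\<And>B a b. B \<in> Q \<Longrightarrow> a \<in> B \<Longrightarrow> b \<in> B \<Longrightarrow> g a = g b"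
      unfolding partitions_within_def by blast+
    let ?R = "{B \<in> Q. \<forall>s\<in>B. g s = g t}"
    have ne: "{} \<notin> Q" and un: "\<Union> Q = T - {t}" using part by (auto simp: partition_on_def)
    have "\<Union> ?R = {s \<in> T - {t}. g s = g t}"
    proof
      show "{s \<in> T - {t}. g s = g t} \<subseteq> \<Union> ?R"
      proof
        fix s assume s: "s \<in> {s \<in> T - {t}. g s = g t}"
        then obtain B where B: "B \<in> Q" "s \<in> B" using un by blast
        have "g s = g t" using s by blast
        then have "\<forall>r\<in>B. g r = g t" using const[OF B(1) _ B(2)] by metis
        then show "s \<in> \<Union> ?R" using B by blast
      qed
    qed (use un in blast)
    moreover have "card (\<Union> ?R) = (\<Sum>B\<in>?R. card B)"
    proof (rule card_Union_disjoint)
      show "disjoint ?R" using part by (auto simp: partition_on_def disjoint_def)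
      show "finite B" if "B \<in> ?R" for B
      proof (rule finite_subset[OF _ fin])
        show "B \<subseteq> T" using that un by blast
      qed
    qed
    ultimately have "card {s \<in> T - {t}. g s = g t} = (\<Sum>B\<in>?R. card B)" by simp
    moreover have "{s \<in> T. g s = g t} = insert t {s \<in> T - {t}. g s = g t}" using t by auto
    ultimately have "card {s \<in> T. g s = g t} = Suc (\<Sum>B\<in>?R. card B)" using fin by simp
    \<comment> \<open>The blocks on which \<open>g\<close> has the value \<open>g t\<close>
      contribute the size of its fibre without \<open>t\<close>, and the empty set supplies the
      missing 1.\<close>
    moreover have "(\<Sum>B\<in>Bl Q. if B = {} then 1 else card B) = Suc (\<Sum>B\<in>?R. card B)"
    proof -
      have "(\<Sum>B\<in>?R. if B = {} then 1 else card B) = (\<Sum>B\<in>?R. card B)"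
        using ne by (intro sum.cong) auto
      then show ?thesis using ne finQ[OF Q] by (simp add: Bl_def)
    qed
    ultimately show "(\<Sum>B\<in>Bl Q. (if B = {} then 1 else card B) * cycle_weight Q) =
        card {s \<in> T. g s = g t} * cycle_weight Q"
      by (simp flip: sum_distrib_right)
  qed
  finally show ?thesis by (simp add: sum_distrib_left)
qed

definition sorted_enumerations :: "('a \<Rightarrow> nat) \<Rightarrow> 'a set \<Rightarrow> 'a list set" where
  "sorted_enumerations g T = {xs. distinct xs \<and> set xs = T \<and> sorted (map g xs)}"

lemma finite_sorted_enumerations: "finite T \<Longrightarrow> finite (sorted_enumerations g T)"
  by (rule finite_subset[OF _ finite_subset_distinct[of T]]) (auto simp: sorted_enumerations_def)

text \<open>A sorted list starts with any of the minimisers \<open>M\<close> of \<open>g\<close>.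
  Each minimiser has \<open>M\<close> as its fibre, so removing it gives the same recursion on the
  side of the partitions. Both numbers are the product of the factorials of the fibre sizes.\<close>

lemma card_sorted_enumerations:
  assumes "finite T"
  shows "card (sorted_enumerations g T) = (\<Sum>Q\<in>partitions_within g T. cycle_weight Q)"
  using assms
proof (induction "card T" arbitrary: T)
  case 0
  then have "T = {}" by simp
  moreover have "sorted_enumerations g {} = {[]}" by (auto simp: sorted_enumerations_def)
  moreover have "partitions_within g {} = {{}}" by (auto simp: partitions_within_def partition_on_empty)
  ultimately show ?case by (simp add: cycle_weight_def)
next
  case (Suc m)
  define M where "M = {t \<in> T. \<forall>s\<in>T. g t \<le> g s}"
  have "T \<noteq> {}" using Suc.hyps(2) by auto
  then obtain t0 where t0: "t0 \<in> T" "\<And>s. s \<in> T \<Longrightarrow> g t0 \<le> g s"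
    using ex_has_least_nat[of "\<lambda>t. t \<in> T" _ g] by blast
  then have M0: "t0 \<in> M" by (auto simp: M_def)
  have finM: "finite M" using Suc.prems by (simp add: M_def)
  have M: "{s \<in> T. g s = g t} = M" if "t \<in> M" for t
    using that by (auto simp: M_def intro: order_antisym)
  have "sorted_enumerations g T = (\<Union>t\<in>M. (#) t ` sorted_enumerations g (T - {t}))"
  proof (intro equalityI subsetI)
    fix xs assume xs: "xs \<in> sorted_enumerations g T"
    then obtain t ys where "xs = t # ys" using \<open>T \<noteq> {}\<close> by (cases xs) (auto simp: sorted_enumerations_def)
    then show "xs \<in> (\<Union>t\<in>M. (#) t ` sorted_enumerations g (T - {t}))"
      using xs by (auto simp: sorted_enumerations_def M_def)
  qed (auto simp: sorted_enumerations_def M_def)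
  also have "card \<dots> = (\<Sum>t\<in>M. card ((#) t ` sorted_enumerations g (T - {t})))"
    using finM Suc.prems by (intro card_UN_disjoint) (auto simp: finite_sorted_enumerations)
  also have "\<dots> = (\<Sum>t\<in>M. \<Sum>Q\<in>partitions_within g (T - {t}). cycle_weight Q)"
  proof (intro sum.cong refl)
    fix t assume "t \<in> M"
    then have "card (T - {t}) = m" using Suc by (simp add: M_def)
    then show "card ((#) t ` sorted_enumerations g (T - {t})) = (\<Sum>Q\<in>partitions_within g (T - {t}). cycle_weight Q)"
      using Suc by (simp add: card_image)
  qed
  \<comment> \<open>On the weighted side the removal of a single \<open>t\<close> already gives the
    factor \<open>card M\<close>; multiplying by \<open>card M\<close> lets the two recursions be
    compared before cancelling.\<close>
  finally have "card M * card (sorted_enumerations g T) =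
      (\<Sum>t\<in>M. card M * (\<Sum>Q\<in>partitions_within g (T - {t}). cycle_weight Q))"
    by (simp add: sum_distrib_left)
  also have "\<dots> = (\<Sum>t\<in>M. \<Sum>Q\<in>partitions_within g T. cycle_weight Q)"
    using sum_cycle_weight_remove[OF Suc.prems, of _ g] M by (intro sum.cong) (auto simp: M_def)
  finally show ?case using M0 finM by auto
qed

text \<open>A partition coarser than \<open>\<alpha>\<close> is the same as a partition of the set \<open>\<alpha>\<close>.\<close>

lemma sum_partition_cartan:
  assumes \<alpha>: "\<alpha> \<in> set_partitions n" and y: "y \<in> packed_words n"
    and g: "\<And>A p. A \<in> \<alpha> \<Longrightarrow> p \<in> A \<Longrightarrow> g A = y ! (p - 1)"
  shows "(\<Sum>\<beta> | refines {1..n} \<alpha> \<beta> \<and> refines {1..n} \<beta> (word_partition y). partition_cartan n \<alpha> \<beta>) =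
    (\<Sum>Q\<in>partitions_within g \<alpha>. cycle_weight Q)"
proof -
  \<comment> \<open>The correspondence sends \<beta> to the sets \<open>below B\<close> for
    \<open>B\<close> in \<beta>, with unions as inverse; the size of \<open>below B\<close> is the
    number of blocks of \<alpha> into which \<open>B\<close> is split.\<close>
  define below where "below B = {A \<in> \<alpha>. A \<subseteq> B}" for B
  have part: "partition_on {1..n} \<alpha>" using \<alpha> by (simp add: set_partitions_def)
  have ne: "{} \<notin> \<alpha>" and un: "\<Union> \<alpha> = {1..n}" using part by (auto simp: partition_on_def)
  have leny: "length y = n" using y by (simp add: packed_words_def)
  have Union_below: "\<Union> (below B) = B" if "refines {1..n} \<alpha> \<beta>" "B \<in> \<beta>" for B \<beta>
    using refines_obtains_subset[OF that] by (simp add: partition_on_def below_def)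
  have below_Union: "below (\<Union> C) = C" if Q: "partition_on \<alpha> Q" and C: "C \<in> Q" for C Q
  proof
    show "below (\<Union> C) \<subseteq> C"
    proof
      fix A assume A: "A \<in> below (\<Union> C)"
      then have "A \<noteq> {}" using ne by (auto simp: below_def)
      then obtain p where p: "p \<in> A" by blast
      then obtain A' where A': "A' \<in> C" "p \<in> A'" using A by (auto simp: below_def)
      have "A' \<in> \<alpha>" using A' Q C by (auto simp: partition_on_def)
      then show "A \<in> C" using partition_on_block_unique[OF part, of A A' p] A A' p by (auto simp: below_def)
    qed
    show "C \<subseteq> below (\<Union> C)" using Q C by (auto simp: partition_on_def below_def)
  qed
  show ?thesis
  proof (rule sum.reindex_bij_witness[of _ "(`) Union" "(`) below"])
    fix \<beta> assume "\<beta> \<in> {\<beta>. refines {1..n} \<alpha> \<beta> \<and> refines {1..n} \<beta> (word_partition y)}"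
    then have ref: "refines {1..n} \<alpha> \<beta>" and ref': "refines {1..n} \<beta> (word_partition y)" by auto
    have \<beta>: "\<beta> \<in> set_partitions n" using ref by (rule refines_in_set_partitions)
    then have part\<beta>: "partition_on {1..n} \<beta>" by (simp add: set_partitions_def)
    show "Union ` below ` \<beta> = \<beta>"
      using Union_below[OF ref] by (force simp: image_image)
    have "partition_on \<alpha> (below ` \<beta>)"
    proof (rule partition_onI)
      show "\<Union> (below ` \<beta>) = \<alpha>"
        using ref by (auto simp: below_def refines_def)
      show "{} \<notin> below ` \<beta>"
        using Union_below[OF ref] part\<beta> unfolding partition_on_def by (metis Union_empty imageE)
      fix P Q assume "P \<in> below ` \<beta>" "Q \<in> below ` \<beta>" "P \<noteq> Q"
      then obtain B C where BC: "B \<in> \<beta>" "C \<in> \<beta>" "B \<noteq> C" "P = below B" "Q = below C" by auto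
      show "disjnt P Q"
        unfolding disjnt_iff
      proof (intro allI notI)
        fix A assume A: "A \<in> P \<and> A \<in> Q"
        then have "A \<noteq> {}" using ne BC by (auto simp: below_def)
        then obtain p where "p \<in> A" by blast
        then show False
          using A BC partition_on_block_unique[OF part\<beta>, of B C p] by (auto simp: below_def)
      qed
    qed
    moreover have "g A = g A'" if "B \<in> \<beta>" "A \<in> below B" "A' \<in> below B" for B A A'
    proof -
      have mem: "A \<in> \<alpha>" "A' \<in> \<alpha>" "A \<subseteq> B" "A' \<subseteq> B" using that by (auto simp: below_def)
      then obtain p p' where p: "p \<in> A" "p' \<in> A'" using ne by (metis ex_in_conv)
      have "y ! (p - 1) = y ! (p' - 1)"
        using ref'[unfolded refines_word_partition_iff[OF \<beta> leny]] that(1) mem p by blast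
      then show ?thesis using g mem p by metis
    qed
    ultimately show "below ` \<beta> \<in> partitions_within g \<alpha>"
      unfolding partitions_within_def by blast
    have "inj_on below \<beta>"
      using Union_below[OF ref] by (metis inj_onI)
    then show "cycle_weight (below ` \<beta>) = partition_cartan n \<alpha> \<beta>"
      using ref by (simp add: cycle_weight_def partition_cartan_def prod.reindex) (simp add: below_def)
  next
    fix Q assume Q: "Q \<in> partitions_within g \<alpha>"
    then have pQ: "partition_on \<alpha> Q" and const: "\<And>C A A'. C \<in> Q \<Longrightarrow> A \<in> C \<Longrightarrow> A' \<in> C \<Longrightarrow> g A = g A'"
      unfolding partitions_within_def by blast+
    show "below ` Union ` Q = Q"
      using below_Union[OF pQ] by (force simp: image_image)
    have sub: "C \<subseteq> \<alpha>" if "C \<in> Q" for C using pQ that by (auto simp: partition_on_def)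
    have part\<beta>: "partition_on {1..n} (Union ` Q)"
    proof (rule partition_onI)
      show "\<Union> (Union ` Q) = {1..n}" using pQ un by (auto simp: partition_on_def)
      show "{} \<notin> Union ` Q"
      proof
        assume "{} \<in> Union ` Q"
        then obtain C where C: "C \<in> Q" "\<Union> C = {}" by auto
        then have "C \<subseteq> {{}}" by auto
        moreover have "C \<noteq> {}" using C pQ by (auto simp: partition_on_def)
        ultimately show False using sub[OF C(1)] ne by auto
      qed
      fix P R assume "P \<in> Union ` Q" "R \<in> Union ` Q" "P \<noteq> R"
      then obtain C D where CD: "C \<in> Q" "D \<in> Q" "C \<noteq> D" "P = \<Union> C" "R = \<Union> D" by auto
      show "disjnt P R"
        unfolding disjnt_iff
      proof (intro allI notI)
        fix p assume "p \<in> P \<and> p \<in> R"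
        then obtain A A' where A: "A \<in> C" "A' \<in> D" "p \<in> A" "p \<in> A'" using CD by auto
        then have "A = A'" using partition_on_block_unique[OF part] sub CD by blast
        then show False using A CD partition_on_block_unique[OF pQ, of C D A] by auto
      qed
    qed
    then have \<beta>: "Union ` Q \<in> set_partitions n" by (simp add: set_partitions_def)
    have "refines {1..n} \<alpha> (Union ` Q)"
      unfolding refines_def using part part\<beta> pQ by (auto simp: partition_on_def)
    moreover have "refines {1..n} (Union ` Q) (word_partition y)"
      unfolding refines_word_partition_iff[OF \<beta> leny]
    proof (intro ballI)
      fix B p p' assume "B \<in> Union ` Q" "p \<in> B" "p' \<in> B"
      then obtain C A A' where "C \<in> Q" "A \<in> C" "A' \<in> C" "p \<in> A" "p' \<in> A'" by auto
      then show "y ! (p - 1) = y ! (p' - 1)"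
        using const g sub by (metis subsetD)
    qed
    ultimately show "Union ` Q \<in> {\<beta>. refines {1..n} \<alpha> \<beta> \<and> refines {1..n} \<beta> (word_partition y)}" by simp
  qed
qed

text \<open>A word of support \<alpha> is an ordering of the blocks, and \<open>y\<close> fixes it
  when the letters of \<open>y\<close> on the blocks increase weakly. Counting sorted orderings by
  partitions of the set \<alpha> then amounts to summing over coarser \<beta>.\<close>

lemma card_fixed_words:
  assumes \<alpha>: "\<alpha> \<in> set_partitions n" and y: "y \<in> packed_words n" and ref: "refines {1..n} \<alpha> (word_partition y)"
  shows "card {x \<in> words_of_partition n \<alpha>. pack y x = x} =
    (\<Sum>\<beta> | refines {1..n} \<alpha> \<beta> \<and> refines {1..n} \<beta> (word_partition y). partition_cartan n \<alpha> \<beta>)"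
proof -
  \<comment> \<open>Any element of the block may be chosen, since \<open>y\<close> is constant on
    the blocks of \<alpha>.\<close>
  define g where "g A = y ! ((SOME p. p \<in> A) - 1)" for A :: "nat set"
  have leny: "length y = n" using y by (simp add: packed_words_def)
  have g: "g A = y ! (p - 1)" if "A \<in> \<alpha>" "p \<in> A" for A p
    using ref[unfolded refines_word_partition_iff[OF \<alpha> leny]] that someI[of "\<lambda>p. p \<in> A" p]
    unfolding g_def by blast
  have bij: "bij_betw (composition_word n) {Bs. distinct Bs \<and> set Bs = \<alpha>} (words_of_partition n \<alpha>)"
    using bij_betw_composition_word[OF \<alpha>] by (simp add: words_of_partition_def)
  have iff: "pack y (composition_word n Bs) = composition_word n Bs \<longleftrightarrow> sorted (map g Bs)"
    if "distinct Bs" "set Bs = \<alpha>" for Bs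
    using that \<alpha> by (intro pack_composition_word_iff y g) (auto simp: set_partitions_def)
  have "bij_betw (composition_word n) (sorted_enumerations g \<alpha>) {x \<in> words_of_partition n \<alpha>. pack y x = x}"
    unfolding bij_betw_def
  proof
    show "inj_on (composition_word n) (sorted_enumerations g \<alpha>)"
      using bij by (rule inj_on_subset[OF bij_betw_imp_inj_on]) (auto simp: sorted_enumerations_def)
    show "composition_word n ` sorted_enumerations g \<alpha> = {x \<in> words_of_partition n \<alpha>. pack y x = x}"
      unfolding bij_betw_imp_surj_on[OF bij, symmetric] sorted_enumerations_def using iff by blast
  qed
  then have "card {x \<in> words_of_partition n \<alpha>. pack y x = x} = card (sorted_enumerations g \<alpha>)"
    by (rule bij_betw_same_card[symmetric])
  also have "\<dots> = (\<Sum>Q\<in>partitions_within g \<alpha>. cycle_weight Q)"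
    using finite_set_partition[OF \<alpha>] by (rule card_sorted_enumerations)
  also have "\<dots> = (\<Sum>\<beta> | refines {1..n} \<alpha> \<beta> \<and> refines {1..n} \<beta> (word_partition y). partition_cartan n \<alpha> \<beta>)"
    by (rule sum_partition_cartan[OF \<alpha> y g, symmetric])
  finally show ?thesis .
qed

section \<open>Cartan invariants of the algebra of packed words\<close>

lemma finite_independent_in_span:
  assumes "wq.independent b" "b \<subseteq> wq.span A" "finite A"
  shows "finite b"
  using wq.independent_span_bound[OF assms(3,1,2)] by simp

text \<open>Left multiplication by \<open>f i\<close> projects the sum onto \<open>U i\<close>, so
  the sum is direct and bases can be united.\<close>

lemma dim_span_orthogonal:
  fixes f :: "'i \<Rightarrow> 'k::field wqsym"
  assumes Q: "finite Q" and U: "\<And>i. i \<in> Q \<Longrightarrow> wq.subspace (U i)"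
    and fin: "finite A" "\<And>i. i \<in> Q \<Longrightarrow> U i \<subseteq> wq.span A"
    and f: "\<And>i j v. i \<in> Q \<Longrightarrow> j \<in> Q \<Longrightarrow> v \<in> U j \<Longrightarrow> f i \<star> v = (if i = j then v else 0)"
  shows "wq.dim (wq.span (\<Union>i\<in>Q. U i)) = (\<Sum>i\<in>Q. wq.dim (U i))"
proof -
  have "\<exists>b. b \<subseteq> U i \<and> wq.independent b \<and> U i \<subseteq> wq.span b \<and> card b = wq.dim (U i)" for i
    using wq.basis_exists[of "U i"] by metis
  then obtain b where b: "\<And>i. b i \<subseteq> U i" "\<And>i. wq.independent (b i)" "\<And>i. U i \<subseteq> wq.span (b i)"
      "\<And>i. card (b i) = wq.dim (U i)"
    by metis
  have finb: "finite (b i)" if "i \<in> Q" for i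
    using b(1,2)[of i] fin that finite_independent_in_span by blast
  have disj: "b i \<inter> b j = {}" if "i \<in> Q" "j \<in> Q" "i \<noteq> j" for i j
  proof (rule ccontr)
    assume "b i \<inter> b j \<noteq> {}"
    then obtain v where v: "v \<in> b i" "v \<in> b j" by blast
    then have "f i \<star> v = v" "f i \<star> v = 0" using f[of i i v] f[of i j v] b(1) that by auto
    then show False using v(1) b(2)[of i] wq.dependent_zero by auto
  qed
  let ?b = "\<Union>i\<in>Q. b i"
  have "wq.independent ?b"
  proof (rule wq.independent_if_scalars_zero)
    show "finite ?b" using Q finb by blast
    fix c v assume sum: "(\<Sum>x\<in>?b. wscale (c x) x) = 0" and "v \<in> ?b"
    then obtain i where i: "i \<in> Q" "v \<in> b i" by blast
    have "0 = f i \<star> (\<Sum>x\<in>?b. wscale (c x) x)" by (simp add: sum)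
    also have "\<dots> = (\<Sum>x\<in>?b. wscale (c x) (f i \<star> x))"
      by (simp only: star_sum_right star_scale_right)
    also have "\<dots> = (\<Sum>x\<in>b i. wscale (c x) (f i \<star> x))"
    proof (rule sum.mono_neutral_right)
      show "\<forall>x\<in>?b - b i. wscale (c x) (f i \<star> x) = 0"
      proof
        fix x assume "x \<in> ?b - b i"
        then obtain j where "j \<in> Q" "x \<in> b j" "i \<noteq> j" by blast
        then show "wscale (c x) (f i \<star> x) = 0" using f[of i j x] i b(1)[of j] by auto
      qed
    qed (use Q finb i in auto)
    also have "\<dots> = (\<Sum>x\<in>b i. wscale (c x) x)"
      using f[of i i] i b(1)[of i] by (intro sum.cong) auto
    finally have "(\<Sum>x\<in>b i. wscale (c x) x) = 0" by simp
    then show "c v = 0"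
      using wq.independentD[OF b(2) finb[OF i(1)] order_refl _ i(2)] by blast
  qed
  moreover have "wq.span (\<Union>i\<in>Q. U i) = wq.span ?b"
  proof (rule wq.span_eq[THEN iffD2], intro conjI UN_least)
    fix i assume "i \<in> Q"
    then show "U i \<subseteq> wq.span ?b" using b(3)[of i] wq.span_mono[of "b i" ?b] by blast
    show "b i \<subseteq> wq.span (\<Union>i\<in>Q. U i)" using b(1)[of i] wq.span_superset[of "\<Union>i\<in>Q. U i"] \<open>i \<in> Q\<close> by blast
  qed
  ultimately have "wq.dim (wq.span (\<Union>i\<in>Q. U i)) = card ?b"
    by (simp add: wq.dim_eq_card_independent)
  also have "\<dots> = (\<Sum>i\<in>Q. card (b i))"
    using Q finb disj by (intro card_UN_disjoint) auto
  finally show ?thesis by (simp add: b(4))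
qed

context wq_level begin

text \<open>The order of the arguments is that of the Cartan invariants: the first index belongs to
  the right idempotent.\<close>

definition peirce_dim :: "nat set set \<Rightarrow> nat set set \<Rightarrow> nat" where
  "peirce_dim X Y = wq.dim ((\<lambda>x. e Y \<star> x \<star> e X) ` W)"

lemma W_finite_dim: "finite (NN ` packed_words n :: 'k wqsym set)" "W \<subseteq> wq.span (NN ` packed_words n)"
  by (auto simp: finite_packed_words WQ_def)

lemma subspace_peirce: "wq.subspace ((\<lambda>x. a \<star> x \<star> b) ` W)" for a b :: "'k wqsym"
  by (rule wqp.linear_subspace_image[OF star_linear_both subspace_WQ])

text \<open>The word \<open>y\<close> acts on the basis elements \<open>NN x \<star> e X\<close> by
  \<open>x \<mapsto> pack y x\<close>. It is idempotent, so its image is spanned by the basis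
  elements that it fixes.\<close>

lemma dim_word_peirce:
  assumes X: "X \<in> partitions" and y: "y \<in> packed_words n" and ref: "finer X (word_partition y)"
  shows "wq.dim ((\<lambda>x. NN y \<star> x \<star> e X) ` W) = card {x \<in> words_of_partition n X. pack y x = x}"
proof -
  let ?Fix = "{x \<in> words_of_partition n X. pack y x = x}"
  let ?b = "(\<lambda>x. NN x \<star> e X) ` ?Fix"
  have lenw: "length x = n" "x \<in> packed_words n" if "x \<in> words_of_partition n X" for x
    using that length_words_of_partition words_of_partition_packed by auto
  have yx: "NN y \<star> (NN x \<star> e X) = NN (pack y x) \<star> e X" if "x \<in> words_of_partition n X" for x
    using that y lenw by (simp add: star_NN_packed flip: star_assoc)
  have inj: "inj_on (\<lambda>x. NN x \<star> e X) ?Fix"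
  proof (rule inj_onI)
    fix x x' assume x: "x \<in> ?Fix" "x' \<in> ?Fix" "NN x \<star> e X = NN x' \<star> e X"
    have "(1 :: 'k) = Poly_Mapping.lookup (NN x \<star> e X) x"
      using lookup_NN_star_saliola[OF X, of x x, where 'k='k] x(1) by simp
    also have "\<dots> = (if x' = x then 1 else 0)"
      unfolding x(3) using lookup_NN_star_saliola[OF X, of x' x, where 'k='k] x(1,2) by blast
    finally show "x = x'" by (simp split: if_splits)
  qed
  have indep: "wq.independent ?b"
  proof (rule wq.independent_if_scalars_zero)
    fix c v assume sum: "(\<Sum>x\<in>?b. wscale (c x) x) = 0" and "v \<in> ?b"
    then obtain w where w: "w \<in> ?Fix" "v = NN w \<star> e X" by blast
    have "0 = Poly_Mapping.lookup (\<Sum>x\<in>?Fix. wscale (c (NN x \<star> e X)) (NN x \<star> e X)) w"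
      using sum by (simp add: sum.reindex[OF inj])
    also have "\<dots> = (\<Sum>x\<in>?Fix. if x = w then c (NN x \<star> e X) else 0)"
      unfolding lookup_sum lookup_wscale
      using w by (intro sum.cong) (auto simp: lookup_NN_star_saliola[OF X])
    also have "\<dots> = c v" using w by simp
    finally show "c v = 0" by simp
  qed simp
  have fixed: "pack y x \<in> ?Fix" if "x \<in> words_of_partition n X" for x
  proof -
    have ly: "length y = n" using y by (simp add: packed_words_def)
    have "pack y (pack y x) = pack (pack y y) x"
      using pack_assoc[OF ly ly lenw(1)[OF that]] by simp
    moreover have "pack y y = y"
      using pack_absorb_right_iff[OF y y] refines_refl'[OF word_partition_packed_words[OF y]] by simp
    ultimately show ?thesis using word_partition_pack_eq[OF y that ref] by simp
  qed
  have "(\<lambda>x. NN y \<star> x \<star> e X) ` W = wq.span ?b"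
  proof
    show "(\<lambda>x. NN y \<star> x \<star> e X) ` W \<subseteq> wq.span ?b"
    proof
      fix z assume "z \<in> (\<lambda>x. NN y \<star> x \<star> e X) ` W"
      then obtain F where F: "F \<in> W" "z = NN y \<star> (F \<star> e X)" by (auto simp: star_assoc)
      have "z = (\<Sum>x\<in>words_of_partition n X. wscale (Poly_Mapping.lookup (F \<star> e X) x) (NN y \<star> (NN x \<star> e X)))"
        unfolding F(2) by (subst star_saliola_expand[OF F(1) X]) (simp only: star_sum_right star_scale_right)
      also have "\<dots> \<in> wq.span ?b"
        using fixed by (intro wq.span_sum wq.span_scale wq.span_base) (auto simp: yx)
      finally show "z \<in> wq.span ?b" .
    qed
    show "wq.span ?b \<subseteq> (\<lambda>x. NN y \<star> x \<star> e X) ` W"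
    proof (rule wq.span_minimal[OF _ subspace_peirce])
      show "?b \<subseteq> (\<lambda>x. NN y \<star> x \<star> e X) ` W"
      proof
        fix v assume "v \<in> ?b"
        then obtain x where x: "x \<in> words_of_partition n X" "pack y x = x" "v = NN x \<star> e X" by blast
        then have "v = NN y \<star> NN x \<star> e X" using yx[OF x(1)] by (simp add: star_assoc)
        then show "v \<in> (\<lambda>x. NN y \<star> x \<star> e X) ` W"
          using NN_in_WQ[OF lenw(2)[OF x(1)]] by blast
      qed
    qed
  qed
  then have "wq.dim ((\<lambda>x. NN y \<star> x \<star> e X) ` W) = card ?b"
    using indep by (simp add: wq.dim_eq_card_independent)
  also have "\<dots> = card ?Fix" by (rule card_image[OF inj])
  finally show ?thesis .
qed

text \<open>A word of support \<open>S\<close> and the sum of the \<open>e Y\<close> with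
  \<open>Y\<close> finer than \<open>S\<close> are idempotents with the same characters, so they cut
  out spaces of the same dimension. The first space has a basis of fixed words; the second one
  splits into Peirce spaces.\<close>

lemma sum_peirce_dim:
  assumes X: "X \<in> partitions" and S: "S \<in> partitions" and ref: "finer X S"
  shows "(\<Sum>Y | finer X Y \<and> finer Y S. peirce_dim X Y) = (\<Sum>Y | finer X Y \<and> finer Y S. partition_cartan n X Y)"
proof -
  let ?y = "partition_word n S"
  let ?Q = "{Y. finer Y S}"
  define E where "E = (\<Sum>Y\<in>?Q. e Y)"
  have y: "?y \<in> packed_words n" "word_partition ?y = S" using partition_word[OF S] by auto
  have QP: "?Q \<subseteq> partitions" using refines_in_set_partitions by blast
  have finQ: "finite ?Q" using QP finite_set_partitions finite_subset by blast
  have EW: "E \<in> W" unfolding E_def using QP e_in_W by (intro wq.subspace_sum subspace_WQ) blast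
  have e_E: "e Y \<star> E = e Y" if "Y \<in> ?Q" for Y
  proof -
    have "e Y \<star> E = (\<Sum>Z\<in>?Q. if Y = Z then e Y else 0)"
      unfolding E_def star_sum_right using that QP
      by (intro sum.cong refl) (auto simp: saliola_orthogonal subsetD)
    then show ?thesis using that finQ by simp
  qed
  have idE: "idempotent_in W E"
    unfolding idempotent_in_def using EW
    by (auto simp: E_def star_sum_left e_E[unfolded E_def])
  have idy: "idempotent_in W (NN ?y)"
    unfolding idempotent_in_def
    using NN_star_same_partition[OF partition_word_in_words[OF S] partition_word_in_words[OF S], where 'a='k] y
    by (auto simp: NN_in_WQ)
  have ideX: "idempotent_in W (e X)"
    using X by (simp add: idempotent_in_def e_in_W saliola_orthogonal)
  have chi: "chi \<sigma> (NN ?y :: 'k wqsym) = chi \<sigma> E" if \<sigma>: "\<sigma> \<in> partitions" for \<sigma>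
  proof -
    have "chi \<sigma> E = (\<Sum>Y\<in>?Q. if \<sigma> = Y then 1 else 0)"
      unfolding E_def chi_sum using QP \<sigma> by (intro sum.cong refl chi_saliola) auto
    also have "\<dots> = (if finer \<sigma> S then 1 else 0)" using finQ by simp
    finally show ?thesis using y length_partition_word[OF S] by (simp add: chi_NN)
  qed
  have "wq.dim ((\<lambda>x. NN ?y \<star> x \<star> e X) ` W) = wq.dim ((\<lambda>x. E \<star> x \<star> e X) ` W)"
    by (rule dim_peirce_eq[OF order_refl subspace_WQ _ _ W_finite_dim idy ideX idE ideX chi refl])
       (auto intro: star_in_WQ)
  moreover have "(\<lambda>x. E \<star> x \<star> e X) ` W = wq.span (\<Union>Y\<in>?Q. (\<lambda>x. e Y \<star> x \<star> e X) ` W)"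
  proof
    show "(\<lambda>x. E \<star> x \<star> e X) ` W \<subseteq> wq.span (\<Union>Y\<in>?Q. (\<lambda>x. e Y \<star> x \<star> e X) ` W)"
    proof
      fix z assume "z \<in> (\<lambda>x. E \<star> x \<star> e X) ` W"
      then obtain x where x: "x \<in> W" "z = (\<Sum>Y\<in>?Q. e Y \<star> x \<star> e X)"
        unfolding E_def star_sum_left by blast
      show "z \<in> wq.span (\<Union>Y\<in>?Q. (\<lambda>x. e Y \<star> x \<star> e X) ` W)"
        unfolding x(2) by (intro wq.span_sum wq.span_base) (use x(1) in blast)
    qed
    show "wq.span (\<Union>Y\<in>?Q. (\<lambda>x. e Y \<star> x \<star> e X) ` W) \<subseteq> (\<lambda>x. E \<star> x \<star> e X) ` W"
    proof (rule wq.span_minimal[OF UN_least subspace_peirce], rule image_subsetI)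
      fix Y x assume Y: "Y \<in> ?Q" and x: "x \<in> W"
      have "E \<star> e Y = (\<Sum>Z\<in>?Q. if Z = Y then e Y else 0)"
        unfolding E_def star_sum_left using Y QP
        by (intro sum.cong refl) (auto simp: saliola_orthogonal subsetD)
      then have "E \<star> e Y = e Y" using Y finQ by simp
      then have "e Y \<star> x \<star> e X = E \<star> (e Y \<star> x) \<star> e X" by (simp flip: star_assoc)
      moreover have "e Y \<star> x \<in> W" using x Y QP by (intro star_in_WQ e_in_W) auto
      ultimately show "e Y \<star> x \<star> e X \<in> (\<lambda>x. E \<star> x \<star> e X) ` W" by blast
    qed
  qed
  moreover have "wq.dim (wq.span (\<Union>Y\<in>?Q. (\<lambda>x. e Y \<star> x \<star> e X) ` W)) = (\<Sum>Y\<in>?Q. peirce_dim X Y)"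
    unfolding peirce_dim_def
  proof (rule dim_span_orthogonal[OF finQ subspace_peirce W_finite_dim(1)])
    show "(\<lambda>x. e Y \<star> x \<star> e X) ` W \<subseteq> wq.span (NN ` packed_words n)" if "Y \<in> ?Q" for Y
    proof -
      have "(\<lambda>x. e Y \<star> x \<star> e X) ` W \<subseteq> W"
        using that QP X by (auto intro!: star_in_WQ e_in_W)
      then show ?thesis using W_finite_dim(2) by blast
    qed
    show "e Y \<star> v = (if Y = Z then v else 0)"
      if YZ: "Y \<in> ?Q" "Z \<in> ?Q" "v \<in> (\<lambda>x. e Z \<star> x \<star> e X) ` W" for Y Z v
    proof -
      obtain x where "v = e Z \<star> x \<star> e X" using YZ by blast
      moreover have "e Y \<star> e Z = (if Y = Z then e Z else 0)"
        using YZ QP by (auto simp: saliola_orthogonal subsetD)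
      ultimately show ?thesis by (simp flip: star_assoc)
    qed
  qed
  \<comment> \<open>By triangularity only those \<open>Y\<close> contribute that \<open>X\<close>
    refines.\<close>
  moreover have "(\<Sum>Y\<in>?Q. peirce_dim X Y) = (\<Sum>Y | finer X Y \<and> finer Y S. peirce_dim X Y)"
  proof (rule sum.mono_neutral_right[OF finQ])
    show "\<forall>Y\<in>?Q - {Y. finer X Y \<and> finer Y S}. peirce_dim X Y = 0"
    proof
      fix Y assume Y: "Y \<in> ?Q - {Y. finer X Y \<and> finer Y S}"
      then have "(\<lambda>x. e Y \<star> x \<star> e X) ` W \<subseteq> {0}"
        using saliola_peirce_eq_0[OF X, of Y] QP by auto
      then have "(\<lambda>x. e Y \<star> x \<star> e X) ` W \<subseteq> wq.span {}" by simp
      then show "peirce_dim X Y = 0"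
        unfolding peirce_dim_def using wq.dim_le_card[of _ "{}"] by simp
    qed
  qed auto
  ultimately show ?thesis
    using dim_word_peirce[OF X y(1)] card_fixed_words[OF X y(1)] y(2) ref by simp
qed

text \<open>The sums over all intervals above \<open>X\<close> determine the summands, as in Moebius
  inversion; partitions strictly finer than \<open>Y\<close> have more blocks and come earlier in
  the induction.\<close>

lemma peirce_dim_eq:
  assumes X: "X \<in> partitions"
  shows "finer X Y \<Longrightarrow> peirce_dim X Y = partition_cartan n X Y"
proof (induction "n - card Y" arbitrary: Y rule: less_induct)
  case less
  let ?Q = "{Z. finer X Z \<and> finer Z Y}"
  have Y: "Y \<in> partitions" using less.prems refines_in_set_partitions by blast
  have finQ: "finite ?Q"
    by (rule finite_subset[OF _ finite_set_partitions[of n]]) (use refines_in_set_partitions in blast)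
  have YQ: "Y \<in> ?Q" using less.prems refines_refl'[OF Y] by simp
  have "peirce_dim X Z = partition_cartan n X Z" if Z: "Z \<in> ?Q - {Y}" for Z
  proof (rule less.hyps)
    have "Z \<in> strictly_finer n Y" using Z by (simp add: strictly_finer_def)
    from strictly_finer_card[OF this] show "n - card Z < n - card Y" by linarith
  qed (use Z in blast)
  then have "(\<Sum>Z\<in>?Q - {Y}. peirce_dim X Z) = (\<Sum>Z\<in>?Q - {Y}. partition_cartan n X Z)"
    by (intro sum.cong refl)
  then show ?case
    using sum_peirce_dim[OF X Y less.prems] sum.remove[OF finQ YQ, of "peirce_dim X"]
      sum.remove[OF finQ YQ, of "partition_cartan n X"] by simp
qed

text \<open>Each Peirce space sits in a single layer of the radical filtration: it is contained in
  the power given by the difference of block numbers and meets no higher one.\<close>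

lemma dim_rad_power_peirce:
  assumes X: "X \<in> partitions" and Y: "Y \<in> partitions"
  shows "wq.dim ((\<lambda>x. e Y \<star> x \<star> e X) ` rad_power W k) =
    (if card Y + k \<le> card X then partition_cartan n X Y else 0)"
proof (cases "finer X Y \<and> card Y + k \<le> card X")
  case True
  have idem: "e Y \<star> e Y = e Y" "e X \<star> e X = e X" by (simp_all add: saliola_orthogonal X Y)
  have k: "ideal_power W N (card X - card Y) \<subseteq> ideal_power W N k"
    using True by (intro ideal_power_antimono) linarith
  have "(\<lambda>x. e Y \<star> x \<star> e X) ` ideal_power W N k = (\<lambda>x. e Y \<star> x \<star> e X) ` W"
  proof
    show "(\<lambda>x. e Y \<star> x \<star> e X) ` ideal_power W N k \<subseteq> (\<lambda>x. e Y \<star> x \<star> e X) ` W"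
      using ideal_power_closed by blast
    show "(\<lambda>x. e Y \<star> x \<star> e X) ` W \<subseteq> (\<lambda>x. e Y \<star> x \<star> e X) ` ideal_power W N k"
    proof (rule image_subsetI)
      fix x assume "x \<in> W"
      then have "e Y \<star> x \<star> e X \<in> ideal_power W N k"
        using peirce_in_ideal_power[OF _ X Y] k by blast
      moreover have "e Y \<star> x \<star> e X = e Y \<star> (e Y \<star> x \<star> e X) \<star> e X"
        by (simp only: star_assoc idem) (simp only: star_assoc[symmetric] idem)
      ultimately show "e Y \<star> x \<star> e X \<in> (\<lambda>x. e Y \<star> x \<star> e X) ` ideal_power W N k" by blast
    qed
  qed
  then show ?thesis
    using True peirce_dim_eq[OF X, of Y] by (simp add: rad_power_eq peirce_dim_def)
next
  case False
  have "(\<lambda>x. e Y \<star> x \<star> e X) ` rad_power W k \<subseteq> wq.span {}"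
    using peirce_ideal_power_eq_0[OF _ X Y False] by (auto simp: rad_power_eq)
  then have "wq.dim ((\<lambda>x. e Y \<star> x \<star> e X) ` rad_power W k) = 0"
    using wq.dim_le_card[of _ "{}"] by simp
  then show ?thesis using False by (auto simp: partition_cartan_def)
qed

text \<open>Powers of the radical are two-sided ideals, so the comparison of corners passes from
  Saliola's family to any other with the same characters.\<close>

lemma dim_rad_power_labelled:
  assumes f: "labelled_idempotents W partitions f" and X: "X \<in> partitions" and Y: "Y \<in> partitions"
  shows "wq.dim ((\<lambda>x. f Y \<star> x \<star> f X) ` rad_power W k) =
    (if card Y + k \<le> card X then partition_cartan n X Y else 0)"
proof -
  have idf: "idempotent_in W (f Z)" "\<And>\<sigma>. \<sigma> \<in> partitions \<Longrightarrow> chi \<sigma> (f Z) = (if \<sigma> = Z then 1 else 0)"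
    if "Z \<in> partitions" for Z
    using f that unfolding labelled_idempotents_iff by auto
  have ide: "idempotent_in W (e Z)" "\<And>\<sigma>. \<sigma> \<in> partitions \<Longrightarrow> chi \<sigma> (e Z) = (if \<sigma> = Z then 1 else 0)"
    if "Z \<in> partitions" for Z
    using labelled_e that unfolding labelled_idempotents_iff by auto
  have sub: "ideal_power W N k \<subseteq> W" using ideal_power_closed by blast
  have fin: "ideal_power W N k \<subseteq> wq.span (NN ` packed_words n)" using sub W_finite_dim(2) by blast
  have "wq.dim ((\<lambda>x. f Y \<star> x \<star> f X) ` ideal_power W N k) =
      wq.dim ((\<lambda>x. e Y \<star> x \<star> e X) ` ideal_power W N k)"
    by (rule dim_peirce_eq[OF sub subspace_ideal_power _ _ W_finite_dim(1) fin
          idf(1)[OF Y] idf(1)[OF X] ide(1)[OF Y] ide(1)[OF X]])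
       (auto intro: ideal_power_left ideal_power_right simp: idf(2) ide(2) X Y)
  then show ?thesis using dim_rad_power_peirce[OF X Y, of k] by (simp add: rad_power_eq)
qed

end

text \<open>The dimension drops from \<open>c\<close> to 0 at the exponent \<open>d - d'\<close>
  alone. The hypothesis guards the truncated subtraction there.\<close>

lemma fps_graded_eq:
  fixes c d d' :: nat
  assumes "c \<noteq> 0 \<Longrightarrow> d' \<le> d"
  shows "Abs_fps (\<lambda>k. (if d' + k \<le> d then c else 0) - (if d' + Suc k \<le> d then c else 0)) =
    of_nat c * fps_X ^ (d - d')"
proof (rule fps_ext)
  fix k
  have "of_nat c = (fps_const c :: nat fps)" using fps_of_nat[of c, where 'a=nat] by simp
  then show "fps_nth (Abs_fps (\<lambda>k. (if d' + k \<le> d then c else 0) - (if d' + Suc k \<le> d then c else 0))) k =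
      fps_nth (of_nat c * fps_X ^ (d - d')) k"
    using assms by (cases "c = 0") (auto simp: fps_X_power_nth)
qed

lemma partition_cartan_refines: "partition_cartan n X Y \<noteq> 0 \<Longrightarrow> refines {1..n} X Y"
  by (auto simp: partition_cartan_def split: if_splits)

context wq_level begin

lemma q_cartan_labelled:
  assumes f: "labelled_idempotents W partitions f" and X: "X \<in> partitions" and Y: "Y \<in> partitions"
  shows "q_cartan_invariant W f X Y = partition_q_cartan n X Y"
  unfolding q_cartan_invariant_def partition_q_cartan_def dim_rad_power_labelled[OF assms]
  using refines_card(1)[OF partition_cartan_refines] by (intro fps_graded_eq) auto

lemma is_q_cartan_matrix_W: "is_q_cartan_matrix W partitions (partition_q_cartan n)"
  unfolding is_q_cartan_matrix_def using labelled_e q_cartan_labelled by blast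

end

section \<open>The idempotent defining the sharp algebra\<close>

lemma outer_product_linear_left: "Vector_Spaces.linear wscale wscale (\<lambda>F. F \<bullet> (G :: 'k::field wqsym))"
  unfolding outer_product_def by (rule bilinear_extension_linear_left)

lemma outer_product_linear_right: "Vector_Spaces.linear wscale wscale (\<lambda>G. (F :: 'k::field wqsym) \<bullet> G)"
  unfolding outer_product_def by (rule bilinear_extension_linear_right)

lemmas outer_product_sum_left = wqp.linear_sum[OF outer_product_linear_left]
  and outer_product_sum_right = wqp.linear_sum[OF outer_product_linear_right]

lemma outer_product_NN:
  "NN u \<bullet> NN v = (\<Sum>w\<in>shuffles u (map (\<lambda>i. i + max_letter u) v). NN w)"
  by (simp add: outer_product_def bilinear_extension_NN)

definition permutation_words :: "nat \<Rightarrow> nat list set" where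
  "permutation_words i = {u. distinct u \<and> set u = {1..i}}"

lemma finite_permutation_words [simp]: "finite (permutation_words i)"
  unfolding permutation_words_def
  by (rule finite_subset[OF _ finite_subset_distinct[of "{1..i}"]]) auto

lemma length_permutation_words: "u \<in> permutation_words i \<Longrightarrow> length u = i"
  by (auto simp: permutation_words_def dest: distinct_card)

lemma max_letter_permutation_words: "u \<in> permutation_words i \<Longrightarrow> max_letter u = i"
  by (simp add: permutation_words_def max_letter_eq)

text \<open>Left multiplication by \<open>NN [1]\<close> shifts a permutation and inserts the letter
  1 somewhere; erasing 1 recovers the permutation.\<close>

lemma permutation_words_Suc:
  "permutation_words (Suc i) = (\<Union>u\<in>permutation_words i. shuffles [1] (map (\<lambda>j. j + 1) u))"
proof (intro equalityI subsetI)
  fix w assume w: "w \<in> permutation_words (Suc i)"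
  let ?v = "filter (\<lambda>l. l \<noteq> 1) w"
  let ?u = "map (\<lambda>l. l - 1) ?v"
  have dw: "distinct w" and sw: "set w = {1..Suc i}" using w by (auto simp: permutation_words_def)
  have "filter (\<lambda>l. l = 1) w = [1]"
  proof -
    have "length (filter (\<lambda>l. l = 1) w) = card (set (filter (\<lambda>l. l = 1) w))"
      by (rule distinct_card[symmetric]) (simp add: dw)
    also have "set (filter (\<lambda>l. l = 1) w) = {1}" using sw by auto
    finally obtain a where a: "filter (\<lambda>l. l = 1) w = [a]" by (auto simp: length_Suc_conv One_nat_def)
    then have "a \<in> set (filter (\<lambda>l. l = 1) w)" by simp
    then have "a = 1" unfolding set_filter by blast
    then show ?thesis using a by simp
  qed
  moreover have "map (\<lambda>j. j + 1) ?u = ?v"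
    unfolding map_map by (rule map_idI) (use sw in auto)
  ultimately have "w \<in> shuffles [1] (map (\<lambda>j. j + 1) ?u)"
    using partition_in_shuffles[of w "\<lambda>l. l = 1"] by simp
  moreover have "?u \<in> permutation_words i"
  proof -
    have "inj_on (\<lambda>l. l - 1) (set ?v)" by (intro inj_onI) (use sw in auto)
    moreover have "set ?v = Suc ` {1..i}" using sw by (auto simp: image_Suc_atLeastAtMost)
    ultimately have "distinct ?u" "set ?u = (\<lambda>l. l - 1) ` Suc ` {1..i}"
      using dw by (simp_all only: distinct_map distinct_filter set_map)
    moreover have "(\<lambda>l. l - 1) ` Suc ` {1..i} = {1..i}" unfolding image_image by simp
    ultimately show ?thesis by (simp add: permutation_words_def)
  qed
  ultimately show "w \<in> (\<Union>u\<in>permutation_words i. shuffles [1] (map (\<lambda>j. j + 1) u))" by blast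
next
  fix w assume "w \<in> (\<Union>u\<in>permutation_words i. shuffles [1] (map (\<lambda>j. j + 1) u))"
  then obtain u where u: "u \<in> permutation_words i" "w \<in> shuffles [1] (map (\<lambda>j. j + 1) u)" by blast
  have su: "set (map (\<lambda>j. j + 1) u) = {2..Suc i}"
    using u(1) by (simp add: permutation_words_def image_Suc_atLeastAtMost)
  have "distinct (map (\<lambda>j. j + 1) u)" using u(1) by (auto simp: permutation_words_def distinct_map)
  then have "distinct w"
    using distinct_disjoint_shuffles[OF _ _ _ u(2)] su by auto
  moreover have "set w = {1..Suc i}"
    unfolding set_shuffles[OF u(2)] su by auto
  ultimately show "w \<in> permutation_words (Suc i)" by (simp add: permutation_words_def)
qed

text \<open>Each permutation word arises in exactly one way by successive insertions, so all
  coefficients are 1.\<close>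

lemma NN_1_power: "((\<lambda>F. NN [1] \<bullet> F) ^^ i) (NN []) = (\<Sum>u\<in>permutation_words i. NN u :: 'k::field wqsym)"
proof (induction i)
  case 0
  have "permutation_words 0 = {[]}" by (auto simp: permutation_words_def)
  then show ?case by simp
next
  case (Suc i)
  have max1: "max_letter [1] = 1" by (rule max_letter_eq) simp
  have "((\<lambda>F. NN [1] \<bullet> F) ^^ Suc i) (NN []) = NN [1] \<bullet> (\<Sum>u\<in>permutation_words i. NN u :: 'k wqsym)"
    using Suc by simp
  also have "\<dots> = (\<Sum>u\<in>permutation_words i. \<Sum>w\<in>shuffles [1] (map (\<lambda>j. j + 1) u). NN w)"
    unfolding outer_product_sum_right outer_product_NN max1 ..
  also have "\<dots> = (\<Sum>w\<in>permutation_words (Suc i). NN w)"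
    unfolding permutation_words_Suc
  proof (rule sum.UNION_disjoint[symmetric], safe)
    fix u u' w assume u: "u \<in> permutation_words i" "u' \<in> permutation_words i" "u \<noteq> u'"
      and w: "w \<in> shuffles [1] (map (\<lambda>j. j + 1) u)" "w \<in> shuffles [1] (map (\<lambda>j. j + 1) u')"
    have "filter (\<lambda>l. l \<notin> set [1]) w = map (\<lambda>j. j + 1) v"
      if "v \<in> permutation_words i" "w \<in> shuffles [1] (map (\<lambda>j. j + 1) v)" for v
      using that by (intro filter_shuffles_disjoint1(2)) (auto simp: permutation_words_def)
    then have "map (\<lambda>j. j + 1) u = map (\<lambda>j. j + 1) u'" using u w by metis
    then have "u = u'" by (rule map_injective) (auto simp: inj_def)
    then show "w \<in> {}" using u by simp
  qed auto
  finally show ?case .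
qed

text \<open>The words occurring in the i-th summand of \<open>S_sharp n\<close>: i singleton blocks
  in any order, followed by one block of all remaining positions, which is empty for i = n.\<close>

definition split_words :: "nat \<Rightarrow> nat \<Rightarrow> nat list set" where
  "split_words n i = {w. length w = n \<and> (\<forall>q<n. 1 \<le> w ! q \<and> w ! q \<le> Suc i) \<and>
    (\<forall>l\<in>{1..i}. \<exists>!q. q < n \<and> w ! q = l)}"

lemma split_words_eq_shuffles:
  assumes "i \<le> n"
  shows "split_words n i = (\<Union>u\<in>permutation_words i. shuffles u (replicate (n - i) (Suc i)))"
proof (intro equalityI subsetI)
  fix w assume w: "w \<in> split_words n i"
  let ?u = "filter (\<lambda>l. l \<le> i) w" and ?v = "filter (\<lambda>l. \<not> l \<le> i) w"
  have len: "length w = n" and range: "\<And>q. q < n \<Longrightarrow> 1 \<le> w ! q \<and> w ! q \<le> Suc i"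
    and uniq: "\<And>l. l \<in> {1..i} \<Longrightarrow> \<exists>!q. q < n \<and> w ! q = l"
    using w by (auto simp: split_words_def)
  have su: "set ?u = {1..i}"
  proof
    show "set ?u \<subseteq> {1..i}" using range len by (auto simp: in_set_conv_nth)
    show "{1..i} \<subseteq> set ?u"
    proof
      fix l assume l: "l \<in> {1..i}"
      then obtain q where "q < n" "w ! q = l" using uniq by blast
      then show "l \<in> set ?u" using l len nth_mem by auto
    qed
  qed
  have cnt: "count_list w l = 1" if l: "l \<in> {1..i}" for l
  proof -
    obtain q where q: "q < n" "w ! q = l" "\<And>q'. q' < n \<Longrightarrow> w ! q' = l \<Longrightarrow> q' = q"
      using uniq[OF l] by blast
    have "{q'. q' < length w \<and> l = w ! q'} = {q}" using q len by blast
    then show ?thesis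
      by (simp add: count_list_eq_length_filter length_filter_conv_card)
  qed
  have "length ?u = (\<Sum>l\<in>set ?u. count_list ?u l)" by (simp add: sum_count_set)
  also have "\<dots> = (\<Sum>l\<in>{1..i}. 1)"
    unfolding su
  proof (intro sum.cong refl)
    fix l assume l: "l \<in> {1..i}"
    have "filter (\<lambda>x. l = x) ?u = filter (\<lambda>x. l = x) w"
      using l unfolding filter_filter by (intro filter_cong) auto
    then show "count_list ?u l = 1" using cnt[OF l] by (simp add: count_list_eq_length_filter)
  qed
  finally have lu: "length ?u = i" by simp
  then have "distinct ?u" using su by (intro card_distinct) simp
  then have "?u \<in> permutation_words i" using su by (simp add: permutation_words_def)
  moreover have "?v = replicate (n - i) (Suc i)"
  proof -
    have "\<forall>x\<in>set ?v. x = Suc i" using range len by (force simp: in_set_conv_nth)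
    moreover have "length ?v = n - i"
      using sum_length_filter_compl[of "\<lambda>l. l \<le> i" w] lu len by simp
    ultimately show ?thesis using replicate_length_same[of ?v "Suc i"] by simp
  qed
  ultimately show "w \<in> (\<Union>u\<in>permutation_words i. shuffles u (replicate (n - i) (Suc i)))"
    using partition_in_shuffles[of w "\<lambda>l. l \<le> i"] by auto
next
  fix w assume "w \<in> (\<Union>u\<in>permutation_words i. shuffles u (replicate (n - i) (Suc i)))"
  then obtain u where u: "u \<in> permutation_words i" and w: "w \<in> shuffles u (replicate (n - i) (Suc i))"
    by blast
  have du: "distinct u" and su: "set u = {1..i}" using u by (auto simp: permutation_words_def)
  have len: "length w = n"
    using length_shuffles[OF w] length_permutation_words[OF u] assms by simp
  have sw: "set w \<subseteq> {1..Suc i}" "{1..i} \<subseteq> set w" using set_shuffles[OF w] su by auto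
  have "filter (\<lambda>x. x \<in> set u) w = u"
    by (rule filter_shuffles_disjoint1(1)[OF _ w]) (use su in auto)
  moreover have "\<exists>!q. q < n \<and> w ! q = l" if l: "l \<in> {1..i}" for l
  proof -
    have "filter (\<lambda>x. x = l) u = filter (\<lambda>x. x = l) w"
      using \<open>filter (\<lambda>x. x \<in> set u) w = u\<close> l su
      by (subst \<open>filter (\<lambda>x. x \<in> set u) w = u\<close>[symmetric], unfold filter_filter, intro filter_cong) auto
    moreover have "length (filter (\<lambda>x. x = l) u) = 1"
    proof -
      have "length (filter (\<lambda>x. x = l) u) = card (set (filter (\<lambda>x. x = l) u))"
        by (rule distinct_card[symmetric]) (simp add: du)
      also have "set (filter (\<lambda>x. x = l) u) = {l}" using l su by auto
      finally show ?thesis by simp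
    qed
    ultimately have "card {q. q < n \<and> w ! q = l} = 1"
      using len by (simp add: length_filter_conv_card)
    then obtain q where "{q. q < n \<and> w ! q = l} = {q}" by (rule card_1_singletonE)
    then show ?thesis by (intro ex1I[of _ q]) blast+
  qed
  moreover have "1 \<le> w ! q \<and> w ! q \<le> Suc i" if "q < n" for q
  proof -
    have "w ! q \<in> {1..Suc i}" using sw(1) nth_mem[of q w] that len by blast
    then show ?thesis by simp
  qed
  ultimately show "w \<in> split_words n i" using len by (simp add: split_words_def)
qed

lemma finite_split_words: "i \<le> n \<Longrightarrow> finite (split_words n i)"
  by (simp add: split_words_eq_shuffles)

text \<open>The letters up to \<open>i\<close> of a shuffle spell the permutation that it comes
  from, so the shuffles of different permutations do not overlap.\<close>

lemma S_sharp_summand: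
  assumes "i \<le> n"
  shows "((\<lambda>F. NN [1] \<bullet> F) ^^ i) (NN []) \<bullet> NN (replicate (n - i) 1) =
    (\<Sum>w\<in>split_words n i. NN w :: 'k::field wqsym)"
proof -
  have "((\<lambda>F. NN [1] \<bullet> F) ^^ i) (NN []) \<bullet> NN (replicate (n - i) 1) =
      (\<Sum>u\<in>permutation_words i. NN u \<bullet> (NN (replicate (n - i) 1) :: 'k wqsym))"
    unfolding NN_1_power outer_product_sum_left ..
  also have "\<dots> = (\<Sum>u\<in>permutation_words i. \<Sum>w\<in>shuffles u (replicate (n - i) (Suc i)). NN w)"
    by (intro sum.cong refl) (simp add: outer_product_NN max_letter_permutation_words plus_1_eq_Suc)
  also have "\<dots> = (\<Sum>w\<in>split_words n i. NN w)"
    unfolding split_words_eq_shuffles[OF assms]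
  proof (rule sum.UNION_disjoint[symmetric], safe)
    fix u u' w assume u: "u \<in> permutation_words i" "u' \<in> permutation_words i" "u \<noteq> u'"
      and w: "w \<in> shuffles u (replicate (n - i) (Suc i))" "w \<in> shuffles u' (replicate (n - i) (Suc i))"
    have "filter (\<lambda>l. l \<in> {1..i}) w = v"
      if "v \<in> permutation_words i" "w \<in> shuffles v (replicate (n - i) (Suc i))" for v
    proof -
      have "set v = {1..i}" using that(1) by (simp add: permutation_words_def)
      moreover have "set v \<inter> set (replicate (n - i) (Suc i)) = {}" using calculation by auto
      ultimately show ?thesis using filter_shuffles_disjoint1(1)[OF _ that(2)] by simp
    qed
    then show "w \<in> {}" using u w by metis
  qed auto
  finally show ?thesis .
qed

lemma S_sharp_eq:
  "S_sharp n = (\<Sum>i\<le>n. wscale ((-1) ^ i / fact i) (\<Sum>w\<in>split_words n i. NN w))"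
  unfolding S_sharp_def by (intro sum.cong refl) (simp add: S_sharp_summand)

lemma split_words_packed:
  assumes w: "w \<in> split_words n i"
  shows "w \<in> packed_words n"
proof -
  have len: "length w = n" using w by (simp add: split_words_def)
  have ins: "insert (Suc i) {1..i} = {1..Suc i}" by auto
  have sub: "set w \<subseteq> insert (Suc i) {1..i}"
    unfolding ins using w by (auto simp: split_words_def in_set_conv_nth)
  have sup: "{1..i} \<subseteq> set w"
  proof
    fix l assume "l \<in> {1..i}"
    then obtain q where "q < n" "w ! q = l" using w unfolding split_words_def by blast
    then show "l \<in> set w" using len nth_mem by auto
  qed
  have "set w = {1..i} \<or> set w = insert (Suc i) {1..i}"
  proof (cases "Suc i \<in> set w")
    case True
    then have "insert (Suc i) {1..i} \<subseteq> set w" using sup by blast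
    then show ?thesis using sub by (intro disjI2 equalityI)
  next
    case False
    then show ?thesis using sub sup by (simp add: subset_insert)
  qed
  then have "set w = {1..i} \<or> set w = {1..Suc i}" unfolding ins .
  then show ?thesis using len by (auto simp: packed_words_def packed_iff)
qed

section \<open>Words with a letter that occurs once\<close>

definition unitary_words :: "nat \<Rightarrow> nat list set" where
  "unitary_words n = {u \<in> packed_words n. \<exists>p<n. \<forall>q<n. u ! q = u ! p \<longrightarrow> q = p}"

lemma split_words_unitary:
  assumes w: "w \<in> split_words n i" and "1 \<le> i"
  shows "w \<in> unitary_words n"
proof -
  have "1 \<in> {1..i}" using assms by simp
  then have "\<exists>!q. q < n \<and> w ! q = 1" using w unfolding split_words_def by blast
  then obtain p where p: "p < n" "w ! p = 1" "\<And>q. q < n \<Longrightarrow> w ! q = 1 \<Longrightarrow> q = p" by blast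
  have "\<forall>q<n. w ! q = w ! p \<longrightarrow> q = p" unfolding p(2) using p(3) by blast
  then show ?thesis using split_words_packed[OF w] p(1) unfolding unitary_words_def by blast
qed

lemma split_words_0: "split_words n 0 = {replicate n 1}"
proof -
  have "split_words n 0 = {w. length w = n \<and> (\<forall>q<n. w ! q = 1)}"
    unfolding split_words_def by (auto simp: One_nat_def intro: le_antisym)
  also have "\<dots> = {replicate n 1}"
    by (auto intro: nth_equalityI)
  finally show ?thesis .
qed

lemma S_sharp_in_WQ: "S_sharp n \<in> WQ n"
  unfolding S_sharp_eq
  by (intro wq.subspace_sum wq.subspace_scale subspace_WQ NN_in_WQ split_words_packed)

text \<open>The summand for 0 is the unit of the big algebra, and in every other summand the letter
  1 occurs exactly once.\<close>

lemma keys_S_sharp_minus_one: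
  "Poly_Mapping.keys (S_sharp n - NN (replicate n 1) :: 'k::field_char_0 wqsym) \<subseteq> unitary_words n"
proof -
  let ?f = "\<lambda>i. wscale ((-1) ^ i / fact i) (\<Sum>w\<in>split_words n i. NN w) :: 'k wqsym"
  have "S_sharp n = ?f 0 + (\<Sum>i\<in>{1..n}. ?f i)"
    unfolding S_sharp_eq atMost_atLeast0 One_nat_def by (rule sum.atLeast_Suc_atMost) simp
  moreover have "?f 0 = NN (replicate n 1)" by (simp add: split_words_0)
  ultimately have eq: "S_sharp n - NN (replicate n 1) = (\<Sum>i\<in>{1..n}. ?f i)" by simp
  have "Poly_Mapping.lookup (S_sharp n - NN (replicate n 1) :: 'k wqsym) w = 0" if "w \<notin> unitary_words n" for w
    unfolding eq lookup_sum lookup_wscale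
  proof (intro sum.neutral ballI)
    fix i assume "i \<in> {1..n}"
    then have "(\<Sum>v\<in>split_words n i. Poly_Mapping.lookup (NN v :: 'k wqsym) w) = 0"
      using that split_words_unitary[of _ n i] by (intro sum.neutral) (auto simp: lookup_NN)
    then show "(-1) ^ i / fact i * (\<Sum>v\<in>split_words n i. Poly_Mapping.lookup (NN v :: 'k wqsym) w) = 0" by simp
  qed
  then show ?thesis by (auto simp: in_keys_iff)
qed

text \<open>
  Since \<open>u\<close> separates \<open>p\<close> from all other positions, \<open>pack u w\<close> does not depend on the letter of
  \<open>w\<close> at \<open>p\<close>, which can be inserted in \<open>i + 1\<close> ways. This makes \<open>NN u \<star> S_sharp n\<close> telescope.
\<close>

lemma sum_singled_out:
  assumes u: "u \<in> packed_words n" and p: "p < n" "\<And>q. q < n \<Longrightarrow> u ! q = u ! p \<Longrightarrow> q = p"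
  shows "(\<Sum>w | w \<in> split_words n (Suc i) \<and> w ! p \<le> Suc i. NN (pack u w)) =
    wscale (of_nat (Suc i)) (\<Sum>w | w \<in> split_words n i \<and> w ! p = Suc i. NN (pack u w) :: 'k::field wqsym)"
proof -
  define A where "A = {w. w \<in> split_words n (Suc i) \<and> w ! p \<le> Suc i}"
  define B where "B = {w. w \<in> split_words n i \<and> w ! p = Suc i}"
  \<comment> \<open>\<open>up k\<close> makes room for the letter \<open>k\<close>, and
    \<open>down k\<close> closes the gap that its removal leaves. \<open>F\<close> inserts
    \<open>k\<close> at \<open>p\<close>; \<open>G\<close> gives \<open>p\<close> the last letter
    and records the old one.\<close>
  define up where "up k l = (if k \<le> l then Suc l else l)" for k l :: nat
  define down where "down k l = (if k < l then l - 1 else l)" for k l :: nat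
  define F where "F = (\<lambda>(w, k). (map (up k) w)[p := k])"
  define G where "G w = ((map (down (w ! p)) w)[p := Suc i], w ! p)" for w
  have lenA: "length w = n" if "w \<in> A" for w using that by (simp add: A_def split_words_def)
  have lenB: "length w = n" if "w \<in> B" for w using that by (simp add: B_def split_words_def)
  have lenu: "length u = n" using u by (simp add: packed_words_def)
  have F_nth: "F (w, k) ! q = (if q = p then k else up k (w ! q))" if "w \<in> B" "q < n" for w k q
    using that lenB[of w] p by (simp add: F_def nth_list_update)
  have G_nth: "fst (G w) ! q = (if q = p then Suc i else down (w ! p) (w ! q))" if "w \<in> A" "q < n" for w q
    using that lenA[of w] p by (simp add: G_def nth_list_update)
  have FA: "F (w, k) \<in> A" if w: "w \<in> B" and k: "k \<in> {1..Suc i}" for w k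
  proof -
    have range: "1 \<le> w ! q \<and> w ! q \<le> Suc i" if "q < n" for q
      using w that by (auto simp: B_def split_words_def)
    have uniq: "\<exists>!q. q < n \<and> w ! q = l" if "l \<in> {1..i}" for l
      using w that by (auto simp: B_def split_words_def)
    have wp: "w ! p = Suc i" using w by (simp add: B_def)
    have len: "length (F (w, k)) = n" using lenB[OF w] by (simp add: F_def)
    have "\<exists>!q. q < n \<and> F (w, k) ! q = l" if l: "l \<in> {1..Suc i}" for l
    proof (cases "l = k")
      case True
      show ?thesis
        by (rule ex1I[of _ p]) (use p F_nth[OF w] True in \<open>auto simp: up_def split: if_splits\<close>)
    next
      case False
      define l' where "l' = (if k < l then l - 1 else l)"
      have "l' \<in> {1..i}" using l k False by (auto simp: l'_def)
      then obtain q where q: "q < n" "w ! q = l'" "\<And>q'. q' < n \<Longrightarrow> w ! q' = l' \<Longrightarrow> q' = q"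
        using uniq by metis
      have "q \<noteq> p" using q(2) wp \<open>l' \<in> {1..i}\<close> by auto
      have iff: "up k m = l \<longleftrightarrow> m = l'" for m
        using False by (auto simp: up_def l'_def)
      show ?thesis
      proof (rule ex1I[of _ q])
        show "q < n \<and> F (w, k) ! q = l"
          using q(1,2) \<open>q \<noteq> p\<close> F_nth[OF w q(1)] iff by simp
        fix q' assume q': "q' < n \<and> F (w, k) ! q' = l"
        then have "q' \<noteq> p" using F_nth[OF w, of q' k] False by auto
        then have "up k (w ! q') = l" using q' F_nth[OF w, of q' k] by simp
        then show "q' = q" using q(3) q' iff by blast
      qed
    qed
    moreover have "1 \<le> F (w, k) ! q \<and> F (w, k) ! q \<le> Suc (Suc i)" if "q < n" for q
      using range[OF that] k F_nth[OF w that] by (auto simp: up_def)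
    ultimately have "F (w, k) \<in> split_words n (Suc i)" using len by (simp add: split_words_def)
    then show ?thesis using F_nth[OF w p(1)] k by (simp add: A_def)
  qed
  have GB: "fst (G w) \<in> B" "snd (G w) \<in> {1..Suc i}" if w: "w \<in> A" for w
  proof -
    let ?k = "w ! p"
    have range: "1 \<le> w ! q \<and> w ! q \<le> Suc (Suc i)" if "q < n" for q
      using w that by (auto simp: A_def split_words_def)
    have uniq: "\<exists>!q. q < n \<and> w ! q = l" if "l \<in> {1..Suc i}" for l
      using w that by (auto simp: A_def split_words_def)
    have k: "?k \<in> {1..Suc i}" using range[OF p(1)] w by (simp add: A_def)
    have other: "w ! q \<noteq> ?k" if "q < n" "q \<noteq> p" for q
      using uniq[OF k] that p by blast
    have len: "length (fst (G w)) = n" using lenA[OF w] by (simp add: G_def)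
    have "\<exists>!q. q < n \<and> fst (G w) ! q = l" if l: "l \<in> {1..i}" for l
    proof -
      define l' where "l' = (if ?k \<le> l then Suc l else l)"
      have "l' \<in> {1..Suc i}" using l by (auto simp: l'_def)
      then obtain q where q: "q < n" "w ! q = l'" "\<And>q'. q' < n \<Longrightarrow> w ! q' = l' \<Longrightarrow> q' = q"
        using uniq by metis
      have "q \<noteq> p" using q(2) by (auto simp: l'_def split: if_splits)
      have iff: "down ?k m = l \<longleftrightarrow> m = l'" if "m \<noteq> ?k" for m
        using that by (auto simp: down_def l'_def)
      show ?thesis
      proof (rule ex1I[of _ q])
        show "q < n \<and> fst (G w) ! q = l"
          using q(1,2) \<open>q \<noteq> p\<close> G_nth[OF w q(1)] iff[OF other[OF q(1) \<open>q \<noteq> p\<close>]] by simp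
        fix q' assume q': "q' < n \<and> fst (G w) ! q' = l"
        then have "q' \<noteq> p" using G_nth[OF w, of q'] l by auto
        then have "down ?k (w ! q') = l" using q' G_nth[OF w, of q'] by simp
        then show "q' = q" using q' \<open>q' \<noteq> p\<close> iff[OF other[of q']] q(3) by blast
      qed
    qed
    moreover have "1 \<le> fst (G w) ! q \<and> fst (G w) ! q \<le> Suc i" if "q < n" for q
      using range[OF that] range[OF p(1)] k other[OF that] G_nth[OF w that] by (auto simp: down_def)
    ultimately have "fst (G w) \<in> split_words n i" using len by (simp add: split_words_def)
    then show "fst (G w) \<in> B" using G_nth[OF w p(1)] by (simp add: B_def)
    show "snd (G w) \<in> {1..Suc i}" using k by (simp add: G_def)
  qed
  have FG: "F (G w) = w" if w: "w \<in> A" for w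
  proof (rule nth_equalityI)
    have B: "fst (G w) \<in> B" and snd: "snd (G w) = w ! p" using GB(1)[OF w] by (auto simp: G_def)
    have eq: "F (G w) = F (fst (G w), snd (G w))" by simp
    show "length (F (G w)) = length w"
      using lenA[OF w] by (simp add: F_def G_def)
    fix q assume "q < length (F (G w))"
    then have q: "q < n" using lenA[OF w] by (simp add: F_def G_def)
    have "w ! p \<in> {1..Suc i}" using GB(2)[OF w] snd by simp
    then have uniq: "\<exists>!q. q < n \<and> w ! q = w ! p" using w unfolding A_def split_words_def by blast
    show "F (G w) ! q = w ! q"
    proof (cases "q = p")
      case False
      then have "w ! q \<noteq> w ! p" using uniq q p by blast
      then have "up (w ! p) (down (w ! p) (w ! q)) = w ! q" by (auto simp: up_def down_def)
      then show ?thesis unfolding eq F_nth[OF B q] snd using False G_nth[OF w q] by simp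
    qed (unfold eq F_nth[OF B q] snd, simp)
  qed
  have GF: "G (F (w, k)) = (w, k)" if w: "w \<in> B" and k: "k \<in> {1..Suc i}" for w k
  proof -
    have A: "F (w, k) \<in> A" by (rule FA[OF w k])
    have kp: "F (w, k) ! p = k" using F_nth[OF w p(1)] by simp
    have "fst (G (F (w, k))) = w"
    proof (rule nth_equalityI)
      show "length (fst (G (F (w, k)))) = length w" by (simp add: G_def F_def)
      fix q assume "q < length (fst (G (F (w, k))))"
      then have q: "q < n" using lenB[OF w] by (simp add: G_def F_def)
      have "down k (up k (w ! q)) = w ! q" by (auto simp: up_def down_def)
      then show "fst (G (F (w, k))) ! q = w ! q"
        using G_nth[OF A q] F_nth[OF w q] kp w by (auto simp: B_def)
    qed
    moreover have "snd (G (F (w, k))) = k" using kp by (simp add: G_def)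
    ultimately show ?thesis by (simp add: prod_eq_iff)
  qed
  \<comment> \<open>Letters of the second word are compared only between positions with equal
    letters in \<open>u\<close>; \<open>p\<close> is alone in its class, and \<open>up k\<close> is
    strictly increasing elsewhere.\<close>
  have pack: "pack u (F (w, k)) = pack u w" if w: "w \<in> B" for w k
  proof (rule packed_words_eqI)
    have len: "length (F (w, k)) = n" "length w = n" using lenB[OF w] by (auto simp: F_def)
    then show "pack u (F (w, k)) \<in> packed_words n" "pack u w \<in> packed_words n"
      using lenu by (auto intro: pack_in_packed_words)
    fix a b assume ab: "a < n" "b < n"
    have "F (w, k) ! a \<le> F (w, k) ! b \<longleftrightarrow> w ! a \<le> w ! b" if "u ! a = u ! b"
    proof (cases "a = b")
      case False
      then have "a \<noteq> p" "b \<noteq> p" using p(2)[of a] p(2)[of b] that ab by auto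
      then show ?thesis using F_nth[OF w] ab by (auto simp: up_def)
    qed simp
    then show "pack u (F (w, k)) ! a \<le> pack u (F (w, k)) ! b \<longleftrightarrow> pack u w ! a \<le> pack u w ! b"
      using ab len lenu by (auto simp: pack_le_iff)
  qed
  have "(\<Sum>w\<in>A. NN (pack u w)) = (\<Sum>(w, k)\<in>B \<times> {1..Suc i}. NN (pack u w) :: 'k wqsym)"
  proof (rule sum.reindex_bij_witness[of _ F G])
    fix w assume w: "w \<in> A"
    show "F (G w) = w" by (rule FG[OF w])
    show "G w \<in> B \<times> {1..Suc i}" using GB[OF w] by (simp add: mem_Times_iff)
    have "pack u (fst (G w)) = pack u w"
      using pack[OF GB(1)[OF w], of "snd (G w)"] FG[OF w] by simp
    then show "(case G w of (w, k) \<Rightarrow> NN (pack u w)) = (NN (pack u w) :: 'k wqsym)"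
      by (simp add: case_prod_beta)
  next
    fix wk assume "wk \<in> B \<times> {1..Suc i}"
    then show "G (F wk) = wk" "F wk \<in> A" using GF FA by auto
  qed
  also have "\<dots> = (\<Sum>w\<in>B. \<Sum>k\<in>{1..Suc i}. NN (pack u w))"
    by (rule sum.cartesian_product[symmetric])
  also have "\<dots> = wscale (of_nat (Suc i)) (\<Sum>w\<in>B. NN (pack u w))"
  proof -
    have "(\<Sum>k\<in>{1..m}. x) = wscale (of_nat m) x" for m :: nat and x :: "'k wqsym"
      by (induction m) (simp_all add: wq.scale_left_distrib atLeastAtMostSuc_conv add.commute)
    then show ?thesis by (simp only: wq.scale_sum_right)
  qed
  finally show ?thesis unfolding A_def B_def .
qed

text \<open>The i-th summand splits into \<open>a i\<close>, where the letter at \<open>p\<close> is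
  one of the single ones, and \<open>b i\<close>, where it is the last letter. Since
  \<open>a (i + 1)\<close> is \<open>i + 1\<close> times \<open>b i\<close>, the coefficients
  \<open>(-1)^i / i!\<close> make it cancel against \<open>b i\<close>.\<close>

lemma NN_unitary_star_S_sharp:
  assumes "u \<in> unitary_words n"
  shows "NN u \<star> S_sharp n = (0 :: 'k::field_char_0 wqsym)"
proof -
  obtain p where u: "u \<in> packed_words n" and p: "p < n" "\<And>q. q < n \<Longrightarrow> u ! q = u ! p \<Longrightarrow> q = p"
    using assms unfolding unitary_words_def by blast
  define a b :: "nat \<Rightarrow> 'k wqsym" where
    "a i = (\<Sum>w | w \<in> split_words n i \<and> w ! p \<le> i. NN (pack u w))" and
    "b i = (\<Sum>w | w \<in> split_words n i \<and> w ! p = Suc i. NN (pack u w))" for i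
  define c :: "nat \<Rightarrow> 'k" where "c i = (-1) ^ i / fact i" for i
  have star: "NN u \<star> NN w = (NN (pack u w) :: 'k wqsym)" if "w \<in> split_words n i" for w i
    using star_NN_packed[OF u split_words_packed[OF that]] .
  have ab: "(\<Sum>w\<in>split_words n i. NN u \<star> NN w) = a i + b i" if "i \<le> n" for i
  proof -
    have "split_words n i = {w. w \<in> split_words n i \<and> w ! p \<le> i} \<union> {w. w \<in> split_words n i \<and> w ! p = Suc i}"
      using p(1) by (auto simp: split_words_def le_Suc_eq)
    then have "(\<Sum>w\<in>split_words n i. NN (pack u w)) = a i + b i"
      unfolding a_def b_def using finite_split_words[OF that]
      by (subst sum.union_disjoint[symmetric]) auto
    moreover have "(\<Sum>w\<in>split_words n i. NN u \<star> NN w) = (\<Sum>w\<in>split_words n i. NN (pack u w) :: 'k wqsym)"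
      using star by (intro sum.cong refl)
    ultimately show ?thesis by simp
  qed
  have a_Suc: "wscale (c (Suc i)) (a (Suc i)) = - wscale (c i) (b i)" for i
  proof -
    have "a (Suc i) = wscale (of_nat (Suc i)) (b i)"
      unfolding a_def b_def by (rule sum_singled_out[OF u p])
    then have "wscale (c (Suc i)) (a (Suc i)) = wscale (c (Suc i) * of_nat (Suc i)) (b i)"
      by simp
    also have "c (Suc i) * of_nat (Suc i) = - c i"
      by (simp add: c_def field_simps del: of_nat_Suc)
    finally show ?thesis by simp
  qed
  have a_0: "a 0 = 0"
  proof -
    have "{w. w \<in> split_words n 0 \<and> w ! p \<le> 0} = {}"
      using p(1) by (auto simp: split_words_0)
    then show ?thesis unfolding a_def by (simp only: sum.empty)
  qed
  \<comment> \<open>The letters 1, ..., n occupy all \<open>n\<close> positions, so the letter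
    \<open>n + 1\<close> cannot occur.\<close>
  have b_n: "b n = 0"
  proof -
    have "w ! p \<noteq> Suc n" if w: "w \<in> split_words n n" for w
    proof
      assume "w ! p = Suc n"
      have len: "length w = n" using w by (simp add: split_words_def)
      have "{1..Suc n} \<subseteq> set w"
      proof
        fix l assume l: "l \<in> {1..Suc n}"
        show "l \<in> set w"
        proof (cases "l = Suc n")
          case True
          then show ?thesis using \<open>w ! p = Suc n\<close> len p nth_mem by metis
        next
          case False
          then have "l \<in> {1..n}" using l by auto
          then obtain q where "q < n" "w ! q = l" using w unfolding split_words_def by blast
          then show ?thesis using len nth_mem by metis
        qed
      qed
      then have "card {1..Suc n} \<le> card (set w)" by (intro card_mono) auto
      then show False using card_length[of w] len by simp
    qed
    then have "{w. w \<in> split_words n n \<and> w ! p = Suc n} = {}" by blast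
    then show ?thesis unfolding b_def by (simp only: sum.empty)
  qed
  have "NN u \<star> S_sharp n = (\<Sum>i\<le>n. wscale (c i) (\<Sum>w\<in>split_words n i. NN u \<star> NN w))"
    unfolding S_sharp_eq star_sum_right star_scale_right c_def ..
  also have "\<dots> = (\<Sum>i\<le>n. wscale (c i) (a i) + wscale (c i) (b i))"
    using ab by (intro sum.cong refl) (simp add: wq.scale_right_distrib)
  also have "\<dots> = wscale (c m) (b m)" if "m = n" for m
  proof -
    \<comment> \<open>A partial sum collapses to its last \<open>b\<close> term, starting from
      \<open>a 0 = 0\<close>.\<close>
    have "(\<Sum>i\<le>m. wscale (c i) (a i) + wscale (c i) (b i)) = wscale (c m) (b m)" for m
      by (induction m) (simp_all add: a_0 a_Suc)
    then show ?thesis using that by simp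
  qed
  finally show ?thesis using b_n by simp
qed

section \<open>The sharp algebra\<close>

lemma nonunitary_partitions_subset: "nonunitary_partitions n \<subseteq> set_partitions n"
  by (auto simp: nonunitary_partitions_def)

lemma unitary_words_iff:
  assumes "u \<in> packed_words n"
  shows "u \<in> unitary_words n \<longleftrightarrow> word_partition u \<notin> nonunitary_partitions n"
proof -
  have len: "length u = n" using assms by (simp add: packed_words_def)
  have P: "word_partition u \<in> set_partitions n" using assms by (rule word_partition_packed_words)
  let ?B = "\<lambda>p. {i \<in> {1..n}. u ! (i - 1) = u ! p}"
  have sing: "card (?B p) = 1 \<longleftrightarrow> (\<forall>q<n. u ! q = u ! p \<longrightarrow> q = p)" if p: "p < n" for p
  proof
    assume "card (?B p) = 1"
    then obtain i where i: "?B p = {i}" by (rule card_1_singletonE)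
    have mem: "Suc q \<in> ?B p" if "q < n" "u ! q = u ! p" for q using that by simp
    show "\<forall>q<n. u ! q = u ! p \<longrightarrow> q = p"
      using mem[of p] mem p unfolding i by (metis Suc_inject singletonD)
  next
    assume r: "\<forall>q<n. u ! q = u ! p \<longrightarrow> q = p"
    have "?B p = {Suc p}"
    proof
      show "?B p \<subseteq> {Suc p}"
      proof
        fix i assume "i \<in> ?B p"
        then have "1 \<le> i" "i - 1 < n" "u ! (i - 1) = u ! p" by auto
        then have "i - 1 = p" using r by blast
        then show "i \<in> {Suc p}" using \<open>1 \<le> i\<close> by simp
      qed
    qed (use p in simp)
    then show "card (?B p) = 1" by simp
  qed
  have "u \<in> unitary_words n \<longleftrightarrow> (\<exists>p<n. card (?B p) = 1)"
    using assms sing by (auto simp: unitary_words_def)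
  also have "\<dots> \<longleftrightarrow> (\<exists>A\<in>word_partition u. card A = 1)"
    unfolding Bex_def mem_word_partition_iff len by blast
  finally show ?thesis using P by (auto simp: nonunitary_partitions_def)
qed

text \<open>A singleton block of \<open>Y\<close> contains a nonempty block of \<open>X\<close>,
  which then is the same singleton.\<close>

lemma nonunitary_coarser:
  assumes "X \<in> nonunitary_partitions n" "refines {1..n} X Y"
  shows "Y \<in> nonunitary_partitions n"
proof -
  have XP: "partition_on {1..n} X" and YP: "partition_on {1..n} Y" using assms(2) by (auto simp: refines_def)
  have "card A \<noteq> 1" if A: "A \<in> Y" for A
  proof
    assume "card A = 1"
    then obtain p where p: "A = {p}" by (rule card_1_singletonE)
    have "p \<in> {1..n}" using A YP p by (auto simp: partition_on_def)
    then have "p \<in> \<Union> X" using XP by (simp add: partition_on_def)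
    then obtain B where B: "B \<in> X" "p \<in> B" by blast
    then obtain C where C: "C \<in> Y" "B \<subseteq> C" using assms(2) by (auto simp: refines_def)
    then have "C = A" using partition_on_block_unique[OF YP, of C A p] A B p by auto
    then have "B = {p}" using B C p by auto
    then show False using assms(1) B by (auto simp: nonunitary_partitions_def)
  qed
  then show ?thesis using YP by (simp add: nonunitary_partitions_def set_partitions_def)
qed

text \<open>Products have finer supports, and refining cannot destroy a singleton block. The words
  with a singleton block thus span a right ideal.\<close>

lemma keys_unitary_star:
  assumes "F \<in> WQ n" "G \<in> WQ n" "Poly_Mapping.keys F \<subseteq> unitary_words n"
  shows "Poly_Mapping.keys (F \<star> G) \<subseteq> unitary_words n"
proof
  fix w assume "w \<in> Poly_Mapping.keys (F \<star> G)"
  from keys_star[OF this] obtain u v where uv: "u \<in> Poly_Mapping.keys F" "v \<in> Poly_Mapping.keys G"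
    "w = pack u v" by blast
  have u: "u \<in> unitary_words n" "u \<in> packed_words n" and v: "v \<in> packed_words n"
    using uv assms by (auto simp: WQ_iff)
  have len: "length u = n" "length v = n" using u v by (auto simp: packed_words_def)
  have w: "w \<in> packed_words n" using uv len by (simp add: pack_in_packed_words)
  have "refines {1..n} (word_partition w) (word_partition u)"
    using word_partition_pack_refines(1)[OF len] uv by simp
  then show "w \<in> unitary_words n"
    using unitary_words_iff[OF w] unitary_words_iff[OF u(2)] u(1) nonunitary_coarser by blast
qed

lemma unitary_star_S_sharp:
  fixes F :: "'k::field_char_0 wqsym"
  assumes "Poly_Mapping.keys F \<subseteq> unitary_words n"
  shows "F \<star> S_sharp n = 0"
proof -
  have "F \<star> S_sharp n = (\<Sum>u\<in>Poly_Mapping.keys F. wscale (Poly_Mapping.lookup F u) (NN u \<star> S_sharp n))"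
    by (subst wq_expand) (simp add: star_sum_left star_scale_left)
  also have "\<dots> = 0"
    using assms by (intro sum.neutral) (auto simp: NN_unitary_star_S_sharp)
  finally show ?thesis .
qed

section \<open>The sharp algebra as a corner of the algebra of packed words\<close>

locale wq_sharp_level = wq_level n scalars
  for n :: nat and scalars :: "'k::field_char_0 itself"
begin

abbreviation s :: "'k wqsym" where "s \<equiv> S_sharp n"

abbreviation W' :: "'k wqsym set" where "W' \<equiv> WQ_sharp n"

abbreviation partitions' :: "nat set set set" where "partitions' \<equiv> nonunitary_partitions n"

lemma s_in_W: "s \<in> W"
  by (rule S_sharp_in_WQ)

lemma s_star_s: "s \<star> s = s"
proof -
  have "s \<star> s = W_one \<star> s + (s - W_one) \<star> s"
    by (simp flip: star_add_left)
  then show ?thesis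
    using one_left[OF s_in_W] unitary_star_S_sharp[OF keys_S_sharp_minus_one] by simp
qed

text \<open>\<open>s - W_one\<close> generates only words with a singleton block, and right
  multiplication by \<open>s\<close> kills these. This identity is what makes
  \<open>x \<mapsto> x \<star> s\<close> multiplicative.\<close>

lemma s_star_star_s:
  assumes "x \<in> W"
  shows "s \<star> x \<star> s = x \<star> s"
proof -
  have t: "s - W_one \<in> W" using s_in_W one_closed by (intro wq.subspace_diff subspace)
  have "s \<star> x \<star> s = W_one \<star> x \<star> s + (s - W_one) \<star> x \<star> s"
    by (simp flip: star_add_left)
  then show ?thesis
    using one_left[OF assms] unitary_star_S_sharp[OF keys_unitary_star[OF t assms keys_S_sharp_minus_one]] by simp
qed

text \<open>A partition without singletons refines no support that has one, so only the unit part of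
  \<open>s\<close> counts. For any other \<pi> the word of support \<pi> is killed by
  \<open>s\<close> although \<open>chi \<pi>\<close> is 1 on it.\<close>

lemma chi_s:
  assumes "\<pi> \<in> partitions"
  shows "chi \<pi> s = (if \<pi> \<in> partitions' then 1 else 0)"
proof (cases "\<pi> \<in> partitions'")
  case True
  have "chi \<pi> (s - W_one) = 0"
    unfolding chi_def
  proof (intro sum.neutral ballI)
    fix u assume "u \<in> Poly_Mapping.keys (s - W_one)"
    then have u: "u \<in> unitary_words n" using keys_S_sharp_minus_one by blast
    then have pu: "u \<in> packed_words n" by (simp add: unitary_words_def)
    then have "length u = n" by (simp add: packed_words_def)
    moreover have "\<not> finer \<pi> (word_partition u)"
      using u unitary_words_iff[OF pu] nonunitary_coarser[OF True] by blast
    ultimately show "Poly_Mapping.lookup (s - W_one) u *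
        (if refines {1..length u} \<pi> (word_partition u) then 1 else 0) = 0" by simp
  qed
  then show ?thesis using True chi_one[OF assms] by (simp add: chi_diff)
next
  case False
  let ?u = "partition_word n \<pi>"
  have u: "?u \<in> packed_words n" "word_partition ?u = \<pi>" "length ?u = n"
    using partition_word[OF assms] length_partition_word[OF assms] by auto
  then have "?u \<in> unitary_words n" using False unitary_words_iff by simp
  then have "chi \<pi> (NN ?u \<star> s) = 0" by (simp add: NN_unitary_star_S_sharp)
  moreover have "chi \<pi> (NN ?u :: 'k wqsym) = 1"
    using u refines_refl'[OF assms] by (simp add: chi_NN)
  ultimately show ?thesis
    using False chi_mult[OF assms NN_in_WQ[OF u(1)] s_in_W] by simp
qed

lemma W'_I: "x \<in> W \<Longrightarrow> x \<star> s \<in> W'"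
  by (auto simp: WQ_sharp_def)

lemma W'_D:
  assumes "x \<in> W'"
  shows "x \<in> W" "x \<star> s = x" "s \<star> x = x"
proof -
  obtain y where y: "y \<in> W" "x = y \<star> s" using assms by (auto simp: WQ_sharp_def)
  then show "x \<in> W" by (simp add: star_in_WQ s_in_W)
  show "x \<star> s = x" using y by (simp add: star_assoc s_star_s)
  show "s \<star> x = x" using y s_star_star_s by (simp add: star_assoc)
qed

lemma W'_iff: "x \<in> W' \<longleftrightarrow> x \<in> W \<and> x \<star> s = x"
  using W'_D W'_I by metis

lemma chi_W'_unitary:
  assumes "x \<in> W'" "\<sigma> \<in> partitions" "\<sigma> \<notin> partitions'"
  shows "chi \<sigma> x = 0"
  using chi_mult[OF assms(2) W'_D(1)[OF assms(1)] s_in_W] chi_s[OF assms(2)] assms(3) W'_D(2)[OF assms(1)]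
  by simp

end

sublocale wq_sharp_level \<subseteq> sharp: pointed_algebra W' s partitions'
proof unfold_locales
  show "wq.subspace W'"
    unfolding WQ_sharp_def by (rule wqp.linear_subspace_image[OF star_linear_left subspace])
  show "s \<in> W'" using s_in_W s_star_s by (simp add: W'_iff)
  fix x y assume xy: "x \<in> W'" "y \<in> W'"
  show "x \<star> y \<in> W'" using W'_D(1,2)[OF xy(2)] W'_D(1)[OF xy(1)] by (simp add: W'_iff star_in_WQ star_assoc)
  show "chi \<pi> (x \<star> y) = chi \<pi> x * chi \<pi> y" if "\<pi> \<in> partitions'" for \<pi>
    using that nonunitary_partitions_subset W'_D(1)[OF xy(1)] W'_D(1)[OF xy(2)]
    by (intro chi_mult) auto
next
  fix x assume "x \<in> W'"
  then show "s \<star> x = x" "x \<star> s = x" by (auto dest: W'_D)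
next
  fix \<pi> assume "\<pi> \<in> partitions'"
  then show "chi \<pi> s = 1" using chi_s[of \<pi>] nonunitary_partitions_subset by auto
qed

context wq_sharp_level begin

text \<open>Characters of partitions with singleton blocks vanish on the corner anyway, so its
  common kernel is the intersection with the big one.\<close>

lemma sharp_N_iff: "x \<in> sharp.N \<longleftrightarrow> x \<in> N \<and> x \<star> s = x"
proof
  assume x: "x \<in> sharp.N"
  then have "x \<in> W'" and chi: "\<And>\<pi>. \<pi> \<in> partitions' \<Longrightarrow> chi \<pi> x = 0"
    unfolding sharp.N_def by blast+
  have "chi \<pi> x = 0" if "\<pi> \<in> partitions" for \<pi>
    using chi chi_W'_unitary[OF \<open>x \<in> W'\<close> that] by (cases "\<pi> \<in> partitions'") auto
  then show "x \<in> N \<and> x \<star> s = x"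
    using W'_D[OF \<open>x \<in> W'\<close>] by (simp add: N_def)
next
  assume "x \<in> N \<and> x \<star> s = x"
  then show "x \<in> sharp.N"
    using nonunitary_partitions_subset by (auto simp: N_def sharp.N_def W'_iff)
qed

lemma N_star_s: "x \<in> N \<Longrightarrow> x \<star> s \<in> sharp.N"
  using N_right[OF _ s_in_W] by (simp add: sharp_N_iff star_assoc s_star_s)

end

sublocale wq_sharp_level \<subseteq> sharp: basic_algebra W' s partitions'
proof unfold_locales
  fix x assume "x \<in> sharp.N"
  then have "x \<in> N" by (simp add: sharp_N_iff)
  then obtain k where k: "(((\<star>) x) ^^ k) W_one = 0" using nil by blast
  have "(((\<star>) x) ^^ j) s = (((\<star>) x) ^^ j) W_one \<star> s" for j
    by (induction j) (simp_all add: one_left[OF s_in_W] star_assoc)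
  then show "\<exists>k. (((\<star>) x) ^^ k) s = 0" using k by (intro exI[of _ k]) simp
qed

context wq_sharp_level begin

text \<open>In a product \<open>(x \<star> s) \<star> y\<close> with \<open>y\<close> in the corner
  the inner \<open>s\<close> is absorbed by \<open>y\<close>; conversely
  \<open>(x \<star> s) \<star> (y \<star> s)\<close> equals
  \<open>(x \<star> y) \<star> s\<close>.\<close>

lemma sharp_ideal_power: "ideal_power W' sharp.N k = (\<lambda>x. x \<star> s) ` ideal_power W N k"
proof (induction k)
  case 0
  show ?case by (simp add: WQ_sharp_def)
next
  case (Suc k)
  have sub: "wq.subspace ((\<lambda>x. x \<star> s) ` ideal_power W N (Suc k))"
    by (rule wqp.linear_subspace_image[OF star_linear_left subspace_ideal_power])
  show ?case
  proof
    show "ideal_power W' sharp.N (Suc k) \<subseteq> (\<lambda>x. x \<star> s) ` ideal_power W N (Suc k)"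
    proof
      fix z assume "z \<in> ideal_power W' sharp.N (Suc k)"
      then show "z \<in> (\<lambda>x. x \<star> s) ` ideal_power W N (Suc k)"
      proof (induction rule: sharp.ideal_power_Suc_induct)
        case (star x y)
        then obtain x' where x': "x' \<in> ideal_power W N k" "x = x' \<star> s" using Suc by blast
        have y: "y \<in> N" "y \<star> s = y" using star by (auto simp: sharp_N_iff)
        have "s \<star> y = y" using s_star_star_s[OF N_closed[OF y(1)]] y(2) by (simp add: star_assoc)
        then have "x \<star> y = (x' \<star> y) \<star> s" using x' y by (simp add: star_assoc)
        moreover have "x' \<star> y \<in> ideal_power W N (Suc k)" using x' y by (intro ideal_power_Suc_I)
        ultimately show ?case by blast
      qed (use sub in \<open>blast intro: wq.subspace_0 wq.subspace_add wq.subspace_scale\<close>)+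
    qed
    have "z \<star> s \<in> ideal_power W' sharp.N (Suc k)" if "z \<in> ideal_power W N (Suc k)" for z
      using that
    proof (induction rule: ideal_power_Suc_induct)
      case (star x y)
      have "x \<star> s \<in> ideal_power W' sharp.N k" using star Suc by blast
      then have "(x \<star> s) \<star> (y \<star> s) \<in> ideal_power W' sharp.N (Suc k)"
        using N_star_s star by (intro sharp.ideal_power_Suc_I)
      moreover have "(x \<star> s) \<star> (y \<star> s) = (x \<star> y) \<star> s"
        using s_star_star_s[OF N_closed[OF star(2)]] by (simp add: star_assoc)
      ultimately show ?case by simp
    next
      case zero
      then show ?case
        using wq.subspace_0[OF sharp.subspace_ideal_power] by (simp only: star_zero_left)
    next
      case (add x y)
      then show ?case
        using wq.subspace_add[OF sharp.subspace_ideal_power] by (simp only: star_add_left)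
    next
      case (scale c x)
      then show ?case
        using wq.subspace_scale[OF sharp.subspace_ideal_power] by (simp only: star_scale_left)
    qed
    then show "(\<lambda>x. x \<star> s) ` ideal_power W N (Suc k) \<subseteq> ideal_power W' sharp.N (Suc k)" by blast
  qed
qed

text \<open>Idempotents of the corner are idempotents of the big algebra, where the characters of
  the remaining partitions vanish on them. Any choice for the corner is therefore part of a choice
  for the big algebra.\<close>

lemma labelled_extend:
  assumes "labelled_idempotents W' partitions' f"
  shows "labelled_idempotents W partitions (\<lambda>\<pi>. if \<pi> \<in> partitions' then f \<pi> else e \<pi>)"
  unfolding labelled_idempotents_iff
proof (intro ballI conjI)
  fix \<pi> assume \<pi>: "\<pi> \<in> partitions"
  have f: "idempotent_in W' (f \<pi>)" "\<And>\<sigma>. \<sigma> \<in> partitions' \<Longrightarrow> chi \<sigma> (f \<pi>) = (if \<sigma> = \<pi> then 1 else 0)"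
    if "\<pi> \<in> partitions'"
    using assms that unfolding sharp.labelled_idempotents_iff by auto
  have e: "idempotent_in W (e \<pi>)" "\<And>\<sigma>. \<sigma> \<in> partitions \<Longrightarrow> chi \<sigma> (e \<pi>) = (if \<sigma> = \<pi> then 1 else 0)"
    using labelled_e \<pi> unfolding labelled_idempotents_iff by auto
  show "idempotent_in W (if \<pi> \<in> partitions' then f \<pi> else e \<pi>)"
    using e(1) f(1) W'_D(1) by (auto simp: idempotent_in_def)
  fix \<sigma> assume \<sigma>: "\<sigma> \<in> partitions"
  show "chi \<sigma> (if \<pi> \<in> partitions' then f \<pi> else e \<pi>) = (if \<sigma> = \<pi> then 1 else 0)"
  proof (cases "\<pi> \<in> partitions'")
    case True
    then have "f \<pi> \<in> W'" using f(1) by (simp add: idempotent_in_def)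
    then have "chi \<sigma> (f \<pi>) = (if \<sigma> = \<pi> then 1 else 0)"
      using f(2)[OF True] chi_W'_unitary[OF _ \<sigma>] True by (cases "\<sigma> \<in> partitions'") auto
    then show ?thesis using True by simp
  qed (simp add: e(2)[OF \<sigma>])
qed

lemma labelled_e_s: "labelled_idempotents W' partitions' (\<lambda>\<pi>. e \<pi> \<star> s)"
  unfolding sharp.labelled_idempotents_iff
proof (intro ballI conjI)
  fix \<pi> assume "\<pi> \<in> partitions'"
  then have \<pi>: "\<pi> \<in> partitions" using nonunitary_partitions_subset by blast
  have "(e \<pi> \<star> s) \<star> (e \<pi> \<star> s) = (e \<pi> \<star> e \<pi>) \<star> s"
    using s_star_star_s[OF e_in_W[OF \<pi>]] by (simp add: star_assoc)
  then show "idempotent_in W' (e \<pi> \<star> s)"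
    using W'_I[OF e_in_W[OF \<pi>]] \<pi> by (simp add: idempotent_in_def saliola_orthogonal)
  fix \<sigma> assume \<sigma>: "\<sigma> \<in> partitions'"
  then have "\<sigma> \<in> partitions" using nonunitary_partitions_subset by blast
  then show "chi \<sigma> (e \<pi> \<star> s) = (if \<sigma> = \<pi> then 1 else 0)"
    using \<sigma> chi_mult[OF _ e_in_W[OF \<pi>] s_in_W] chi_s chi_saliola[OF \<pi>, of \<sigma>, where 'k='k] by simp
qed

text \<open>The radical powers of the corner are those of the big algebra times \<open>s\<close>,
  and this \<open>s\<close> is absorbed by \<open>f \<alpha>\<close>.\<close>

lemma q_cartan_sharp:
  assumes f: "labelled_idempotents W' partitions' f" and \<alpha>: "\<alpha> \<in> partitions'" and \<beta>: "\<beta> \<in> partitions'"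
  shows "q_cartan_invariant W' f \<alpha> \<beta> =
    q_cartan_invariant W (\<lambda>\<pi>. if \<pi> \<in> partitions' then f \<pi> else e \<pi>) \<alpha> \<beta>"
proof -
  have "f \<alpha> \<in> W'"
    using f \<alpha> unfolding sharp.labelled_idempotents_iff by (simp add: idempotent_in_def)
  then have "s \<star> f \<alpha> = f \<alpha>" by (rule W'_D)
  then have "f \<beta> \<star> (x \<star> s) \<star> f \<alpha> = f \<beta> \<star> x \<star> f \<alpha>" for x
    by (simp add: star_assoc)
  then have "(\<lambda>x. f \<beta> \<star> x \<star> f \<alpha>) ` rad_power W' k = (\<lambda>x. f \<beta> \<star> x \<star> f \<alpha>) ` rad_power W k" for k
    unfolding rad_power_eq sharp.rad_power_eq sharp_ideal_power image_image by simp
  then show ?thesis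
    using \<alpha> \<beta> by (simp only: q_cartan_invariant_def if_True)
qed

lemma is_q_cartan_matrix_sharp:
  assumes "is_q_cartan_matrix W partitions C"
  shows "is_q_cartan_matrix W' partitions' C"
proof -
  have "q_cartan_invariant W' f \<alpha> \<beta> = C \<alpha> \<beta>"
    if f: "labelled_idempotents W' partitions' f" and "\<alpha> \<in> partitions'" "\<beta> \<in> partitions'" for f \<alpha> \<beta>
    using q_cartan_sharp[OF that] labelled_extend[OF f] assms that nonunitary_partitions_subset
    unfolding is_q_cartan_matrix_def by (metis (no_types, lifting) subsetD)
  then show ?thesis
    unfolding is_q_cartan_matrix_def using labelled_e_s by blast
qed

text \<open>A labelled family exists, and its invariants pin down the entries of the matrix.\<close>

lemma is_q_cartan_matrix_sharp_unique:
  assumes "is_q_cartan_matrix W' partitions' C" "\<alpha> \<in> partitions'" "\<beta> \<in> partitions'"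
  shows "C \<alpha> \<beta> = partition_q_cartan n \<alpha> \<beta>"
  using assms labelled_e_s is_q_cartan_matrix_sharp[OF is_q_cartan_matrix_W]
  unfolding is_q_cartan_matrix_def by metis

lemma quiver_vertices_sharp:
  "quiver_vertices_labelled TYPE('v::ab_group_add) W' s partitions'"
proof (rule sharp.quiver_vertices_labelled)
  show "finite partitions'"
    by (rule finite_subset[OF nonunitary_partitions_subset finite_set_partitions])
  show "e \<pi> \<star> s \<in> W'" if "\<pi> \<in> partitions'" for \<pi>
    using that nonunitary_partitions_subset by (intro W'_I e_in_W) auto
  show "chi \<sigma> (e \<pi> \<star> s) = (if \<sigma> = \<pi> then 1 else 0)" if "\<pi> \<in> partitions'" "\<sigma> \<in> partitions'" for \<pi> \<sigma>
    using labelled_e_s that unfolding sharp.labelled_idempotents_iff by blast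
qed

end

text \<open>Merging lowers the number of blocks by exactly one, as the union is not a block already;
  so the exponent of q is 1, and its coefficient is a product of factorials.\<close>

lemma num_arrows_merge:
  assumes \<alpha>: "\<alpha> \<in> set_partitions n" and \<beta>: "\<beta> \<in> set_partitions n" and merge: "merges_two_blocks \<alpha> \<beta>"
  shows "num_arrows (partition_q_cartan n) \<alpha> \<beta> \<ge> 1"
proof -
  obtain A A' where A: "A \<in> \<alpha>" "A' \<in> \<alpha>" "A \<noteq> A'" and \<beta>_eq: "\<beta> = insert (A \<union> A') (\<alpha> - {A, A'})"
    using merge unfolding merges_two_blocks_def by blast
  have part: "partition_on {1..n} \<alpha>" using \<alpha> by (simp add: set_partitions_def)
  have fin: "finite \<alpha>" using \<alpha> by (rule finite_set_partition)
  have "refines {1..n} \<alpha> \<beta>"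
    unfolding refines_def using \<alpha> \<beta> \<beta>_eq by (auto simp: set_partitions_def)
  then have "partition_cartan n \<alpha> \<beta> \<ge> 1"
    by (simp add: partition_cartan_def Suc_le_eq One_nat_def prod_pos)
  moreover have "card \<alpha> - card \<beta> = 1"
  proof -
    have "A \<union> A' \<notin> \<alpha>"
    proof
      assume mem: "A \<union> A' \<in> \<alpha>"
      have "A \<noteq> {}" "A' \<noteq> {}" using A part by (auto simp: partition_on_def)
      then obtain p q where "p \<in> A" "q \<in> A'" by blast
      then have "A \<union> A' = A" "A \<union> A' = A'"
        using partition_on_block_unique[OF part mem A(1), of p]
          partition_on_block_unique[OF part mem A(2), of q] by blast+
      then show False using A(3) by simp
    qed
    then have "card \<beta> = Suc (card (\<alpha> - {A, A'}))" using fin by (simp add: \<beta>_eq)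
    moreover have "card (\<alpha> - {A, A'}) = card \<alpha> - 2"
      using A fin by (subst card_Diff_subset) auto
    moreover have "2 \<le> card \<alpha>"
      using A card_mono[of \<alpha> "{A, A'}"] fin by auto
    ultimately show ?thesis by simp
  qed
  moreover have "of_nat (partition_cartan n \<alpha> \<beta>) = fps_const (partition_cartan n \<alpha> \<beta>)"
    using fps_of_nat[of "partition_cartan n \<alpha> \<beta>", where 'a=nat] by simp
  ultimately show ?thesis
    unfolding num_arrows_def partition_q_cartan_def by simp
qed

theorem theorem3p5:
  fixes n :: nat
  assumes "1 \<le> n"
  shows "is_q_cartan_matrix (WQ n :: 'k::field_char_0 wqsym set) (set_partitions n)
           (partition_q_cartan n) \<and>
         (\<forall>C. is_q_cartan_matrix (WQ n :: 'k wqsym set) (set_partitions n) C \<longrightarrow>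
            is_q_cartan_matrix (WQ_sharp n :: 'k wqsym set) (nonunitary_partitions n) C) \<and>
         quiver_vertices_labelled TYPE('v::ab_group_add) (WQ_sharp n :: 'k wqsym set)
           (S_sharp n) (nonunitary_partitions n) \<and>
         (\<forall>C. is_q_cartan_matrix (WQ_sharp n :: 'k wqsym set) (nonunitary_partitions n) C \<longrightarrow>
            (\<forall>\<alpha>\<in>nonunitary_partitions n. \<forall>\<beta>\<in>nonunitary_partitions n.
               merges_two_blocks \<alpha> \<beta> \<longrightarrow> num_arrows C \<alpha> \<beta> \<ge> 1))"
proof -
  interpret wq_sharp_level n "TYPE('k)"
    by unfold_locales (rule assms)
  have "num_arrows C \<alpha> \<beta> \<ge> 1"
    if "is_q_cartan_matrix W' partitions' C" "\<alpha> \<in> partitions'" "\<beta> \<in> partitions'" "merges_two_blocks \<alpha> \<beta>"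
    for C \<alpha> \<beta>
  proof -
    \<comment> \<open>By uniqueness an arbitrary matrix of the corner may be replaced by the
      explicit one.\<close>
    have "num_arrows C \<alpha> \<beta> = num_arrows (partition_q_cartan n) \<alpha> \<beta>"
      using is_q_cartan_matrix_sharp_unique[OF that(1-3)] by (simp add: num_arrows_def)
    then show ?thesis
      using num_arrows_merge[of \<alpha> n \<beta>] that(2-4) nonunitary_partitions_subset by (auto simp: subset_iff)
  qed
  then show ?thesis
    using is_q_cartan_matrix_W is_q_cartan_matrix_sharp quiver_vertices_sharp by blast
qed

end
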